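(* Let $p\geq 3$ be a prime and let $\ell$ be a positive integer. (i) Assume that for every integer partition $\lambda=1^{m_1}2^{m_2}\cdots \ell^{m_\ell}$ (i.e. every $(m_1,\dots,m_\ell)\in\mathbb{N}^\ell$), as $d$ varies over the set of negative fundamental discriminants, the average of $|\mathrm{Cl}(K_d)[p]|^{m_1}|\mathrm{Cl}(K_d)[p^2]|^{m_2}\cdots|\mathrm{Cl}(K_d)[p^\ell]|^{m_\ell}$ is equal to $\sum_{\mu\subseteq\lambda}C_{\lambda,\mu}(p)$. Then for any integers $\mu_1\geq\mu_2\geq\cdots\geq\mu_\ell\geq 0$, as $d$ varies over the set of negative fundamental discriminants, the probability that $\mathrm{rk}_{p^j}(\mathrm{Cl}(K_d))=\mu_j$ for all $1\leq j\leq \ell$ is equal to $$\frac{(1/p^{\mu_\ell+1};1/p)_\infty}{p^{\mu_1^2+\cdots+\mu_\ell^2}\prod_{j=1}^{\ell}(1/p;1/p)_{\mu_j-\mu_{j+1}}},$$ where $\mu_{\ell+1}:=0$. (ii) Assume that for every positive integer $\ell$ and every partition $\lambda=1^{m_1}2^{m_2}\cdots\ell^{m_\ell}$, as $d$ varies over the set of positive fundamental discriminants, the average of $|\mathrm{Cl}(K_d)[p]|^{m_1}\cdots|\mathrm{Cl}(K_d)[p^\ell]|^{m_\ell}$ is equal to $\sum_{\mu\subseteq\lambda}C_{\lambda,\mu}(p)p^{-|\mu|}$. Then for any integers $\mu_1\geq\cdots\geq\mu_\ell\geq 0$, as $d$ varies over the set of positive fundamental discriminants, the probability that $\mathrm{rk}_{p^j}(\mathrm{Cl}(K_d))=\mu_j$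 for all $1\leq j\leq\ell$ is equal to $$\frac{(1/p^{\mu_\ell+2};1/p)_\infty}{p^{\mu_1^2+\cdots+\mu_\ell^2+(\mu_1+\cdots+\mu_\ell)}\prod_{j=1}^{\ell}(1/p;1/p)_{\mu_j-\mu_{j+1}}},$$ where $\mu_{\ell+1}:=0$.
   Context: For a fundamental discriminant $d$, $\mathrm{Cl}(K_d)$ is the class group of $K_d=\mathbb{Q}(\sqrt d)$. For a finite abelian group $G$, $G[n]$ denotes its $n$-torsion subgroup and the $p^j$-rank is $\mathrm{rk}_{p^j}(G)=\dim_{\mathbb{F}_p}p^{j-1}G/p^jG$. For a real function $f$ on isomorphism classes of finite abelian groups, $f(\mathrm{Cl}(K_d))$ has average value $c_\pm$ (over $\pm d>0$) if $\sum_{0<\pm d<X}f(\mathrm{Cl}(K_d))/\sum_{0<\pm d<X}1=c_\pm+o(1)$ as $X\to\infty$ (sums over fundamental discriminants); when $f$ is the indicator of a property, $c_\pm$ is called its probability. For $|q|<1$: $(a;q)_0=1$, $(a;q)_k=(1-a)(1-aq)\cdots(1-aq^{k-1})$ for $k>0$, $(a;q)_\infty=\lim_k(a;q)_k$, and $\binom{n}{k}_q=\frac{(q;q)_n}{(q;q)_k(q;q)_{n-k}}$ (a polynomial in $q$). A partition $\lambda=(\lambda_1\geq\lambda_2\geq\cdots)$ written $1^{m_1}\cdots\ell^{m_\ell}$ has $m_i$ parts equal to $i$; $|\lambda|=\sum_i\lambda_i$; its conjugate $\lambda'$ has $\lambda'_k=\sum_{j\geq k}m_j$; $\mu\subseteq\lambda$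 means $\mu_i\leq\lambda_i$ for all $i$, and the sum over $\mu\subseteq\lambda$ runs over all partitions $\mu$ with this property. For partitions $\lambda,\mu$ and a variable $x$ (here $x=p$), $$C_{\lambda,\mu}(x)=x^{\sum_{i\geq1}\mu'_{i+1}(\lambda'_i-\mu'_i)}\prod_{i\geq1}\binom{\lambda'_i-\mu'_{i+1}}{\lambda'_i-\mu'_i}_{x}$$ (the number of subgroups of type $\mu$ in an abelian $p$-group of type $\lambda$ when $x=p$). *)

theory Defs
  imports
    Complex_Main
    "HOL-Computational_Algebra.Computational_Algebra"
    "HOL-Algebra.Coset"
    "HOL-Algebra.FiniteProduct"
begin

section \<open>Quadratic fields and their class groups\<close>

text \<open>Only discriminants of quadratic fields count, so 1 is not fundamental.\<close>

definition fundamental_discriminant :: "int \<Rightarrow> bool" where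
  "fundamental_discriminant d \<longleftrightarrow>
     d \<noteq> 1 \<and>
     (d mod 4 = 1 \<and> squarefree d \<or>
      (\<exists>m. d = 4 * m \<and> (m mod 4 = 2 \<or> m mod 4 = 3) \<and> squarefree m))"

definition quadratic_field :: "int \<Rightarrow> complex set" where
  "quadratic_field d = {of_rat a + of_rat b * csqrt (of_int d) | a b. True}"

definition ring_of_integers :: "int \<Rightarrow> complex set" where
  "ring_of_integers d = {x \<in> quadratic_field d. algebraic_int x}"

definition fractional_ideal :: "int \<Rightarrow> complex set \<Rightarrow> bool" where
  "fractional_ideal d I \<longleftrightarrow>
     I \<subseteq> quadratic_field d \<and> 0 \<in> I \<and> I \<noteq> {0} \<and>
     (\<forall>x\<in>I. \<forall>y\<in>I. x + y \<in> I) \<and>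
     (\<forall>a\<in>ring_of_integers d. \<forall>x\<in>I. a * x \<in> I) \<and>
     (\<exists>c\<in>ring_of_integers d. c \<noteq> 0 \<and> (\<forall>x\<in>I. c * x \<in> ring_of_integers d))"

definition ideal_product :: "complex set \<Rightarrow> complex set \<Rightarrow> complex set" where
  "ideal_product I J =
     {\<Sum>k<n. a k * b k | (n::nat) a b. \<forall>k<n. a k \<in> I \<and> b k \<in> J}"

definition fractional_ideal_group :: "int \<Rightarrow> complex set monoid" where
  "fractional_ideal_group d =
     \<lparr>carrier = {I. fractional_ideal d I}, mult = ideal_product, one = ring_of_integers d\<rparr>"

definition principal_fractional_ideals :: "int \<Rightarrow> complex set set" where
  "principal_fractional_ideals d =
     {(\<lambda>x. a * x) ` ring_of_integers d | a. a \<in> quadratic_field d \<and> a \<noteq> 0}"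

definition class_group :: "int \<Rightarrow> complex set set monoid" where
  "class_group d = fractional_ideal_group d Mod principal_fractional_ideals d"


section \<open>Torsion and ranks of (multiplicatively written) abelian groups\<close>

definition torsion :: "('a, 'm) monoid_scheme \<Rightarrow> nat \<Rightarrow> 'a set" where
  "torsion G n = {x \<in> carrier G. x [^]\<^bsub>G\<^esub> n = \<one>\<^bsub>G\<^esub>}"

definition power_subgroup :: "('a, 'm) monoid_scheme \<Rightarrow> nat \<Rightarrow> 'a set" where
  "power_subgroup G n = (\<lambda>x. x [^]\<^bsub>G\<^esub> n) ` carrier G"

text \<open>
  An abelian group \<open>V\<close> of exponent dividing \<open>p\<close> is a vector space over the field with \<open>p\<close>
  elements, the residue class of \<open>c\<close> acting on \<open>v\<close> by \<open>v [^] c\<close>. Scalars are represented by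
  \<open>{..<p}\<close>; only finite bases are considered.
\<close>

definition Fp_basis :: "nat \<Rightarrow> ('a, 'm) monoid_scheme \<Rightarrow> 'a set \<Rightarrow> bool" where
  "Fp_basis p V B \<longleftrightarrow>
     finite B \<and> B \<subseteq> carrier V \<and>
     (\<forall>v\<in>carrier V. \<exists>!c. c \<in> B \<rightarrow>\<^sub>E {..<p} \<and> v = finprod V (\<lambda>b. b [^]\<^bsub>V\<^esub> (c b :: nat)) B)"

definition Fp_dim :: "nat \<Rightarrow> ('a, 'm) monoid_scheme \<Rightarrow> nat" where
  "Fp_dim p V = (THE n. \<exists>B. Fp_basis p V B \<and> card B = n)"

definition prime_power_rank :: "nat \<Rightarrow> nat \<Rightarrow> ('a, 'm) monoid_scheme \<Rightarrow> nat" where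
  "prime_power_rank p j G =
     Fp_dim p (G\<lparr>carrier := power_subgroup G (p ^ (j - 1))\<rparr> Mod power_subgroup G (p ^ j))"


section \<open>Averages over fundamental discriminants\<close>

text \<open>The parameter \<open>s\<close> is the sign: \<open>1\<close> for positive and \<open>- 1\<close> for negative discriminants.\<close>

definition discriminants_below :: "int \<Rightarrow> real \<Rightarrow> int set" where
  "discriminants_below s X =
     {d. fundamental_discriminant d \<and> 0 < s * d \<and> real_of_int (s * d) < X}"

definition class_group_average ::
    "int \<Rightarrow> (complex set set monoid \<Rightarrow> real) \<Rightarrow> real \<Rightarrow> bool" where
  "class_group_average s f c \<longleftrightarrow>
     ((\<lambda>X. (\<Sum>d\<in>discriminants_below s X. f (class_group d)) /
           (\<Sum>d\<in>discriminants_below s X. 1)) \<longlongrightarrow> c) at_top"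

definition class_group_probability ::
    "int \<Rightarrow> (complex set set monoid \<Rightarrow> bool) \<Rightarrow> real \<Rightarrow> bool" where
  "class_group_probability s P c \<longleftrightarrow> class_group_average s (\<lambda>G. of_bool (P G)) c"


section \<open>q-Pochhammer symbols and q-binomial coefficients\<close>

definition qpochhammer :: "real \<Rightarrow> real \<Rightarrow> nat \<Rightarrow> real" where
  "qpochhammer a q k = (\<Prod>i<k. 1 - a * q ^ i)"

definition qpochhammer_inf :: "real \<Rightarrow> real \<Rightarrow> real" where
  "qpochhammer_inf a q = lim (\<lambda>k. qpochhammer a q k)"

text \<open>
  For \<open>k \<le> n\<close> the quotient equals the value at \<open>q\<close> of the Gaussian polynomial whenever
  \<open>q\<close> is not a root of unity, in particular for \<open>q > 1\<close>.
\<close>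

definition qbinomial :: "nat \<Rightarrow> nat \<Rightarrow> real \<Rightarrow> real" where
  "qbinomial n k q =
     (if k \<le> n then qpochhammer q q n / (qpochhammer q q k * qpochhammer q q (n - k)) else 0)"


section \<open>Integer partitions\<close>

text \<open>
  A partition is a weakly decreasing sequence that is eventually zero. Sequences are indexed
  from 0, so \<open>lam i\<close> is the part usually written with index \<open>i + 1\<close> and \<open>lam 0\<close> is the
  largest part.
\<close>

definition is_partition :: "(nat \<Rightarrow> nat) \<Rightarrow> bool" where
  "is_partition lam \<longleftrightarrow> antimono lam \<and> finite {i. lam i \<noteq> 0}"

definition partition_size :: "(nat \<Rightarrow> nat) \<Rightarrow> nat" where
  "partition_size lam = (\<Sum>i | lam i \<noteq> 0. lam i)"

text \<open>Meaningful for \<open>j \<ge> 1\<close> only.\<close>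

definition part_mult :: "(nat \<Rightarrow> nat) \<Rightarrow> nat \<Rightarrow> nat" where
  "part_mult lam j = card {i. lam i = j}"

text \<open>
  For \<open>k \<ge> 1\<close>, \<open>conj_part lam k\<close> is the \<open>k\<close>-th part of the conjugate partition; here
  the index does start at 1.
\<close>

definition conj_part :: "(nat \<Rightarrow> nat) \<Rightarrow> nat \<Rightarrow> nat" where
  "conj_part lam k = (\<Sum>j=k..lam 0. part_mult lam j)"

definition subpartitions :: "(nat \<Rightarrow> nat) \<Rightarrow> (nat \<Rightarrow> nat) set" where
  "subpartitions lam = {mu. is_partition mu \<and> (\<forall>i. mu i \<le> lam i)}"

text \<open>
  Used for \<open>mu \<in> subpartitions lam\<close>, where no natural subtraction truncates and all terms
  and factors with \<open>i > lam 0\<close> are trivial.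
\<close>

definition subgroup_coeff :: "(nat \<Rightarrow> nat) \<Rightarrow> (nat \<Rightarrow> nat) \<Rightarrow> real \<Rightarrow> real" where
  "subgroup_coeff lam mu x =
     x ^ (\<Sum>i=1..lam 0. conj_part mu (i + 1) * (conj_part lam i - conj_part mu i)) *
     (\<Prod>i=1..lam 0.
        qbinomial (conj_part lam i - conj_part mu (i + 1)) (conj_part lam i - conj_part mu i) x)"

definition torsion_moment ::
    "nat \<Rightarrow> nat \<Rightarrow> (nat \<Rightarrow> nat) \<Rightarrow> ('a, 'm) monoid_scheme \<Rightarrow> real" where
  "torsion_moment p l lam G = (\<Prod>i=1..l. real (card (torsion G (p ^ i))) ^ part_mult lam i)"

end

theory Submission
  imports Defs "HOL-Analysis.Kronecker_Approximation_Theorem"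
begin

text \<open>
  The class groups are finite abelian, so the number of \<open>p\<^sup>i\<close>-torsion elements is \<open>p\<close> to
  the power \<open>r\<^sub>1 + \<dots> + r\<^sub>i\<close>, where \<open>r\<^sub>1 \<ge> r\<^sub>2 \<ge> \<dots>\<close> are the ranks, and the mixed torsion
  moment attached to \<open>lam\<close> counts homomorphisms to a group \<open>H\<close> of type \<open>lam\<close>. Sorting them by
  their image, a subgroup of \<open>H\<close>, and using the q-binomial theorem, one finds that the average
  number of surjections to every \<open>H\<close> is \<open>1\<close>, respectively \<open>1 / |H|\<close>.

  The number of surjections is a product over the levels \<open>i\<close>, and at each level the indicator of
  \<open>r\<^sub>i = mu\<^sub>i\<close> is an explicit alternating combination of these factors with a Bonferroni-type error
  bound. In the resulting expansion of the indicator of \<open>r = mu\<close> the conjugate type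
  \<open>n\<^sub>1 \<ge> \<dots> \<ge> n\<^sub>l\<close> of \<open>H\<close> interlaces with \<open>mu\<close>, so that only \<open>n\<^sub>1\<close> is unbounded. The error tends to
  zero, which justifies averaging term by term; Euler's identity sums over \<open>n\<^sub>1\<close> and the q-binomial
  theorem sums over the other \<open>n\<^sub>i\<close>.
\<close>

section \<open>Finite abelian groups\<close>

text \<open>The obstacle is an interchange of limits: each single moment has a known average as X
  grows, with no uniformity between moments, while isolating one rank vector takes infinitely many
  of them. What saves the argument is that, group by group, the truncation error at \<open>b\<close>
  is at most a nonnegative combination of surjection numbers with n_1 = b, so the hypothesis also
  controls the average of the error. Its limit vanishes as \<open>b\<close> grows: averaged
  surjection numbers tend to at most 1, while the coefficients decay like q^(-b^2/2). This is why
  torsion moments are first turned into surjection numbers, by a triangular system with ones on the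
  diagonal. Only n_1 is unbounded because r_1 = mu_1 forces r_2 <= mu_1, so the sum over n_2 may
  stop at mu_1 and is still exact, and likewise further down. The class groups are concrete sets of
  sets of complex numbers, so that they are abelian and finite has to be proved. Both facts come
  from elementary arguments in the style of Hurwitz, with Dirichlet approximation in place of
  lattice point theorems.\<close>

lemma (in comm_group) card_power_subgroup_torsion:
  assumes "finite (carrier G)"
  shows "card (power_subgroup G n) * card (torsion G n) = card (carrier G)"
proof -
  let ?h = "\<lambda>x. x [^] n"
  let ?H = "G\<lparr>carrier := power_subgroup G n\<rparr>"
  have hom: "?h \<in> hom G G" by (auto simp: hom_def nat_pow_distrib)
  then interpret h: group_hom G G ?h by unfold_locales
  have ker: "kernel G G ?h = torsion G n" by (simp add: kernel_def torsion_def)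
  have "(\<lambda>X. the_elem (?h ` X)) ` carrier (G Mod kernel G G ?h) = power_subgroup G n"
  proof -
    have sub: "subgroup (power_subgroup G n) G"
      using h.img_is_subgroup by (simp add: power_subgroup_def)
    interpret k: group_hom G ?H ?h
      using subgroup.subgroup_is_group[OF sub is_group] hom
      by (auto simp: group_hom_def group_hom_axioms_def hom_def power_subgroup_def)
    have "kernel G ?H ?h = kernel G G ?h" by (simp add: kernel_def)
    then show ?thesis using k.FactGroup_onto by (simp add: power_subgroup_def)
  qed
  then have "card (power_subgroup G n) = card (rcosets (kernel G G ?h))"
    using card_image[OF h.FactGroup_inj_on] by (simp add: FactGroup_def)
  then show ?thesis
    using lagrange[OF h.subgroup_kernel] by (simp add: ker order_def)
qed

lemma (in comm_group) subgroup_power_subgroup: "subgroup (power_subgroup G n) G"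
proof -
  have "(\<lambda>x. x [^] n) \<in> hom G G" by (auto simp: hom_def nat_pow_distrib)
  then interpret h: group_hom G G "\<lambda>x. x [^] n" by unfold_locales
  show ?thesis using h.img_is_subgroup by (simp add: power_subgroup_def)
qed

text \<open>The coordinate map is a bijection from the functions \<open>B\<close> to
  \<open>{..<p}\<close> onto the group.\<close>

lemma Fp_basis_card:
  assumes "comm_group V" "Fp_basis p V B"
  shows "card (carrier V) = p ^ card B"
proof -
  interpret V: comm_group V by fact
  let ?f = "\<lambda>c. finprod V (\<lambda>b. b [^]\<^bsub>V\<^esub> (c b :: nat)) B"
  have B: "finite B" "B \<subseteq> carrier V"
    and ex1: "\<And>v. v \<in> carrier V \<Longrightarrow> \<exists>!c. c \<in> B \<rightarrow>\<^sub>E {..<p} \<and> v = ?f c"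
    using assms(2) by (auto simp: Fp_basis_def)
  have closed: "?f c \<in> carrier V" for c using B by (intro V.finprod_closed) auto
  have "bij_betw ?f (B \<rightarrow>\<^sub>E {..<p}) (carrier V)"
    unfolding bij_betw_def
  proof
    show "inj_on ?f (B \<rightarrow>\<^sub>E {..<p})"
    proof (rule inj_onI)
      fix c c' assume "c \<in> B \<rightarrow>\<^sub>E {..<p}" "c' \<in> B \<rightarrow>\<^sub>E {..<p}" "?f c = ?f c'"
      then show "c = c'" using ex1[OF closed[of c]] by blast
    qed
    show "?f ` (B \<rightarrow>\<^sub>E {..<p}) = carrier V"
    proof
      show "?f ` (B \<rightarrow>\<^sub>E {..<p}) \<subseteq> carrier V" using closed by blast
      show "carrier V \<subseteq> ?f ` (B \<rightarrow>\<^sub>E {..<p})" using ex1 by blast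
    qed
  qed
  then have "card (carrier V) = card (B \<rightarrow>\<^sub>E {..<p})" by (simp add: bij_betw_same_card)
  then show ?thesis using B by (simp add: card_PiE)
qed

text \<open>\<open>Fp_dim\<close> is a definite description, so it is meaningful only once some
  basis exists and all bases have the same size. Both are established here for finite groups of
  exponent dividing \<open>p\<close>.\<close>

locale elementary_abelian = comm_group +
  fixes p :: nat
  assumes finite_carrier: "finite (carrier G)"
    and prime: "Factorial_Ring.prime p"
    and exponent: "x \<in> carrier G \<Longrightarrow> x [^] p = \<one>"
begin

definition lincomb :: "'a set \<Rightarrow> ('a \<Rightarrow> nat) \<Rightarrow> 'a" where
  "lincomb B c = finprod G (\<lambda>b. b [^] c b) B"

lemma lincomb_closed [intro, simp]: "B \<subseteq> carrier G \<Longrightarrow> lincomb B c \<in> carrier G"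
  unfolding lincomb_def by (intro finprod_closed) auto

lemma lincomb_mult:
  "B \<subseteq> carrier G \<Longrightarrow> lincomb B c \<otimes> lincomb B c' = lincomb B (\<lambda>b. c b + c' b)"
proof -
  assume B: "B \<subseteq> carrier G"
  have "lincomb B (\<lambda>b. c b + c' b) = finprod G (\<lambda>b. b [^] c b \<otimes> b [^] c' b) B"
    unfolding lincomb_def using B by (intro finprod_cong') (auto simp: nat_pow_mult)
  also have "\<dots> = lincomb B c \<otimes> lincomb B c'"
    unfolding lincomb_def using B by (intro finprod_multf) auto
  finally show ?thesis by simp
qed

lemma pow_mod: "x \<in> carrier G \<Longrightarrow> x [^] (n mod p) = x [^] n"
proof -
  assume x: "x \<in> carrier G"
  have "x [^] n = x [^] (p * (n div p) + n mod p)" by simp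
  also have "\<dots> = (x [^] p) [^] (n div p) \<otimes> x [^] (n mod p)"
    using x by (simp add: nat_pow_mult nat_pow_pow)
  finally show ?thesis using x by (simp add: exponent)
qed

lemma lincomb_reduce:
  assumes "B \<subseteq> carrier G"
  obtains c' where "c' \<in> B \<rightarrow>\<^sub>E {..<p}" "lincomb B c' = lincomb B c"
proof
  show "restrict (\<lambda>b. c b mod p) B \<in> B \<rightarrow>\<^sub>E {..<p}"
    using prime_gt_0_nat[OF prime] by auto
  show "lincomb B (restrict (\<lambda>b. c b mod p) B) = lincomb B c"
    unfolding lincomb_def using assms by (intro finprod_cong') (auto simp: pow_mod)
qed

lemma lincomb_pow: "B \<subseteq> carrier G \<Longrightarrow> lincomb B c [^] n = lincomb B (\<lambda>b. n * c b)"
proof (induction n)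
  case 0
  have "lincomb B (\<lambda>b. 0) = finprod G (\<lambda>b. \<one>) B"
    unfolding lincomb_def using 0 by (intro finprod_cong') auto
  then show ?case by (simp add: finprod_one_eqI)
next
  case (Suc n) then show ?case by (simp add: lincomb_mult add.commute)
qed

text \<open>Exponents in \<open>lincomb\<close> are natural numbers; this keeps inverses of
  combinations inside the span.\<close>

lemma inv_eq_pow: "x \<in> carrier G \<Longrightarrow> inv x = x [^] (p - 1)"
proof -
  assume x: "x \<in> carrier G"
  have "x [^] (p - 1) \<otimes> x = x [^] Suc (p - 1)" by simp
  also have "Suc (p - 1) = p" using prime_gt_0_nat[OF prime] by simp
  finally show ?thesis using x by (intro inv_equality) (simp_all add: exponent)
qed

text \<open>A relation with different exponents at \<open>v\<close> would put \<open>v [^] d\<close>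
  into the span of \<open>B\<close> for some \<open>0 < d < p\<close>. As \<open>d\<close> is
  invertible modulo \<open>p\<close>, a further power would put \<open>v\<close> itself
  there.\<close>

lemma lincomb_insert_independent:
  assumes B: "B \<subseteq> carrier G" "inj_on (lincomb B) (B \<rightarrow>\<^sub>E {..<p})"
    and v: "v \<in> carrier G" "\<And>c. v \<noteq> lincomb B c"
  shows "v \<notin> B \<and> inj_on (lincomb (insert v B)) (insert v B \<rightarrow>\<^sub>E {..<p})"
proof
  have fin: "finite B" using B(1) finite_carrier finite_subset by blast
  show vB: "v \<notin> B"
  proof
    assume "v \<in> B"
    have "lincomb B (\<lambda>b. if b = v then 1 else 0) = finprod G (\<lambda>b. if v = b then b else \<one>) B"
      unfolding lincomb_def using B by (intro finprod_cong') auto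
    also have "\<dots> = v" using B fin \<open>v \<in> B\<close> by (intro finprod_singleton) auto
    finally show False using v(2) by metis
  qed
  have ins: "lincomb (insert v B) c = v [^] c v \<otimes> lincomb B c" for c
    unfolding lincomb_def using B v fin vB by (subst finprod_insert) auto
  have main: "c v = c' v"
    if c: "c \<in> insert v B \<rightarrow>\<^sub>E {..<p}" "c' \<in> insert v B \<rightarrow>\<^sub>E {..<p}"
      and eq: "lincomb (insert v B) c = lincomb (insert v B) c'" and le: "c v \<le> c' v" for c c'
  proof (rule ccontr)
    assume "c v \<noteq> c' v"
    define d where "d = c' v - c v"
    have d: "0 < d" "d < p" using \<open>c v \<noteq> c' v\<close> le c(2) unfolding d_def by (auto simp: PiE_iff)
    have "v [^] c v \<otimes> lincomb B c = v [^] c v \<otimes> (v [^] d \<otimes> lincomb B c')"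
      using eq le B v by (simp add: ins d_def m_assoc[symmetric] nat_pow_mult)
    then have "lincomb B c = v [^] d \<otimes> lincomb B c'"
      using B v by simp
    then have "v [^] d = lincomb B c \<otimes> inv (lincomb B c')"
      using B v by (simp add: m_assoc)
    also have "\<dots> = lincomb B (\<lambda>b. c b + (p - 1) * c' b)"
      using B by (simp add: inv_eq_pow lincomb_pow lincomb_mult)
    finally have vd: "v [^] d = lincomb B (\<lambda>b. c b + (p - 1) * c' b)" .
    have "coprime d p" using d prime
      by (metis coprime_commute nat_dvd_not_less prime_imp_coprime)
    then obtain x y where xy: "d * x = p * y + 1"
      using bezout_nat[of d p] d by auto
    have "v = v [^] (d * x)" using v by (simp add: xy nat_pow_mult[symmetric] nat_pow_pow[symmetric] exponent)
    also have "\<dots> = lincomb B (\<lambda>b. x * (c b + (p - 1) * c' b))"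
      using B v by (simp add: nat_pow_pow[symmetric] vd lincomb_pow)
    finally show False using v(2) by blast
  qed
  show "inj_on (lincomb (insert v B)) (insert v B \<rightarrow>\<^sub>E {..<p})"
  proof (rule inj_onI)
    fix c c' assume c: "c \<in> insert v B \<rightarrow>\<^sub>E {..<p}" "c' \<in> insert v B \<rightarrow>\<^sub>E {..<p}"
      and eq: "lincomb (insert v B) c = lincomb (insert v B) c'"
    have cv: "c v = c' v" using main[OF c eq] main[OF c(2,1) eq[symmetric]] by linarith
    then have "lincomb B c = lincomb B c'" using eq B v by (simp add: ins)
    \<comment> \<open>Elements of \<open>insert v B \<rightarrow>\<^sub>E {..<p}\<close> also carry
      a value at \<open>v\<close>, so they must be restricted before injectivity over
      \<open>B\<close> applies.\<close>
    moreover have "lincomb B c = lincomb B (restrict c B)" for c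
      unfolding lincomb_def using B by (intro finprod_cong') auto
    ultimately have "lincomb B (restrict c B) = lincomb B (restrict c' B)" by metis
    moreover have "restrict c B \<in> B \<rightarrow>\<^sub>E {..<p}" "restrict c' B \<in> B \<rightarrow>\<^sub>E {..<p}"
      using c by (auto simp: PiE_iff)
    ultimately have "restrict c B = restrict c' B" using B(2) by (simp add: inj_on_def)
    then show "c = c'"
      using cv c by (intro PiE_ext[OF c]) (metis insertE restrict_apply')
  qed
qed

text \<open>An independent set of maximal cardinality spans, since an element outside its span could
  be added by \<open>lincomb_insert_independent\<close>.\<close>

lemma ex_Fp_basis: "\<exists>B. Fp_basis p G B"
proof -
  define I where "I = {B. B \<subseteq> carrier G \<and> inj_on (lincomb B) (B \<rightarrow>\<^sub>E {..<p})}"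
  have "I \<subseteq> Pow (carrier G)" by (auto simp: I_def)
  then have finI: "finite I" using finite_carrier finite_subset by blast
  have "{} \<in> I" by (simp add: I_def)
  then obtain B where B: "B \<in> I" and max: "\<And>B'. B' \<in> I \<Longrightarrow> card B' \<le> card B"
  proof -
    have "Max (card ` I) \<in> card ` I" using finI \<open>{} \<in> I\<close> by (intro Max_in) auto
    then obtain B where "B \<in> I" "card B = Max (card ` I)" by auto
    with finI that show ?thesis by simp
  qed
  have BG: "B \<subseteq> carrier G" and inj: "inj_on (lincomb B) (B \<rightarrow>\<^sub>E {..<p})"
    using B by (auto simp: I_def)
  have fin: "finite B" using BG finite_carrier finite_subset by blast
  have span: "\<exists>c. v = lincomb B c" if v: "v \<in> carrier G" for v
  proof (rule ccontr)
    assume "\<nexists>c. v = lincomb B c"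
    then have "v \<notin> B \<and> inj_on (lincomb (insert v B)) (insert v B \<rightarrow>\<^sub>E {..<p})"
      by (intro lincomb_insert_independent BG inj v) auto
    then have "insert v B \<in> I" "card (insert v B) = Suc (card B)"
      using v BG fin by (auto simp: I_def)
    then show False using max by fastforce
  qed
  have "\<exists>!c. c \<in> B \<rightarrow>\<^sub>E {..<p} \<and> v = lincomb B c" if v: "v \<in> carrier G" for v
  proof -
    obtain c where "v = lincomb B c" using span[OF v] by blast
    then obtain c' where "c' \<in> B \<rightarrow>\<^sub>E {..<p}" "v = lincomb B c'"
      using lincomb_reduce[OF BG] by metis
    then show ?thesis using inj_onD[OF inj] by (intro ex1I[of _ c']) auto
  qed
  then have "Fp_basis p G B" unfolding Fp_basis_def lincomb_def by (intro conjI ballI fin BG)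
  then show ?thesis by blast
qed

text \<open>The order \<open>p ^ n\<close> of the group determines \<open>n\<close>, so all bases
  have the same size and the description in \<open>Fp_dim\<close> is unique.\<close>

lemma card_carrier_eq: "card (carrier G) = p ^ Fp_dim p G"
proof -
  obtain B where B: "Fp_basis p G B" using ex_Fp_basis by blast
  have "Fp_dim p G = card B"
    unfolding Fp_dim_def
  proof (rule the_equality)
    fix n assume "\<exists>B. Fp_basis p G B \<and> card B = n"
    then have "p ^ n = p ^ card B"
      using Fp_basis_card[OF comm_group_axioms] B by metis
    then show "n = card B" using prime_gt_1_nat[OF prime] by simp
  qed (use B in blast)
  then show ?thesis using Fp_basis_card[OF comm_group_axioms B] by simp
qed

end

lemma (in comm_group) power_subgroup_power_subgroup:
  "power_subgroup (G\<lparr>carrier := power_subgroup G m\<rparr>) n = power_subgroup G (m * n)"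
proof -
  have "x [^]\<^bsub>G\<lparr>carrier := power_subgroup G m\<rparr>\<^esub> n = x [^] n" for x
    by (simp add: nat_pow_consistent[symmetric])
  then show ?thesis
    by (auto simp: power_subgroup_def nat_pow_pow image_image)
qed

lemma (in comm_group) power_subgroup_mono_dvd:
  "power_subgroup G (m * n) \<subseteq> power_subgroup G m"
proof
  fix y assume "y \<in> power_subgroup G (m * n)"
  then obtain x where x: "x \<in> carrier G" "y = x [^] (m * n)" by (auto simp: power_subgroup_def)
  then have "y = (x [^] n) [^] m" by (simp add: nat_pow_pow mult.commute)
  then show "y \<in> power_subgroup G m" using x(1) by (auto simp: power_subgroup_def)
qed

lemma (in comm_group) subgroup_imp_comm_group:
  "subgroup H G \<Longrightarrow> comm_group (G\<lparr>carrier := H\<rparr>)"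
  by (rule group.group_comm_groupI)
     (auto simp: subgroup.subgroup_is_group is_group intro: m_comm subgroup.mem_carrier)

text \<open>The quotient of two consecutive power subgroups is elementary abelian, and its dimension
  is the rank by definition; Lagrange's theorem does the rest.\<close>

lemma (in comm_group) card_power_subgroup_step:
  assumes "finite (carrier G)" "Factorial_Ring.prime p" "1 \<le> j"
  shows "card (power_subgroup G (p ^ (j - 1))) =
           p ^ prime_power_rank p j G * card (power_subgroup G (p ^ j))"
proof -
  define P where "P = power_subgroup G (p ^ (j - 1))"
  define Q where "Q = power_subgroup G (p ^ j)"
  define H where "H = G\<lparr>carrier := P\<rparr>"
  have pj: "p ^ j = p ^ (j - 1) * p" using assms(3) by (cases j) auto
  have sub: "subgroup P G" "subgroup Q G" by (auto simp: P_def Q_def subgroup_power_subgroup)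
  have QP: "Q \<subseteq> P" using power_subgroup_mono_dvd by (simp add: P_def Q_def pj)
  interpret H: comm_group H
    unfolding H_def using sub(1) by (rule subgroup_imp_comm_group)
  have subH: "subgroup Q H" unfolding H_def by (rule subgroup_incl[OF sub(2) sub(1) QP])
  interpret N: normal Q H using subH by (rule H.subgroup_imp_normal)
  interpret V: comm_group "H Mod Q" using subH by (rule H.abelian_FactGroup)
  have finH: "finite (carrier H)"
    using assms(1) sub(1) finite_subset[OF subgroup.subset] by (auto simp: H_def)
  interpret V: elementary_abelian "H Mod Q" p
  proof
    show "finite (carrier (H Mod Q))"
      unfolding carrier_FactGroup using finH by blast
    fix X assume "X \<in> carrier (H Mod Q)"
    then obtain x where x: "x \<in> carrier H" "X = Q #>\<^bsub>H\<^esub> x" by (auto simp: carrier_FactGroup)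
    have "x [^]\<^bsub>H\<^esub> p \<in> Q"
      using x(1) power_subgroup_power_subgroup[of "p ^ (j - 1)" p]
      unfolding H_def P_def Q_def pj by (auto simp: power_subgroup_def)
    then show "X [^]\<^bsub>H Mod Q\<^esub> p = \<one>\<^bsub>H Mod Q\<^esub>"
      using x N.FactGroup_pow[OF x(1), of p] H.coset_join2[OF _ subH] H.nat_pow_closed by simp
  qed (fact assms(2))
  have "card (carrier (H Mod Q)) * card Q = card P"
    using H.lagrange[OF subH] by (simp add: FactGroup_def order_def H_def)
  moreover have "Fp_dim p (H Mod Q) = prime_power_rank p j G"
    by (simp add: prime_power_rank_def H_def P_def Q_def)
  ultimately have "card P = p ^ prime_power_rank p j G * card Q"
    using V.card_carrier_eq by simp
  then show ?thesis by (simp only: P_def Q_def)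
qed

text \<open>The index of the subgroup of \<open>p ^ i\<close>-th powers is computed twice: as the
  order of the kernel of powering, and as the telescoping product of the steps
  \<open>card_power_subgroup_step\<close>.\<close>

theorem (in comm_group) card_torsion_prime_power:
  assumes "finite (carrier G)" "Factorial_Ring.prime p"
  shows "card (torsion G (p ^ i)) = p ^ (\<Sum>k<i. prime_power_rank p (Suc k) G)"
proof -
  have pos: "0 < card (power_subgroup G n)" for n
    using subgroup.one_closed[OF subgroup_power_subgroup, of n] assms(1)
      finite_subset[OF subgroup.subset[OF subgroup_power_subgroup]]
    by (auto simp: card_gt_0_iff)
  have total: "card (power_subgroup G (p ^ i)) * p ^ (\<Sum>k<i. prime_power_rank p (Suc k) G) = card (carrier G)"
  proof (induction i)
    case 0
    have "power_subgroup G 1 = (\<lambda>x. x) ` carrier G"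
      unfolding power_subgroup_def by (intro image_cong) auto
    then show ?case by simp
  next
    case (Suc i)
    then show ?case
      using card_power_subgroup_step[OF assms, of "Suc i"] by (simp add: power_add mult_ac)
  qed
  have "card (power_subgroup G (p ^ i)) * card (torsion G (p ^ i))
      = card (power_subgroup G (p ^ i)) * p ^ (\<Sum>k<i. prime_power_rank p (Suc k) G)"
    unfolding total by (rule card_power_subgroup_torsion[OF assms(1)])
  then show ?thesis using pos[of "p ^ i"] by (simp only: mult_cancel1) simp
qed

text \<open>Inside \<open>P j\<close>, powering by \<open>p\<close> has image
  \<open>P (Suc j)\<close>, so \<open>p ^ r j\<close> is the order of its kernel, the elements of
  \<open>P j\<close> killed by \<open>p\<close>. These kernels shrink because the groups
  \<open>P j\<close> do.\<close>

theorem (in comm_group) prime_power_rank_antimono: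
  assumes "finite (carrier G)" "Factorial_Ring.prime p"
  shows "antimono (\<lambda>k. prime_power_rank p (Suc k) G)"
  unfolding antimono_iff_le_Suc
proof
  fix k
  define r where "r j = prime_power_rank p (Suc j) G" for j
  define P where "P j = power_subgroup G (p ^ j)" for j
  have sub: "subgroup (P j) G" for j by (simp add: P_def subgroup_power_subgroup)
  have fin: "finite (P j)" for j
    using assms(1) finite_subset[OF subgroup.subset[OF sub]] by blast
  have pos: "0 < card (P j)" for j
    using subgroup.one_closed[OF sub, of j] fin by (auto simp: card_gt_0_iff)
  have rank: "p ^ r j = card {x \<in> P j. x [^] p = \<one>}" for j
  proof -
    interpret H: comm_group "G\<lparr>carrier := P j\<rparr>"
      using sub by (rule subgroup_imp_comm_group)
    have tors: "torsion (G\<lparr>carrier := P j\<rparr>) p = {x \<in> P j. x [^] p = \<one>}"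
      by (simp add: torsion_def nat_pow_consistent[symmetric])
    have "power_subgroup (G\<lparr>carrier := P j\<rparr>) p = P (Suc j)"
      unfolding P_def power_subgroup_power_subgroup by (simp add: mult.commute)
    then have "card (P (Suc j)) * card {x \<in> P j. x [^] p = \<one>} = card (P j)"
      using H.card_power_subgroup_torsion[of p] fin by (simp add: tors)
    moreover have "card (P j) = p ^ r j * card (P (Suc j))"
      using card_power_subgroup_step[OF assms, of "Suc j"] by (simp add: P_def r_def)
    ultimately have "card (P (Suc j)) * p ^ r j = card (P (Suc j)) * card {x \<in> P j. x [^] p = \<one>}"
      by (simp only: mult.commute)
    then show ?thesis using pos[of "Suc j"] by (simp only: mult_cancel1) simp
  qed
  have "P (Suc k) \<subseteq> P k"
    using power_subgroup_mono_dvd[of "p ^ k" p] by (simp add: P_def mult.commute)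
  then have "p ^ r (Suc k) \<le> p ^ r k"
    unfolding rank using fin by (intro card_mono) auto
  then show "prime_power_rank p (Suc (Suc k)) G \<le> prime_power_rank p (Suc k) G"
    using prime_gt_1_nat[OF assms(2)] by (simp add: r_def)
qed

section \<open>Class groups of quadratic fields\<close>

text \<open>The generator \<open>w\<close> has trace \<open>e\<close> and norm \<open>c\<close>, so
  an element u + v w has trace 2u + ve and norm u^2 + uve + v^2 c. The assumption
  \<open>maximal\<close> says that integral trace and norm force integral coordinates; it is what
  makes Z[w] the full ring of integers.\<close>

locale quadratic_order =
  fixes d :: int and w :: complex and e c :: int
  assumes field: "quadratic_field d = {of_rat u + of_rat v * w | u v. True}"
    and w_square: "w\<^sup>2 = of_int e * w - of_int c"
    and independent: "of_rat u + of_rat v * w = 0 \<Longrightarrow> u = 0 \<and> v = 0"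
    and maximal: "2 * u + v * of_int e \<in> \<int> \<Longrightarrow> u\<^sup>2 + u * v * of_int e + v\<^sup>2 * of_int c \<in> \<int> \<Longrightarrow>
                    u \<in> \<int> \<and> v \<in> \<int>"
begin

abbreviation K where "K \<equiv> quadratic_field d"
abbreviation R where "R \<equiv> ring_of_integers d"

definition elt :: "rat \<Rightarrow> rat \<Rightarrow> complex" where
  "elt u v = of_rat u + of_rat v * w"

text \<open>Conjugation sends w to e - w. The description reads off the coordinates, which are
  unique by \<open>independent\<close>; outside \<open>K\<close> the value is arbitrary, hence the
  membership premises below.\<close>

definition qconj :: "complex \<Rightarrow> complex" where
  "qconj z = (THE z'. \<exists>u v. z = elt u v \<and> z' = elt (u + v * of_int e) (- v))"

definition qnorm :: "complex \<Rightarrow> rat" where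
  "qnorm z = (THE n. \<exists>u v. z = elt u v \<and> n = u\<^sup>2 + u * v * of_int e + v\<^sup>2 * of_int c)"

definition qtrace :: "complex \<Rightarrow> rat" where
  "qtrace z = (THE t. \<exists>u v. z = elt u v \<and> t = 2 * u + v * of_int e)"

lemma elt_eq_iff [simp]: "elt u v = elt u' v' \<longleftrightarrow> u = u' \<and> v = v'"
proof
  assume "elt u v = elt u' v'"
  then have "of_rat (u - u') + of_rat (v - v') * w = 0"
    by (simp add: elt_def of_rat_diff algebra_simps)
  then show "u = u' \<and> v = v'" using independent by force
qed simp

lemma elt_in_K [simp]: "elt u v \<in> K" by (auto simp: field elt_def)

lemma K_cases: assumes "z \<in> K" obtains u v where "z = elt u v"
  using assms by (auto simp: field elt_def)

lemma qconj_elt [simp]: "qconj (elt u v) = elt (u + v * of_int e) (- v)"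
  unfolding qconj_def by (rule the_equality) auto

lemma qnorm_elt [simp]: "qnorm (elt u v) = u\<^sup>2 + u * v * of_int e + v\<^sup>2 * of_int c"
  unfolding qnorm_def by (rule the_equality) auto

lemma qtrace_elt [simp]: "qtrace (elt u v) = 2 * u + v * of_int e"
  unfolding qtrace_def by (rule the_equality) auto

lemma elt_add: "elt u v + elt u' v' = elt (u + u') (v + v')"
  by (simp add: elt_def of_rat_add algebra_simps)

lemma elt_mult: "elt u v * elt u' v' = elt (u * u' - of_int c * v * v') (u * v' + v * u' + of_int e * v * v')"
proof -
  have "elt u v * elt u' v' = of_rat u * of_rat u' + (of_rat u * of_rat v' + of_rat v * of_rat u') * w
      + of_rat v * of_rat v' * w\<^sup>2"
    by (simp add: elt_def algebra_simps power2_eq_square)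
  also have "\<dots> = elt (u * u' - of_int c * v * v') (u * v' + v * u' + of_int e * v * v')"
    unfolding w_square by (simp add: elt_def of_rat_add of_rat_mult of_rat_diff algebra_simps)
  finally show ?thesis .
qed

lemma of_rat_eq_elt: "of_rat u = elt u 0" by (simp add: elt_def)

lemma of_int_eq_elt: "of_int n = elt (of_int n) 0" by (simp add: elt_def)

lemma zero_eq_elt: "0 = elt 0 0" and one_eq_elt: "1 = elt 1 0" by (simp_all add: elt_def)

lemma of_rat_in_K [simp]: "of_rat u \<in> K" by (simp add: of_rat_eq_elt)

lemma of_int_in_K [simp]: "of_int u \<in> K" by (simp add: of_int_eq_elt)

lemma zero_in_K [simp]: "0 \<in> K" and one_in_K [simp]: "1 \<in> K"
  using of_int_in_K[of 0] of_int_in_K[of 1] by auto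

lemma K_add [intro]: "x \<in> K \<Longrightarrow> y \<in> K \<Longrightarrow> x + y \<in> K"
  by (metis K_cases elt_add elt_in_K)

lemma K_mult [intro]: "x \<in> K \<Longrightarrow> y \<in> K \<Longrightarrow> x * y \<in> K"
  by (metis K_cases elt_mult elt_in_K)

lemma qconj_in_K [simp]: "x \<in> K \<Longrightarrow> qconj x \<in> K"
  by (metis K_cases qconj_elt elt_in_K)

lemma qconj_qconj [simp]: "x \<in> K \<Longrightarrow> qconj (qconj x) = x"
  by (auto elim!: K_cases)

lemma qconj_add: "x \<in> K \<Longrightarrow> y \<in> K \<Longrightarrow> qconj (x + y) = qconj x + qconj y"
  by (auto elim!: K_cases simp: elt_add algebra_simps)

lemma qconj_mult: "x \<in> K \<Longrightarrow> y \<in> K \<Longrightarrow> qconj (x * y) = qconj x * qconj y"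
  by (auto elim!: K_cases simp: elt_mult algebra_simps)

lemma qconj_of_rat [simp]: "qconj (of_rat u) = of_rat u"
  by (simp add: of_rat_eq_elt)

lemma qconj_zero [simp]: "qconj 0 = 0"
  using qconj_of_rat[of 0] by simp

lemma mult_qconj: "x \<in> K \<Longrightarrow> x * qconj x = of_rat (qnorm x)"
  by (auto elim!: K_cases simp: elt_mult of_rat_eq_elt algebra_simps power2_eq_square)

lemma add_qconj: "x \<in> K \<Longrightarrow> x + qconj x = of_rat (qtrace x)"
  by (auto elim!: K_cases simp: elt_add of_rat_eq_elt algebra_simps)

lemma qconj_eq_0_iff [simp]: "x \<in> K \<Longrightarrow> qconj x = 0 \<longleftrightarrow> x = 0"
  by (auto elim!: K_cases simp: zero_eq_elt)

lemma qnorm_eq_0_iff: "x \<in> K \<Longrightarrow> qnorm x = 0 \<longleftrightarrow> x = 0"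
  using mult_qconj[of x] by auto

lemma qnorm_mult: "x \<in> K \<Longrightarrow> y \<in> K \<Longrightarrow> qnorm (x * y) = qnorm x * qnorm y"
proof -
  assume x: "x \<in> K" and y: "y \<in> K"
  have "of_rat (qnorm (x * y)) = (x * qconj x) * (y * qconj y)"
    using x y by (subst mult_qconj[symmetric]) (auto simp: qconj_mult)
  also have "\<dots> = (of_rat (qnorm x * qnorm y) :: complex)"
    using x y by (simp add: mult_qconj of_rat_mult)
  finally show ?thesis by simp
qed

lemma K_inverse: "x \<in> K \<Longrightarrow> inverse x \<in> K"
proof (cases "x = 0")
  case False
  assume x: "x \<in> K"
  have "inverse x = qconj x * of_rat (inverse (qnorm x))"
  proof (rule inverse_unique)
    have "x * (qconj x * of_rat (inverse (qnorm x))) = (x * qconj x) * of_rat (inverse (qnorm x))"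
      by simp
    also have "\<dots> = of_rat (qnorm x * inverse (qnorm x))"
      by (simp only: mult_qconj[OF x] of_rat_mult)
    also have "\<dots> = 1" using qnorm_eq_0_iff[OF x] False by simp
    finally show "x * (qconj x * of_rat (inverse (qnorm x))) = 1" .
  qed
  then show ?thesis using x by auto
qed simp

lemma K_divide [intro]: "x \<in> K \<Longrightarrow> y \<in> K \<Longrightarrow> x / y \<in> K"
  unfolding divide_inverse by (intro K_mult K_inverse)

section \<open>The ring of integers is Z[w]\<close>

definition int_span :: "complex set" where
  "int_span = {of_int a + of_int b * w | a b. True}"

lemma int_span_iff: "elt u v \<in> int_span \<longleftrightarrow> u \<in> \<int> \<and> v \<in> \<int>"
proof -
  have "of_int a + of_int b * w = elt (of_int a) (of_int b)" for a b by (simp add: elt_def)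
  then show ?thesis by (auto simp: int_span_def Ints_def)
qed

lemma int_span_subset_K: "int_span \<subseteq> K"
proof
  fix x assume "x \<in> int_span"
  then obtain a b where "x = of_int a + of_int b * w" by (auto simp: int_span_def)
  then have "x = elt (of_int a) (of_int b)" by (simp add: elt_def)
  then show "x \<in> K" by simp
qed

lemma int_span_cases: assumes "z \<in> int_span" obtains u v where "z = elt u v" "u \<in> \<int>" "v \<in> \<int>"
proof -
  obtain u v where "z = elt u v" using assms int_span_subset_K K_cases by blast
  then show thesis using that assms int_span_iff by blast
qed

lemma int_span_add: "x \<in> int_span \<Longrightarrow> y \<in> int_span \<Longrightarrow> x + y \<in> int_span"
  by (auto elim!: int_span_cases simp: elt_add int_span_iff)

lemma int_span_mult: "x \<in> int_span \<Longrightarrow> y \<in> int_span \<Longrightarrow> x * y \<in> int_span"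
  by (auto elim!: int_span_cases simp: elt_mult int_span_iff)

lemma int_span_of_int [simp]: "of_int n \<in> int_span"
  by (simp add: of_int_eq_elt int_span_iff)

lemma int_span_sum: "(\<And>i. i \<in> A \<Longrightarrow> f i \<in> int_span) \<Longrightarrow> sum f A \<in> int_span"
  using int_span_of_int[of 0] by (induction A rule: infinite_finite_induct) (auto intro: int_span_add)

lemma int_span_qnorm: "x \<in> int_span \<Longrightarrow> qnorm x \<in> \<int>"
  by (auto elim!: int_span_cases)

text \<open>If b is the denominator of r in lowest terms, every power of b divides the nonzero D, so
  b = 1.\<close>

lemma rat_bounded_powers_int:
  assumes D: "D \<noteq> 0" and powers: "\<And>k. of_int D * r ^ k \<in> \<int>"
  shows "(r :: rat) \<in> \<int>"
proof -
  obtain a b where ab: "r = of_int a / of_int b" "b > 0" "coprime a b"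
    by (cases r rule: Rat_cases) (auto simp: Fract_of_int_quotient)
  have dvd: "b ^ k dvd D" for k
  proof -
    obtain m where "of_int D * r ^ k = of_int m" using powers[of k] by (auto elim: Ints_cases)
    then have "of_int (D * a ^ k) = (of_int (m * b ^ k) :: rat)"
      using ab by (simp add: power_divide field_simps)
    then have "D * a ^ k = m * b ^ k" by (simp only: of_int_eq_iff)
    then have "b ^ k dvd D * a ^ k" by simp
    moreover have "coprime (b ^ k) (a ^ k)" using ab by (simp add: coprime_commute)
    ultimately show ?thesis by (simp add: coprime_dvd_mult_left_iff)
  qed
  have "b = 1"
  proof (rule ccontr)
    assume "b \<noteq> 1"
    then have "b \<ge> 2" using ab by simp
    \<comment> \<open>Because n < 2^n, the exponent n = |D| already makes the divisor
      \<open>b ^ n\<close> of D exceed |D|.\<close>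
    have "int (nat \<bar>D\<bar>) < 2 ^ nat \<bar>D\<bar>" using of_nat_less_two_power by blast
    also have "(2::int) ^ nat \<bar>D\<bar> \<le> b ^ nat \<bar>D\<bar>" using \<open>b \<ge> 2\<close> by (intro power_mono) auto
    also have "\<dots> \<le> \<bar>D\<bar>" using dvd[of "nat \<bar>D\<bar>"] D by (intro zdvd_imp_le) auto
    finally show False by simp
  qed
  then show ?thesis using ab by simp
qed

lemma int_span_denominator:
  assumes "x \<in> K"
  obtains n :: int where "n \<noteq> 0" "of_int n * x \<in> int_span"
proof -
  obtain u v where x: "x = elt u v" using assms by (rule K_cases)
  obtain a b where u: "u = of_int a / of_int b" "b > 0"
    by (cases u rule: Rat_cases) (auto simp: Fract_of_int_quotient)
  obtain a' b' where v: "v = of_int a' / of_int b'" "b' > 0"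
    by (cases v rule: Rat_cases) (auto simp: Fract_of_int_quotient)
  have "of_int (b * b') * x = elt (of_int (b * b') * u) (of_int (b * b') * v)"
    by (simp add: x elt_def of_rat_mult algebra_simps)
  also have "of_int (b * b') * u = of_int (b' * a)" using u by simp
  also have "of_int (b * b') * v = of_int (b * a')" using v by simp
  finally have "of_int (b * b') * x \<in> int_span" by (simp only: int_span_iff Ints_of_int simp_thms)
  moreover have "b * b' \<noteq> 0" using u v by simp
  ultimately show thesis using that by blast
qed

text \<open>The monic equation of degree n rewrites z^n through lower powers with integer
  coefficients. Hence the product \<open>E\<close> of denominators for the first n powers serves, by
  induction, for all of them.\<close>

lemma algebraic_int_bounded_powers:
  assumes z: "z \<in> K" "algebraic_int z"
  obtains D where "D \<noteq> 0" "\<And>k. of_int D * z ^ k \<in> int_span"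
proof -
  obtain p where p: "lead_coeff p = 1" "\<forall>i. coeff p i \<in> \<int>" "poly p z = 0"
    using z(2) by (auto elim: algebraic_int.cases)
  define n where "n = degree p"
  have zn: "z ^ n = - (\<Sum>i<n. coeff p i * z ^ i)"
  proof -
    have "0 = (\<Sum>i\<le>n. coeff p i * z ^ i)" using p(3) by (simp add: poly_altdef n_def)
    also have "\<dots> = (\<Sum>i<n. coeff p i * z ^ i) + z ^ n"
      using p(1) by (simp add: lessThan_Suc_atMost[symmetric] n_def)
    finally show ?thesis by (simp add: eq_neg_iff_add_eq_0 add.commute)
  qed
  have zK: "z ^ i \<in> K" for i by (induction i) (use z in auto)
  have "\<forall>i. \<exists>D. D \<noteq> 0 \<and> of_int D * z ^ i \<in> int_span"
    using int_span_denominator[OF zK] by metis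
  then obtain D where D: "\<And>i. D i \<noteq> 0" "\<And>i. of_int (D i) * z ^ i \<in> int_span"
    using choice[of "\<lambda>i D. D \<noteq> 0 \<and> of_int D * z ^ i \<in> int_span"] by blast
  define E where "E = (\<Prod>i<n. D i)"
  have "of_int E * z ^ k \<in> int_span" for k
  proof (induction k rule: less_induct)
    case (less k)
    show ?case
    proof (cases "k < n")
      case True
      have "E = (\<Prod>i\<in>{..<n}-{k}. D i) * D k"
        unfolding E_def using True by (subst prod.remove[of _ k]) (auto simp: mult.commute)
      then have "of_int E * z ^ k = of_int (\<Prod>i\<in>{..<n}-{k}. D i) * (of_int (D k) * z ^ k)" by simp
      then show ?thesis using D(2) int_span_mult[OF int_span_of_int] by metis
    next
      case False
      then have "z ^ k = z ^ n * z ^ (k - n)" by (simp add: power_add[symmetric])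
      then have "of_int E * z ^ k = (\<Sum>i<n. (- coeff p i) * (of_int E * z ^ (i + (k - n))))"
        unfolding zn by (simp add: sum_negf sum_distrib_left sum_distrib_right power_add algebra_simps)
      moreover have "- coeff p i \<in> int_span" for i
        using p(2) Ints_minus Ints_cases int_span_of_int by metis
      moreover have "of_int E * z ^ (i + (k - n)) \<in> int_span" if "i < n" for i
        using that False by (intro less.IH) simp
      ultimately show ?thesis by (simp only:) (rule int_span_sum, rule int_span_mult, auto)
    qed
  qed
  moreover have "E \<noteq> 0" using D(1) by (simp add: E_def)
  ultimately show thesis using that by blast
qed

text \<open>By multiplicativity of the norm, D^2 is a common denominator for all powers of
  \<open>qnorm x\<close>.\<close>

lemma qnorm_int_if_bounded_powers:
  assumes "x \<in> K" "D \<noteq> 0" "\<And>k. of_int D * x ^ k \<in> int_span"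
  shows "qnorm x \<in> \<int>"
proof (rule rat_bounded_powers_int)
  fix k
  have xk: "x ^ k \<in> K" "qnorm (x ^ k) = qnorm x ^ k" for k
  proof (induction k)
    case 0 show "x ^ 0 \<in> K" "qnorm (x ^ 0) = qnorm x ^ 0" using qnorm_elt[of 1 0] by (auto simp: one_eq_elt)
  next
    case (Suc k) then show "x ^ Suc k \<in> K" "qnorm (x ^ Suc k) = qnorm x ^ Suc k"
      using assms(1) by (auto simp: qnorm_mult)
  qed
  have "qnorm (of_int D * x ^ k) = of_int (D\<^sup>2) * qnorm x ^ k"
    using xk by (simp add: qnorm_mult) (simp add: of_int_eq_elt)
  then show "of_int (D\<^sup>2) * qnorm x ^ k \<in> \<int>"
    using int_span_qnorm[OF assms(3)[of k]] by simp
qed (use assms in auto)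

text \<open>
  If \<open>z\<close> is an algebraic integer, all powers of \<open>z\<close> and of \<open>z + 1\<close> have a common denominator, and so
  have the powers of their norms, which forces these norms, and hence the trace of \<open>z\<close>, to
  be integers.
\<close>

theorem ring_of_integers_eq: "R = int_span"
proof
  show "R \<subseteq> int_span"
  proof
    fix z assume "z \<in> R"
    then have z: "z \<in> K" "algebraic_int z" by (auto simp: ring_of_integers_def)
    obtain D where D: "D \<noteq> 0" "\<And>k. of_int D * z ^ k \<in> int_span"
      using algebraic_int_bounded_powers[OF z] by blast
    have "of_int D * (z + 1) ^ k \<in> int_span" for k
    proof -
      have "of_int D * (z + 1) ^ k = (\<Sum>i\<le>k. of_int (int (k choose i)) * (of_int D * z ^ i))"
        by (simp add: binomial_ring sum_distrib_left mult_ac)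
      then show ?thesis
        by (simp only:) (rule int_span_sum, rule int_span_mult, rule int_span_of_int, rule D(2))
    qed
    then have N: "qnorm z \<in> \<int>" "qnorm (z + 1) \<in> \<int>"
      using qnorm_int_if_bounded_powers[OF z(1) D]
        qnorm_int_if_bounded_powers[OF K_add[OF z(1) one_in_K] D(1)] by blast+
    obtain u v where zuv: "z = elt u v" using z(1) by (rule K_cases)
    have "qnorm (z + 1) = qnorm z + qtrace z + 1"
      by (simp add: zuv one_eq_elt elt_add power2_eq_square algebra_simps)
    then have "qtrace z = qnorm (z + 1) - qnorm z - 1" by linarith
    also have "\<dots> \<in> \<int>" by (intro Ints_diff N Ints_1)
    finally have "qtrace z \<in> \<int>" .
    then show "z \<in> int_span"
      using maximal N(1) unfolding zuv int_span_iff qtrace_elt qnorm_elt by blast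
  qed
  \<comment> \<open>Conversely, z is a root of X^2 - t X + n, where t and n are its trace and
    norm.\<close>
  show "int_span \<subseteq> R"
  proof
    fix z assume z: "z \<in> int_span"
    then obtain u v where zuv: "z = elt u v" "u \<in> \<int>" "v \<in> \<int>" by (rule int_span_cases)
    have zK: "z \<in> K" by (simp add: zuv)
    have "qtrace z \<in> \<int>" "qnorm z \<in> \<int>" using zuv by auto
    then obtain t n where tn: "qtrace z = of_int t" "qnorm z = of_int n" by (auto elim!: Ints_cases)
    have "algebraic_int z"
    proof (rule algebraic_int.intros)
      show "lead_coeff [:of_int n, - of_int t, 1 :: complex:] = 1" by simp
      show "\<forall>i. coeff [:of_int n, - of_int t, 1 :: complex:] i \<in> \<int>"
        by (auto simp: coeff_pCons split: nat.split)
      have "poly [:of_int n, - of_int t, 1:] z = z * qconj z - (z + qconj z) * z + z * z"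
        using mult_qconj[OF zK] add_qconj[OF zK] by (simp add: tn algebra_simps)
      then show "poly [:of_int n, - of_int t, 1:] z = 0" by (simp add: algebra_simps)
    qed
    then show "z \<in> R" using zK by (simp add: ring_of_integers_def)
  qed
qed

end

context quadratic_order begin

lemma R_cases: assumes "z \<in> R" obtains a b where "z = elt (of_int a) (of_int b)"
proof -
  obtain u v where "z = elt u v" "u \<in> \<int>" "v \<in> \<int>"
    using assms unfolding ring_of_integers_eq by (rule int_span_cases)
  then show thesis using that by (auto elim!: Ints_cases)
qed

lemma elt_in_R: "elt u v \<in> R \<longleftrightarrow> u \<in> \<int> \<and> v \<in> \<int>"
  unfolding ring_of_integers_eq by (rule int_span_iff)

lemma R_subset_K: "R \<subseteq> K" by (auto simp: ring_of_integers_def)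

lemma R_in_K [simp]: "x \<in> R \<Longrightarrow> x \<in> K" using R_subset_K by blast

lemma R_add: "x \<in> R \<Longrightarrow> y \<in> R \<Longrightarrow> x + y \<in> R"
  and R_mult: "x \<in> R \<Longrightarrow> y \<in> R \<Longrightarrow> x * y \<in> R"
  unfolding ring_of_integers_eq by (simp_all add: int_span_add int_span_mult)

lemma R_of_int [simp]: "of_int n \<in> R"
  unfolding ring_of_integers_eq by simp

lemma R_zero [simp]: "0 \<in> R" and R_one [simp]: "1 \<in> R"
  using R_of_int[of 0] R_of_int[of 1] by simp_all

lemma R_qconj: "x \<in> R \<Longrightarrow> qconj x \<in> R"
  by (auto elim!: R_cases simp: elt_in_R)

lemma qnorm_int: "x \<in> R \<Longrightarrow> qnorm x \<in> \<int>"
  unfolding ring_of_integers_eq by (rule int_span_qnorm)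

lemma qtrace_int: "x \<in> R \<Longrightarrow> qtrace x \<in> \<int>"
  by (auto elim!: R_cases)

lemma in_R_if_trace_norm: "x \<in> K \<Longrightarrow> qtrace x \<in> \<int> \<Longrightarrow> qnorm x \<in> \<int> \<Longrightarrow> x \<in> R"
  by (auto elim!: K_cases simp: elt_in_R dest: maximal)

lemma K_diff: "x \<in> K \<Longrightarrow> y \<in> K \<Longrightarrow> x - y \<in> K"
  using K_add[of x "of_int (- 1) * y"] K_mult[OF of_int_in_K, of y "- 1"] by simp

lemma of_nat_in_K [simp]: "of_nat n \<in> K"
  using of_int_in_K[of "int n"] by (simp only: of_int_of_nat_eq)

section \<open>The group of fractional ideals\<close>

abbreviation frac_ideal where "frac_ideal \<equiv> fractional_ideal d"

lemma fracD:
  assumes "frac_ideal I"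
  shows "I \<subseteq> K" "0 \<in> I" "x \<in> I \<Longrightarrow> y \<in> I \<Longrightarrow> x + y \<in> I" "a \<in> R \<Longrightarrow> x \<in> I \<Longrightarrow> a * x \<in> I"
  using assms by (auto simp: fractional_ideal_def)

lemma frac_nonzero:
  assumes "frac_ideal I" obtains x where "x \<in> I" "x \<noteq> 0"
  using assms by (auto simp: fractional_ideal_def)

lemma frac_denominator:
  assumes "frac_ideal I" obtains a where "a \<in> R" "a \<noteq> 0" "\<And>x. x \<in> I \<Longrightarrow> a * x \<in> R"
  using assms unfolding fractional_ideal_def by blast

lemma frac_minus: "frac_ideal I \<Longrightarrow> x \<in> I \<Longrightarrow> - x \<in> I"
  using fracD(4)[of I "-1" x] R_of_int[of "-1"] by simp

lemma frac_diff: "frac_ideal I \<Longrightarrow> x \<in> I \<Longrightarrow> y \<in> I \<Longrightarrow> x - y \<in> I"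
  using fracD(3)[of I x "- y"] frac_minus by simp

lemma ideal_product_mem:
  assumes "a \<in> I" "b \<in> J"
  shows "a * b \<in> ideal_product I J"
  unfolding ideal_product_def using assms
  by (intro CollectI exI[of _ "1::nat"] exI[of _ "\<lambda>_. a"] exI[of _ "\<lambda>_. b"]) simp

lemma ideal_product_zero: "0 \<in> ideal_product I J"
  unfolding ideal_product_def by (auto intro!: exI[of _ "0::nat"])

lemma ideal_product_add:
  assumes "x \<in> ideal_product I J" "y \<in> ideal_product I J"
  shows "x + y \<in> ideal_product I J"
proof -
  obtain n :: nat and a b where x: "x = (\<Sum>k<n. a k * b k)" "\<forall>k<n. a k \<in> I \<and> b k \<in> J"
    using assms(1) by (auto simp: ideal_product_def)
  obtain m :: nat and a' b' where y: "y = (\<Sum>k<m. a' k * b' k)" "\<forall>k<m. a' k \<in> I \<and> b' k \<in> J"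
    using assms(2) by (auto simp: ideal_product_def)
  define a'' where "a'' k = (if k < n then a k else a' (k - n))" for k
  define b'' where "b'' k = (if k < n then b k else b' (k - n))" for k
  have "(\<Sum>k<n + m. a'' k * b'' k) = (\<Sum>k<n. a'' k * b'' k) + (\<Sum>k<m. a'' (n + k) * b'' (n + k))"
    by (induction m) simp_all
  also have "\<dots> = x + y" by (simp add: x y a''_def b''_def)
  finally have "x + y = (\<Sum>k<n + m. a'' k * b'' k)" by simp
  moreover have "\<forall>k<n + m. a'' k \<in> I \<and> b'' k \<in> J" using x y by (auto simp: a''_def b''_def)
  ultimately show ?thesis unfolding ideal_product_def by blast
qed

text \<open>Properties of products can thus be checked on generators \<open>a * b\<close> and under
  addition, without handling the indexed sums in the definition.\<close>

lemma ideal_product_induct [consumes 1, case_names zero add mult]: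
  assumes "x \<in> ideal_product I J" "P 0" "\<And>x y. P x \<Longrightarrow> P y \<Longrightarrow> P (x + y)"
    "\<And>a b. a \<in> I \<Longrightarrow> b \<in> J \<Longrightarrow> P (a * b)"
  shows "P x"
proof -
  obtain n :: nat and a b where x: "x = (\<Sum>k<n. a k * b k)" "\<forall>k<n. a k \<in> I \<and> b k \<in> J"
    using assms(1) by (auto simp: ideal_product_def)
  have "P (\<Sum>k<m. a k * b k)" if "m \<le> n" for m
    using that by (induction m) (auto intro!: assms(2-4) simp: x(2))
  then show ?thesis using x(1) by simp
qed

lemma ideal_product_commute: "ideal_product I J = ideal_product J I"
proof -
  have "ideal_product I J \<subseteq> ideal_product J I" for I J
  proof
    fix x assume "x \<in> ideal_product I J"
    then show "x \<in> ideal_product J I"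
    proof (induction rule: ideal_product_induct)
      case (mult a b) then show ?case using ideal_product_mem[of b J a I] by (simp add: mult.commute)
    qed (simp_all add: ideal_product_zero ideal_product_add)
  qed
  then show ?thesis by blast
qed

lemma ideal_product_assoc:
  "ideal_product (ideal_product I J) L = ideal_product I (ideal_product J L)"
proof -
  have sub: "ideal_product (ideal_product I J) L \<subseteq> ideal_product I (ideal_product J L)" for I J L
  proof
    fix x assume "x \<in> ideal_product (ideal_product I J) L"
    then show "x \<in> ideal_product I (ideal_product J L)"
    proof (induction rule: ideal_product_induct)
      case (mult a b)
      then show ?case
      proof (induction rule: ideal_product_induct)
        case (mult a' b')
        then show ?case by (simp add: mult.assoc ideal_product_mem)
      qed (simp_all add: ideal_product_zero ideal_product_add distrib_right)
    qed (simp_all add: ideal_product_zero ideal_product_add)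
  qed
  \<comment> \<open>Commutativity reverses the bracketing, so \<open>sub\<close> with I and L
    exchanged is the missing inclusion.\<close>
  have "ideal_product I (ideal_product J L) = ideal_product (ideal_product L J) I"
    by (simp only: ideal_product_commute)
  also have "\<dots> \<subseteq> ideal_product L (ideal_product J I)" by (rule sub)
  also have "\<dots> = ideal_product (ideal_product I J) L" by (simp only: ideal_product_commute)
  finally show ?thesis using sub by blast
qed

lemma ideal_product_scale:
  assumes "frac_ideal I" "a \<in> R" "x \<in> ideal_product I J"
  shows "a * x \<in> ideal_product I J"
  using assms(3)
proof (induction rule: ideal_product_induct)
  case (mult b c)
  then show ?case using ideal_product_mem[OF fracD(4)[OF assms(1,2)]] by (simp add: mult.assoc[symmetric])
qed (simp_all add: ideal_product_zero ideal_product_add distrib_left)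

lemma frac_ideal_product:
  assumes I: "frac_ideal I" and J: "frac_ideal J"
  shows "frac_ideal (ideal_product I J)"
  unfolding fractional_ideal_def
proof (intro conjI ballI)
  show "ideal_product I J \<subseteq> K"
  proof
    fix x assume "x \<in> ideal_product I J"
    then show "x \<in> K" using fracD(1)[OF I] fracD(1)[OF J]
      by (induction rule: ideal_product_induct) auto
  qed
  show "ideal_product I J \<noteq> {0}"
  proof -
    obtain a b where "a \<in> I" "b \<in> J" "a \<noteq> 0" "b \<noteq> 0" using frac_nonzero[OF I] frac_nonzero[OF J] by metis
    then have "a * b \<in> ideal_product I J" "a * b \<noteq> 0" by (auto intro: ideal_product_mem)
    then show ?thesis by blast
  qed
  obtain a where a: "a \<in> R" "a \<noteq> 0" "\<And>x. x \<in> I \<Longrightarrow> a * x \<in> R" using frac_denominator[OF I] by blast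
  obtain b where b: "b \<in> R" "b \<noteq> 0" "\<And>x. x \<in> J \<Longrightarrow> b * x \<in> R" using frac_denominator[OF J] by blast
  have "a * b * x \<in> R" if "x \<in> ideal_product I J" for x
    using that
  proof (induction rule: ideal_product_induct)
    case (mult x y)
    have "a * b * (x * y) = (a * x) * (b * y)" by simp
    then show ?case using mult a b R_mult by metis
  qed (auto simp: distrib_left R_add)
  then show "\<exists>c\<in>R. c \<noteq> 0 \<and> (\<forall>x\<in>ideal_product I J. c * x \<in> R)"
    using a b R_mult[OF a(1) b(1)] by (intro bexI[of _ "a * b"]) simp_all
qed (simp_all add: ideal_product_zero ideal_product_add ideal_product_scale[OF I])

lemma frac_R: "frac_ideal R"
  unfolding fractional_ideal_def
proof (intro conjI ballI bexI[of _ 1])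
  show "R \<noteq> {0}" using R_one by (metis singletonD zero_neq_one)
qed (simp_all add: R_subset_K R_add R_mult)

lemma ideal_product_R: "frac_ideal I \<Longrightarrow> ideal_product R I = I"
proof
  assume I: "frac_ideal I"
  show "ideal_product R I \<subseteq> I"
  proof
    fix x assume "x \<in> ideal_product R I"
    then show "x \<in> I" using fracD[OF I] by (induction rule: ideal_product_induct) auto
  qed
  show "I \<subseteq> ideal_product R I" using ideal_product_mem[OF R_one] by fastforce
qed

lemma frac_scale:
  assumes I: "frac_ideal I" and a: "a \<in> K" "a \<noteq> 0"
  shows "frac_ideal ((*) a ` I)"
  unfolding fractional_ideal_def
proof (intro conjI)
  show "(*) a ` I \<subseteq> K" using fracD(1)[OF I] a by auto
  show "0 \<in> (*) a ` I" using fracD(2)[OF I] by force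
  show "(*) a ` I \<noteq> {0}" using frac_nonzero[OF I] a by (metis image_eqI mult_eq_0_iff singletonD)
  show "\<forall>x\<in>(*) a ` I. \<forall>y\<in>(*) a ` I. x + y \<in> (*) a ` I"
    using fracD(3)[OF I] by (auto simp: distrib_left[symmetric])
  show "\<forall>r\<in>R. \<forall>x\<in>(*) a ` I. r * x \<in> (*) a ` I"
    using fracD(4)[OF I] by (auto simp: mult.left_commute[of _ a])
  obtain b where b: "b \<in> R" "b \<noteq> 0" "\<And>x. x \<in> I \<Longrightarrow> b * x \<in> R" using frac_denominator[OF I] by blast
  obtain n :: int where n: "n \<noteq> 0" "of_int n * a \<in> R" using int_span_denominator[OF a(1)] unfolding ring_of_integers_eq by blast
  have "of_int n * b * (a * x) \<in> R" if "x \<in> I" for x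
    using R_mult[OF n(2) b(3)[OF that]] by (simp add: mult_ac)
  then show "\<exists>c\<in>R. c \<noteq> 0 \<and> (\<forall>x\<in>(*) a ` I. c * x \<in> R)"
    using n b R_mult[OF R_of_int b(1), of n] by (intro bexI[of _ "of_int n * b"]) auto
qed

lemma ideal_product_principal:
  assumes "frac_ideal I"
  shows "ideal_product ((*) a ` R) I = (*) a ` I"
proof
  show "ideal_product ((*) a ` R) I \<subseteq> (*) a ` I"
  proof
    fix x assume "x \<in> ideal_product ((*) a ` R) I"
    then show "x \<in> (*) a ` I"
    proof (induction rule: ideal_product_induct)
      case zero then show ?case using fracD(2)[OF assms] by force
    next
      case (add x y) then show ?case using fracD(3)[OF assms] by (auto simp: distrib_left[symmetric])
    next
      case (mult x y) then show ?case using fracD(4)[OF assms] by (auto simp: mult.assoc)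
    qed
  qed
  show "(*) a ` I \<subseteq> ideal_product ((*) a ` R) I"
  proof
    fix x assume "x \<in> (*) a ` I"
    then obtain y where y: "y \<in> I" "x = (a * 1) * y" by auto
    then show "x \<in> ideal_product ((*) a ` R) I"
      by (simp only:) (intro ideal_product_mem imageI R_one)
  qed
qed

text \<open>
  Hurwitz's argument: the integers in the product of \<open>I\<close> with its conjugate form an ideal
  generated by some \<open>g\<close>; for \<open>x, y\<close> in \<open>I\<close> the norm and the trace of \<open>x * qconj y / g\<close>
  are integers, hence \<open>x * qconj y / g\<close> is integral.
\<close>

lemma integral_ideal_inverse:
  assumes I: "frac_ideal I" "I \<subseteq> R"
  shows "\<exists>J. frac_ideal J \<and> ideal_product I J = R"
proof -
  define C where "C = ideal_product I (qconj ` I)"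
  define S where "S = {n :: int. of_int n \<in> C}"
  have IK: "x \<in> K" if "x \<in> I" for x using that I(2) by auto
  have C_scale: "a * x \<in> C" if "a \<in> R" "x \<in> C" for a x
    using ideal_product_scale[OF I(1)] that by (simp add: C_def)
  have C_add: "x + y \<in> C" if "x \<in> C" "y \<in> C" for x y
    using ideal_product_add that by (simp add: C_def)
  have S_add: "m + n \<in> S" if "m \<in> S" "n \<in> S" for m n
    using C_add that by (simp add: S_def)
  have S_mult: "m * n \<in> S" if "n \<in> S" for m n
    using C_scale[OF R_of_int] that by (simp add: S_def)
  have qn: "\<exists>n\<in>S. qnorm x = of_int n" if "x \<in> I" for x
  proof -
    have "x * qconj x \<in> C" unfolding C_def using that by (intro ideal_product_mem imageI)
    then have "of_rat (qnorm x) \<in> C" using mult_qconj[OF IK[OF that]] by simp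
    moreover have "qnorm x \<in> \<int>" using qnorm_int I(2) that by blast
    then obtain n where "qnorm x = of_int n" by (rule Ints_cases)
    ultimately show ?thesis by (auto simp: S_def)
  qed
  have qt: "\<exists>n\<in>S. qtrace (x * qconj y) = of_int n" if "x \<in> I" "y \<in> I" for x y
  proof -
    have xy: "x * qconj y \<in> R" using that I(2) R_mult R_qconj by blast
    have "x * qconj y + y * qconj x \<in> C"
      unfolding C_def using that by (intro ideal_product_add ideal_product_mem imageI)
    also have "x * qconj y + y * qconj x = x * qconj y + qconj (x * qconj y)"
      using that IK by (simp add: qconj_mult mult.commute)
    also have "\<dots> = of_rat (qtrace (x * qconj y))" using xy by (intro add_qconj) simp
    finally have "of_rat (qtrace (x * qconj y)) \<in> C" .
    moreover obtain n where "qtrace (x * qconj y) = of_int n"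
      using qtrace_int[OF xy] by (auto elim: Ints_cases)
    ultimately show ?thesis by (auto simp: S_def)
  qed
  obtain b where b: "b \<in> I" "b \<noteq> 0" using frac_nonzero[OF I(1)] by blast
  obtain n0 where n0: "n0 \<in> S" "qnorm b = of_int n0" using qn[OF b(1)] by blast
  have "n0 \<noteq> 0" using n0 qnorm_eq_0_iff[OF IK[OF b(1)]] b by auto
  moreover have "\<bar>n0\<bar> \<in> S" using n0 S_mult[of n0 "-1"] by (auto simp: abs_if)
  ultimately have "\<exists>k. 0 < k \<and> int k \<in> S" by (intro exI[of _ "nat \<bar>n0\<bar>"]) auto
  then obtain g where g: "0 < g" "int g \<in> S" and gmin: "\<And>k. k < g \<Longrightarrow> \<not> (0 < k \<and> int k \<in> S)"
    using exists_least_iff[of "\<lambda>k. 0 < k \<and> int k \<in> S"] by blast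
  have gdvd: "int g dvd n" if "n \<in> S" for n
  proof -
    have "n mod int g = n + - (n div int g) * int g" by (simp add: minus_div_mult_eq_mod[symmetric])
    then have "n mod int g \<in> S" using S_add[OF that S_mult[OF g(2)]] by metis
    then have "\<not> 0 < nat (n mod int g)"
      using gmin[of "nat (n mod int g)"] g(1) by (simp add: nat_less_iff)
    then have "n mod int g \<le> 0" by simp
    moreover have "0 \<le> n mod int g" using g(1) by simp
    ultimately have "n mod int g = 0" by (rule order_antisym)
    then show ?thesis by auto
  qed
  define h where "h = (of_rat (1 / of_nat g) :: complex)"
  have h: "h \<in> K" "h \<noteq> 0" "h * of_int (int g) = 1"
  proof -
    show "h \<in> K" by (simp only: h_def of_rat_in_K)
  qed (use g(1) in \<open>simp_all add: h_def of_rat_divide\<close>)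
  have integral: "h * (x * qconj y) \<in> R" if xy: "x \<in> I" "y \<in> I" for x y
  proof (rule in_R_if_trace_norm)
    have xyK: "x * qconj y \<in> K" using xy IK by auto
    then show "h * (x * qconj y) \<in> K" using h by blast
    obtain u v where uv: "x * qconj y = elt u v" using xyK by (rule K_cases)
    obtain n where n: "n \<in> S" "qtrace (x * qconj y) = of_int n" using qt xy by blast
    obtain m where m: "n = int g * m" using gdvd[OF n(1)] by auto
    have heq: "h * (x * qconj y) = elt (u / of_nat g) (v / of_nat g)"
      unfolding uv h_def by (simp add: of_rat_eq_elt elt_mult)
    have "qtrace (h * (x * qconj y)) = qtrace (x * qconj y) / of_nat g"
      unfolding heq unfolding uv by (simp add: add_divide_distrib)
    also have "\<dots> = of_int m" using g(1) by (simp add: n m)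
    finally show "qtrace (h * (x * qconj y)) \<in> \<int>" by simp
    \<comment> \<open>The norms of x and of y each lie in \<open>S\<close>, so each is divisible by
      g; their product is divisible by g^2, the denominator introduced by \<open>h\<close>.\<close>
    obtain nx where nx: "nx \<in> S" "qnorm x = of_int nx" using qn xy by blast
    obtain ny where ny: "ny \<in> S" "qnorm y = of_int ny" using qn xy by blast
    obtain mx my where mxy: "nx = int g * mx" "ny = int g * my" using gdvd nx ny by (meson dvdE)
    have "qnorm (qconj y) = qnorm y"
      using IK[OF xy(2)] by (auto elim!: K_cases simp: power2_eq_square algebra_simps)
    moreover have "qnorm h = 1 / (of_nat g * of_nat g)"
      unfolding h_def by (simp add: of_rat_eq_elt power2_eq_square)
    ultimately have "qnorm (h * (x * qconj y)) = of_int (mx * my)"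
      using xy IK h(1) g(1) by (simp add: qnorm_mult K_mult nx ny mxy field_simps)
    then show "qnorm (h * (x * qconj y)) \<in> \<int>" by simp
  qed
  \<comment> \<open>The inverse is the conjugate ideal divided by g: \<open>integral\<close> puts
    the product with I into R, and g in \<open>C\<close> becomes the element 1.\<close>
  define J where "J = (*) h ` qconj ` I"
  have "frac_ideal (qconj ` I)"
    unfolding fractional_ideal_def
  proof (intro conjI)
    show "qconj ` I \<subseteq> K" using IK by auto
    show "0 \<in> qconj ` I" using fracD(2)[OF I(1)] by (force simp: image_iff)
    show "qconj ` I \<noteq> {0}" using b IK qconj_eq_0_iff by (metis imageI singletonD)
    show "\<forall>x\<in>qconj ` I. \<forall>y\<in>qconj ` I. x + y \<in> qconj ` I"
      using fracD(3)[OF I(1)] IK by (auto simp: qconj_add[symmetric])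
    show "\<forall>a\<in>R. \<forall>x\<in>qconj ` I. a * x \<in> qconj ` I"
    proof (intro ballI)
      fix a x assume a: "a \<in> R" and "x \<in> qconj ` I"
      then obtain y where y: "y \<in> I" "x = qconj y" by blast
      have "a * x = qconj (qconj a * y)" using a y IK by (simp add: qconj_mult)
      then show "a * x \<in> qconj ` I" using fracD(4)[OF I(1) R_qconj[OF a] y(1)] by blast
    qed
    show "\<exists>c\<in>R. c \<noteq> 0 \<and> (\<forall>x\<in>qconj ` I. c * x \<in> R)"
      using I(2) R_qconj by (intro bexI[of _ 1]) auto
  qed
  then have "frac_ideal J" unfolding J_def using h by (intro frac_scale)
  moreover have "ideal_product I J = R"
  proof
    show "ideal_product I J \<subseteq> R"
    proof
      fix x assume "x \<in> ideal_product I J"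
      then show "x \<in> R"
        using integral by (induction rule: ideal_product_induct) (auto simp: R_add J_def mult.left_commute)
    qed
    have scaled: "h * x \<in> ideal_product I J" if "x \<in> C" for x
      using that unfolding C_def
    proof (induction rule: ideal_product_induct)
      case (mult x y)
      then have "x * (h * y) \<in> ideal_product I J" unfolding J_def by (intro ideal_product_mem imageI)
      then show ?case by (simp add: mult.left_commute)
    qed (simp_all add: ideal_product_zero ideal_product_add distrib_left)
    have "1 \<in> ideal_product I J" using scaled[of "of_int (int g)"] g(2) h(3) by (simp add: S_def)
    then show "R \<subseteq> ideal_product I J" using ideal_product_scale[OF I(1)] by fastforce
  qed
  ultimately show ?thesis by blast
qed

text \<open>A denominator a of I moves the problem to the integral ideal a I; an inverse J of a I
  yields the inverse a J of I.\<close>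

lemma frac_inverse:
  assumes I: "frac_ideal I"
  shows "\<exists>J. frac_ideal J \<and> ideal_product I J = R"
proof -
  obtain a where a: "a \<in> R" "a \<noteq> 0" "\<And>x. x \<in> I \<Longrightarrow> a * x \<in> R" using frac_denominator[OF I] by blast
  have aI: "frac_ideal ((*) a ` I)" using I a by (intro frac_scale) auto
  moreover have "(*) a ` I \<subseteq> R" using a by auto
  ultimately obtain J where J: "frac_ideal J" "ideal_product ((*) a ` I) J = R"
    using integral_ideal_inverse by blast
  have "ideal_product I ((*) a ` J) = ideal_product ((*) a ` R) (ideal_product I J)"
    using J(1) by (simp only: ideal_product_principal[symmetric] ideal_product_assoc[symmetric]
        ideal_product_commute[of I "(*) a ` R"])
  also have "\<dots> = ideal_product ((*) a ` I) J"
    using I by (simp only: ideal_product_principal ideal_product_assoc[symmetric])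
  finally have "ideal_product I ((*) a ` J) = R" using J by simp
  moreover have "frac_ideal ((*) a ` J)" using J(1) a by (intro frac_scale) auto
  ultimately show ?thesis by blast
qed

lemma comm_group_fractional_ideals: "comm_group (fractional_ideal_group d)"
proof (rule comm_groupI)
  show "\<exists>J\<in>carrier (fractional_ideal_group d).
      J \<otimes>\<^bsub>fractional_ideal_group d\<^esub> I = \<one>\<^bsub>fractional_ideal_group d\<^esub>"
    if "I \<in> carrier (fractional_ideal_group d)" for I
    using frac_inverse[of I] that ideal_product_commute[of I]
    by (auto simp: fractional_ideal_group_def)
qed (simp_all add: fractional_ideal_group_def frac_ideal_product frac_R ideal_product_assoc
       ideal_product_R, rule ideal_product_commute)

abbreviation P where "P \<equiv> principal_fractional_ideals d"

lemma P_iff: "I \<in> P \<longleftrightarrow> (\<exists>a. a \<in> K \<and> a \<noteq> 0 \<and> I = (*) a ` R)"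
  by (auto simp: principal_fractional_ideals_def)

lemma subgroup_principal: "subgroup P (fractional_ideal_group d)"
proof -
  interpret F: comm_group "fractional_ideal_group d" by (rule comm_group_fractional_ideals)
  have mult: "ideal_product ((*) a ` R) ((*) b ` R) = (*) (a * b) ` R" if "b \<in> K" "b \<noteq> 0" for a b
    using that by (simp add: ideal_product_principal frac_scale frac_R image_image mult.assoc)
  have one: "(*) 1 ` R = R" by simp
  show ?thesis
  proof (rule F.subgroupI)
    show "P \<subseteq> carrier (fractional_ideal_group d)"
      using frac_scale[OF frac_R] by (auto simp: P_iff fractional_ideal_group_def)
    show "P \<noteq> {}" using one_in_K P_iff by (metis empty_iff zero_neq_one)
    show "I \<otimes>\<^bsub>fractional_ideal_group d\<^esub> J \<in> P" if IJ: "I \<in> P" "J \<in> P" for I J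
    proof -
      obtain a b where ab: "a \<in> K" "a \<noteq> 0" "I = (*) a ` R" "b \<in> K" "b \<noteq> 0" "J = (*) b ` R"
        using IJ by (auto simp: P_iff)
      then show ?thesis using mult[of b a] K_mult
        by (auto simp: P_iff fractional_ideal_group_def intro!: exI[of _ "a * b"])
    qed
    show "inv\<^bsub>fractional_ideal_group d\<^esub> I \<in> P" if I: "I \<in> P" for I
    proof -
      obtain a where a: "a \<in> K" "a \<noteq> 0" "I = (*) a ` R" using I by (auto simp: P_iff)
      have ia: "inverse a \<in> K" "inverse a \<noteq> 0" using a K_inverse by auto
      have "inv\<^bsub>fractional_ideal_group d\<^esub> I = (*) (inverse a) ` R"
        using a ia frac_scale[OF frac_R] mult[OF a(1,2), of "inverse a"]
        by (intro F.inv_equality) (auto simp: fractional_ideal_group_def)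
      then show ?thesis using ia by (auto simp: P_iff)
    qed
  qed
qed

section \<open>Finiteness of the class group\<close>

lemma qnorm_bound: "\<bar>qnorm (elt u v)\<bar> \<le> s\<^sup>2 * of_int (1 + \<bar>e\<bar> + \<bar>c\<bar>)" if "\<bar>u\<bar> \<le> s" "\<bar>v\<bar> \<le> s"
proof -
  have s: "0 \<le> s" using that by linarith
  have "\<bar>u\<^sup>2\<bar> \<le> s\<^sup>2" "\<bar>v\<^sup>2\<bar> \<le> s\<^sup>2" "\<bar>u * v\<bar> \<le> s\<^sup>2"
    using that s abs_le_square_iff[of u s] abs_le_square_iff[of v s]
    by (simp_all add: abs_mult power2_eq_square mult_mono')
  then have "\<bar>u\<^sup>2\<bar> + \<bar>u * v\<bar> * of_int \<bar>e\<bar> + \<bar>v\<^sup>2\<bar> * of_int \<bar>c\<bar>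
      \<le> s\<^sup>2 + s\<^sup>2 * of_int \<bar>e\<bar> + s\<^sup>2 * of_int \<bar>c\<bar>"
    by (intro add_mono mult_right_mono) auto
  moreover have "\<bar>qnorm (elt u v)\<bar> \<le> \<bar>u\<^sup>2\<bar> + \<bar>u * v\<bar> * of_int \<bar>e\<bar> + \<bar>v\<^sup>2\<bar> * of_int \<bar>c\<bar>"
    unfolding qnorm_elt
    by (rule order_trans[OF abs_triangle_ineq] add_mono)+ (simp_all add: abs_mult)
  ultimately show ?thesis by (simp add: algebra_simps)
qed

text \<open>A substitute for Euclidean division: x itself may be far from R, but a multiple by a
  bounded t comes within norm less than 1, by simultaneous approximation of its two
  coordinates.\<close>

lemma approximation_by_integer:
  obtains M :: nat where "\<And>x. x \<in> K \<Longrightarrow>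
    \<exists>t y. 0 < t \<and> t \<le> M \<and> y \<in> R \<and> \<bar>qnorm (of_nat t * x - y)\<bar> < 1"
proof -
  \<comment> \<open>L is the constant of \<open>qnorm_bound\<close>: coordinates below 1/L give a
    norm below L/L^2 <= 1. Dirichlet's theorem for two numbers at precision 1/L allows multipliers
    up to L^2.\<close>
  define L where "L = nat (1 + \<bar>e\<bar> + \<bar>c\<bar>)"
  have L: "0 < L" "int L = 1 + \<bar>e\<bar> + \<bar>c\<bar>" by (simp_all add: L_def)
  have "\<exists>t y. 0 < t \<and> t \<le> L ^ 2 \<and> y \<in> R \<and> \<bar>qnorm (of_nat t * x - y)\<bar> < 1" if x: "x \<in> K" for x
  proof -
    obtain u v where uv: "x = elt u v" using x by (rule K_cases)
    define th where "th i = (if i = 0 then real_of_rat u else real_of_rat v)" for i :: nat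
    obtain q p where q: "0 < q" "q \<le> int (L ^ 2)"
      and approx: "\<And>i. i < 2 \<Longrightarrow> \<bar>of_int q * th i - of_int (p i)\<bar> < 1 / L"
      using Dirichlet_approx_simult[OF L(1), of 2 th] by blast
    define t where "t = nat q"
    have t: "0 < t" "t \<le> L ^ 2" "int t = q" using q by (auto simp: t_def nat_le_iff)
    define y where "y = elt (of_int (p 0)) (of_int (p 1))"
    have "of_rat \<bar>of_int q * u - of_int (p 0)\<bar> < real_of_rat (1 / of_nat L)"
      "of_rat \<bar>of_int q * v - of_int (p 1)\<bar> < real_of_rat (1 / of_nat L)"
      unfolding abs_of_rat[symmetric]
      using approx[of 0] approx[of 1] by (simp_all add: th_def of_rat_diff of_rat_mult of_rat_divide)
    then have b: "\<bar>of_int q * u - of_int (p 0)\<bar> < 1 / of_nat L" "\<bar>of_int q * v - of_int (p 1)\<bar> < 1 / of_nat L"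
      by (simp_all only: of_rat_less)
    define s where "s = max \<bar>of_int q * u - of_int (p 0)\<bar> \<bar>of_int q * v - of_int (p 1)\<bar>"
    have s: "0 \<le> s" "s * of_nat L < 1" using b L(1) by (auto simp: s_def field_simps max_def)
    have "of_nat t * x - y = elt (of_int q * u - of_int (p 0)) (of_int q * v - of_int (p 1))"
      unfolding uv y_def t(3)[symmetric]
      by (simp add: elt_def of_rat_diff of_rat_mult algebra_simps)
    then have "\<bar>qnorm (of_nat t * x - y)\<bar> \<le> s\<^sup>2 * of_int (1 + \<bar>e\<bar> + \<bar>c\<bar>)"
      by (simp only:) (intro qnorm_bound, simp_all only: s_def max.cobounded1 max.cobounded2)
    also have "\<dots> = s * (s * of_nat L)" unfolding L(2)[symmetric] by (simp add: power2_eq_square)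
    also have "\<dots> < 1"
    proof -
      have "s \<le> s * of_nat L" using s(1) L(1) by (simp add: mult_le_cancel_left1)
      then have "s < 1" using s(2) by linarith
      then show ?thesis using s mult_strict_mono'[of s 1 "s * of_nat L" 1] by simp
    qed
    finally show ?thesis using t by (intro exI[of _ t] exI[of _ y]) (auto simp: y_def elt_in_R)
  qed
  then show thesis using that by blast
qed

definition ideals_containing :: "nat \<Rightarrow> complex set set" where
  "ideals_containing m = {J. frac_ideal J \<and> J \<subseteq> R \<and> of_nat m \<in> J}"

text \<open>An ideal containing m is a union of residue classes modulo m, so it is determined by its
  trace on the finite box \<open>B\<close> of reduced representatives.\<close>

lemma finite_ideals_containing:
  assumes "0 < m"
  shows "finite (ideals_containing m)"
proof -
  define B where "B = (\<lambda>(a, b). elt (of_int a) (of_int b)) ` ({0..<int m} \<times> {0..<int m})"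
  have red: "elt (of_int a) (of_int b) \<in> J \<longleftrightarrow> elt (of_int (a mod int m)) (of_int (b mod int m)) \<in> J"
    if J: "J \<in> ideals_containing m" for J a b
  proof -
    have fJ: "frac_ideal J" "of_nat m \<in> J" using J by (auto simp: ideals_containing_def)
    define y where "y = elt (of_int (a div int m)) (of_int (b div int m)) * of_nat m"
    have yJ: "y \<in> J" unfolding y_def using fJ by (intro fracD(4)) (auto simp: elt_in_R)
    have ab: "rat_of_int a = of_int (a div int m) * of_nat m + of_int (a mod int m)" for a
      by (metis div_mult_mod_eq of_int_add of_int_mult of_int_of_nat_eq)
    have "elt (of_int a) (of_int b) = y + elt (of_int (a mod int m)) (of_int (b mod int m))"
      unfolding y_def by (subst (1 2) ab) (simp add: elt_def of_rat_add of_rat_mult algebra_simps)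
    then show ?thesis
      using fracD(3)[OF fJ(1) yJ] frac_diff[OF fJ(1) _ yJ] by (metis add_diff_cancel_left')
  qed
  have "inj_on (\<lambda>J. J \<inter> B) (ideals_containing m)"
  proof (rule inj_onI)
    fix I J assume IJ: "I \<in> ideals_containing m" "J \<in> ideals_containing m" "I \<inter> B = J \<inter> B"
    have "x \<in> I \<longleftrightarrow> x \<in> J" if xR: "x \<in> R" for x
    proof -
      obtain a b where x: "x = elt (of_int a) (of_int b)" using xR by (rule R_cases)
      have "elt (of_int (a mod int m)) (of_int (b mod int m)) \<in> B"
        unfolding B_def using assms by force
      then show ?thesis using red[OF IJ(1)] red[OF IJ(2)] IJ(3) unfolding x by blast
    qed
    then show "I = J" using IJ by (auto simp: ideals_containing_def)
  qed
  moreover have "(\<lambda>J. J \<inter> B) ` ideals_containing m \<subseteq> Pow B" by blast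
  moreover have "finite (Pow B)" by (simp add: B_def)
  ultimately show ?thesis using finite_imageD finite_subset by metis
qed

text \<open>Let J be an integral multiple of I and b a nonzero element of J with least absolute
  norm. For x in J, some t <= M and y in R make t x - y b smaller in norm than b, hence zero, so t x
  / b is integral. Since t divides M!, the ideal (M!/b) J lies in R, and it contains M! as the image
  of b. Thus \<open>m = fact M\<close> works for every class.\<close>

lemma ideal_class_bounded_representative:
  obtains m :: nat where "0 < m"
    "\<And>I. frac_ideal I \<Longrightarrow> \<exists>a. a \<in> K \<and> a \<noteq> 0 \<and> (*) a ` I \<in> ideals_containing m"
proof -
  obtain M :: nat where M: "\<And>x. x \<in> K \<Longrightarrow>
    \<exists>t y. 0 < t \<and> t \<le> M \<and> y \<in> R \<and> \<bar>qnorm (of_nat t * x - y)\<bar> < 1"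
    using approximation_by_integer by blast
  have "\<exists>a. a \<in> K \<and> a \<noteq> 0 \<and> (*) a ` I \<in> ideals_containing (fact M)" if I: "frac_ideal I" for I
  proof -
    obtain k where k: "k \<in> R" "k \<noteq> 0" "\<And>x. x \<in> I \<Longrightarrow> k * x \<in> R" using frac_denominator[OF I] by blast
    define J where "J = (*) k ` I"
    have J: "frac_ideal J" "J \<subseteq> R" using frac_scale[OF I] k by (auto simp: J_def)
    define f where "f x = nat \<lfloor>\<bar>qnorm x\<bar>\<rfloor>" for x
    have fq: "of_nat (f x) = \<bar>qnorm x\<bar>" if "x \<in> R" for x
    proof -
      obtain n where "qnorm x = of_int n" using qnorm_int[OF \<open>x \<in> R\<close>] by (auto elim: Ints_cases)
      then show ?thesis by (simp add: f_def)
    qed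
    have "\<exists>b. b \<in> J \<and> b \<noteq> 0" using frac_nonzero[OF J(1)] by metis
    then obtain b where b: "b \<in> J" "b \<noteq> 0" and bmin: "\<And>x. x \<in> J \<Longrightarrow> x \<noteq> 0 \<Longrightarrow> f b \<le> f x"
      using ex_has_least_nat[of "\<lambda>b. b \<in> J \<and> b \<noteq> 0" _ f] by blast
    have bR: "b \<in> R" using b J by blast
    have key: "of_nat (fact M) / b * x \<in> R" if x: "x \<in> J" for x
    proof -
      have xR: "x \<in> R" using x J by blast
      have "x / b \<in> K" using xR bR by auto
      then obtain t y where t: "0 < t" "t \<le> M" and y: "y \<in> R" "\<bar>qnorm (of_nat t * (x / b) - y)\<bar> < 1"
        using M by blast
      define z where "z = of_nat t * x - y * b"
      have zJ: "z \<in> J" unfolding z_def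
        using fracD(4)[OF J(1) R_of_int[of "int t"] x] fracD(4)[OF J(1) y(1) b(1)]
        by (intro frac_diff[OF J(1)]) auto
      have "z = b * (of_nat t * (x / b) - y)" using b by (simp add: z_def field_simps)
      moreover have "of_nat t * (x / b) - y \<in> K"
        by (intro K_diff K_mult of_nat_in_K \<open>x / b \<in> K\<close> R_in_K y(1))
      ultimately have "qnorm z = qnorm b * qnorm (of_nat t * (x / b) - y)"
        using bR by (simp add: qnorm_mult)
      then have "\<bar>qnorm z\<bar> < \<bar>qnorm b\<bar>"
        using y(2) qnorm_eq_0_iff[of b] b bR by (simp add: abs_mult)
      then have "f z < f b" using fq[OF bR] fq[of z] zJ J(2) by (metis of_nat_less_iff subsetD)
      then have "z = 0" using bmin[OF zJ] by force
      then have "x = y * b / of_nat t" using t by (simp add: z_def field_simps)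
      moreover obtain r where "fact M = t * r" using dvd_fact[of t M] t by (auto elim: dvdE)
      ultimately have "of_nat (fact M) / b * x = of_int (int r) * y"
        using t b by (simp only:) (simp add: field_simps)
      then show ?thesis using R_mult[OF R_of_int y(1)] by metis
    qed
    define a where "a = of_nat (fact M) / b * k"
    have "a \<in> K" unfolding a_def by (intro K_mult K_divide of_nat_in_K R_in_K bR k(1))
    moreover have "a \<noteq> 0" using k(2) b(2) by (simp add: a_def)
    ultimately have a: "a \<in> K" "a \<noteq> 0" .
    have aI: "(*) a ` I = (*) (of_nat (fact M) / b) ` J"
      by (simp add: a_def J_def image_image mult.assoc)
    have "frac_ideal ((*) a ` I)" using I a by (rule frac_scale)
    moreover have "(*) a ` I \<subseteq> R" using key by (auto simp: aI)
    moreover have "of_nat (fact M) \<in> (*) a ` I"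
      unfolding aI using b by (intro image_eqI[of _ _ b]) simp_all
    ultimately show ?thesis using a unfolding ideals_containing_def by blast
  qed
  then show thesis using that[of "fact M"] by (simp add: fact_gt_zero)
qed

text \<open>Every coset of the principal ideals meets the finite set
  \<open>ideals_containing m\<close>, so there are finitely many cosets.\<close>

theorem class_group_finite_comm_group:
  "comm_group (class_group d)" "finite (carrier (class_group d))"
proof -
  let ?F = "fractional_ideal_group d"
  interpret F: comm_group ?F by (rule comm_group_fractional_ideals)
  show "comm_group (class_group d)"
    unfolding class_group_def using subgroup_principal by (rule F.abelian_FactGroup)
  obtain m :: nat where m: "0 < m"
    "\<And>I. frac_ideal I \<Longrightarrow> \<exists>a. a \<in> K \<and> a \<noteq> 0 \<and> (*) a ` I \<in> ideals_containing m"
    using ideal_class_bounded_representative by blast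
  have "carrier (class_group d) \<subseteq> (\<lambda>J. P #>\<^bsub>?F\<^esub> J) ` ideals_containing m"
  proof
    fix X assume "X \<in> carrier (class_group d)"
    then obtain I where I: "frac_ideal I" "X = P #>\<^bsub>?F\<^esub> I"
      by (auto simp: class_group_def carrier_FactGroup fractional_ideal_group_def)
    obtain a where a: "a \<in> K" "a \<noteq> 0" "(*) a ` I \<in> ideals_containing m" using m(2)[OF I(1)] by blast
    have "(*) a ` I = (*) a ` R \<otimes>\<^bsub>?F\<^esub> I"
      using ideal_product_principal[OF I(1)] by (simp add: fractional_ideal_group_def)
    then have "(*) a ` I \<in> P #>\<^bsub>?F\<^esub> I" using a P_iff unfolding r_coset_def by blast
    then have "P #>\<^bsub>?F\<^esub> I = P #>\<^bsub>?F\<^esub> ((*) a ` I)"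
      using I(1) subgroup_principal by (intro F.repr_independence) (auto simp: fractional_ideal_group_def)
    then show "X \<in> (\<lambda>J. P #>\<^bsub>?F\<^esub> J) ` ideals_containing m" using I(2) a(3) by blast
  qed
  then show "finite (carrier (class_group d))"
    using finite_ideals_containing[OF m(1)] finite_surj by blast
qed

end

section \<open>Fundamental discriminants yield maximal quadratic orders\<close>

lemma rat_square_int:
  assumes "(r :: rat)\<^sup>2 = of_int n"
  shows "r \<in> \<int>"
proof -
  obtain a b where ab: "r = of_int a / of_int b" "b > 0" "coprime a b"
    by (cases r rule: Rat_cases) (auto simp: Fract_of_int_quotient)
  have "of_int (a\<^sup>2) = (of_int (n * b\<^sup>2) :: rat)"
    using assms ab by (simp add: power_divide field_simps)
  then have "a\<^sup>2 = n * b\<^sup>2" by (simp only: of_int_eq_iff)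
  then have "b dvd a" by (metis dvd_triv_right pow_divides_pow_iff pos2)
  then have "b dvd 1" using ab(3) by (metis coprime_common_divisor dvd_refl)
  then show ?thesis using ab by simp
qed

lemma odd_square_mod_4:
  assumes "odd x"
  shows "(x\<^sup>2 :: int) mod 4 = 1"
proof -
  obtain y where y: "x = 2 * y + 1" using assms by (blast elim: oddE)
  define z where "z = y\<^sup>2 + y"
  have "x\<^sup>2 = 4 * z + 1" by (simp add: y z_def power2_eq_square algebra_simps)
  then show ?thesis by simp
qed

lemma square_mod_4: "(x\<^sup>2 :: int) mod 4 = 0 \<or> x\<^sup>2 mod 4 = 1"
proof (cases "even x")
  case True
  then obtain y where "x = 2 * y" by blast
  then show ?thesis by (simp add: power2_eq_square)
qed (simp add: odd_square_mod_4)

lemma fundamental_discriminant_cases: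
  assumes "fundamental_discriminant d"
  obtains (odd) "d \<noteq> 1" "d mod 4 = 1" "squarefree d"
    | (even) m where "d = 4 * m" "m mod 4 = 2 \<or> m mod 4 = 3" "squarefree m"
proof (cases "d mod 4 = 1 \<and> squarefree d")
  case True
  then show thesis using assms odd unfolding fundamental_discriminant_def by blast
next
  case False
  then obtain m where "d = 4 * m" "m mod 4 = 2 \<or> m mod 4 = 3" "squarefree m"
    using assms unfolding fundamental_discriminant_def by blast
  then show thesis by (rule even)
qed

text \<open>In the odd case a squarefree square is 1, which the definition excludes. In the even
  case m would be a square, but squares are 0 or 1 modulo 4.\<close>

lemma fundamental_discriminant_not_square:
  assumes "fundamental_discriminant d"
  shows "d \<noteq> k\<^sup>2"
proof
  assume k: "d = k\<^sup>2"
  from assms show False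
  proof (cases rule: fundamental_discriminant_cases)
    case odd
    have "k dvd 1" by (rule squarefreeD[OF odd(3)]) (simp add: k)
    then have "k\<^sup>2 = 1" by (metis one_power2 power2_abs zdvd1_eq)
    then show False using odd(1) k by simp
  next
    case (even m)
    then have "even k" using k by (metis dvd_mult2 dvd_triv_left even_numeral even_power pos2)
    then obtain j where "k = 2 * j" by blast
    then have "m = j\<^sup>2" using k even by (simp add: power2_eq_square)
    then show False using even(2) square_mod_4[of j] by auto
  qed
qed

text \<open>This makes the norm (d^2 - d)/4 of the generator an integer.\<close>

lemma fundamental_discriminant_dvd:
  assumes "fundamental_discriminant d"
  shows "4 dvd d\<^sup>2 - d"
  using assms
proof (cases rule: fundamental_discriminant_cases)
  case odd
  then have "4 dvd d - 1" by (simp add: mod_eq_dvd_iff[of d 4 1, symmetric])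
  then have "4 dvd d * (d - 1)" by simp
  then show ?thesis by (simp add: power2_eq_square algebra_simps)
next
  case even then show ?thesis by (simp add: power2_eq_square)
qed

text \<open>The right-hand side is the discriminant of X^2 - t X + n. Writing v = a/b in lowest
  terms, b^2 divides d. Squarefreeness leaves b = 1 or, for d = 4m, also b = 2 with a odd; then m
  would be congruent to t^2 modulo 4, against m being 2 or 3 modulo 4.\<close>

lemma fundamental_discriminant_square_factor:
  assumes d: "fundamental_discriminant d" and v: "(v :: rat)\<^sup>2 * of_int d = of_int (t\<^sup>2 - 4 * n)"
  shows "v \<in> \<int>"
proof -
  obtain a b where ab: "v = of_int a / of_int b" "b > 0" "coprime a b"
    by (cases v rule: Rat_cases) (auto simp: Fract_of_int_quotient)
  have "of_int (a\<^sup>2 * d) = (of_int ((t\<^sup>2 - 4 * n) * b\<^sup>2) :: rat)"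
    using v ab by (simp add: power_divide field_simps)
  then have eq: "a\<^sup>2 * d = (t\<^sup>2 - 4 * n) * b\<^sup>2" by (simp only: of_int_eq_iff)
  then have "b\<^sup>2 dvd a\<^sup>2 * d" by simp
  moreover have "coprime (b\<^sup>2) (a\<^sup>2)" using ab by (simp add: coprime_commute)
  ultimately have bd: "b\<^sup>2 dvd d" by (simp add: coprime_dvd_mult_right_iff)
  from d have "b dvd 1"
  proof (cases rule: fundamental_discriminant_cases)
    case odd
    show ?thesis by (rule squarefreeD[OF odd(3) bd])
  next
    case (even m)
    show ?thesis
    proof (cases "2 dvd b")
      case False
      then have "coprime b 2" by simp
      then have "coprime (b\<^sup>2) (2 ^ 2)"
        by (simp only: coprime_power_left_iff coprime_power_right_iff) simp
      then have "b\<^sup>2 dvd m" using bd even(1) by (simp add: coprime_dvd_mult_right_iff)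
      then show ?thesis by (rule squarefreeD[OF even(3)])
    next
      case True
      then obtain b' where b': "b = 2 * b'" by blast
      then have "b'\<^sup>2 dvd m" using bd even(1) by (simp add: power2_eq_square)
      then have "b' dvd 1" by (rule squarefreeD[OF even(3)])
      then have "b = 2" using b' ab(2) by simp
      moreover from this have "odd a" using ab(3) by (metis coprime_common_divisor dvd_refl odd_one)
      ultimately have "a\<^sup>2 * m = t\<^sup>2 - 4 * n" using eq even(1) by simp
      then have "(a\<^sup>2 * m) mod 4 = t\<^sup>2 mod 4" by (metis mod_mult_self2 diff_add_cancel mult.commute)
      then have "m mod 4 = t\<^sup>2 mod 4"
        using odd_square_mod_4[OF \<open>odd a\<close>] by (metis mod_mult_left_eq mult_1)
      then show ?thesis using square_mod_4[of t] even(2) by auto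
    qed
  qed
  then show ?thesis using ab by simp
qed

text \<open>The generator (d + sqrt d)/2 serves both kinds of fundamental discriminant at once; it
  has trace d and norm (d^2 - d)/4.\<close>

lemma quadratic_order_fundamental:
  assumes d: "fundamental_discriminant d"
  shows "quadratic_order d ((of_int d + csqrt (of_int d)) / 2) d ((d\<^sup>2 - d) div 4)"
proof
  define s where "s = csqrt (of_int d)"
  define c where "c = (d\<^sup>2 - d) div 4"
  have s2: "s\<^sup>2 = of_int d" by (simp add: s_def)
  have c4: "4 * c = d\<^sup>2 - d" using fundamental_discriminant_dvd[OF d] by (simp add: c_def)
  have irr: "b = 0" if "of_rat a + of_rat b * s = 0" for a b
  proof (rule ccontr)
    assume b: "b \<noteq> 0"
    then have "s = of_rat (- a / b)"
      using that by (simp add: of_rat_divide of_rat_minus field_simps eq_neg_iff_add_eq_0)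
    then have "of_rat ((- a / b)\<^sup>2) = (of_rat (of_int d) :: complex)"
      unfolding of_rat_power of_rat_of_int_eq using s2 by (simp only:)
    then have sq: "(- a / b)\<^sup>2 = of_int d" by (simp only: of_rat_eq_iff)
    then obtain k where "- a / b = of_int k" using rat_square_int by (metis Ints_cases)
    then have "of_int (k\<^sup>2) = (of_int d :: rat)" using sq by simp
    then have "d = k\<^sup>2" by (simp only: of_int_eq_iff)
    then show False using fundamental_discriminant_not_square[OF d] by blast
  qed
  show "quadratic_field d = {of_rat u + of_rat v * ((of_int d + csqrt (of_int d)) / 2) | u v. True}"
  proof (intro equalityI subsetI)
    fix x assume "x \<in> quadratic_field d"
    then obtain a b where x: "x = of_rat a + of_rat b * s" by (auto simp: quadratic_field_def s_def)
    have "x = of_rat (a - b * of_int d) + of_rat (2 * b) * ((of_int d + s) / 2)"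
      by (simp add: x of_rat_diff of_rat_mult algebra_simps)
    then show "x \<in> {of_rat u + of_rat v * ((of_int d + csqrt (of_int d)) / 2) | u v. True}"
      unfolding s_def by blast
  next
    fix x assume "x \<in> {of_rat u + of_rat v * ((of_int d + csqrt (of_int d)) / 2) | u v. True}"
    then obtain u v where x: "x = of_rat u + of_rat v * ((of_int d + s) / 2)" by (auto simp: s_def)
    have "x = of_rat (u + v * of_int d / 2) + of_rat (v / 2) * s"
      by (simp add: x of_rat_add of_rat_mult of_rat_divide algebra_simps add_divide_distrib)
    then show "x \<in> quadratic_field d" unfolding quadratic_field_def s_def by blast
  qed
  show "((of_int d + csqrt (of_int d)) / 2)\<^sup>2
      = of_int d * ((of_int d + csqrt (of_int d)) / 2) - of_int ((d\<^sup>2 - d) div 4)"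
  proof -
    have "4 * (of_int c :: complex) = of_int (d\<^sup>2 - d)" unfolding c4[symmetric] by simp
    then have c: "of_int c = (of_int (d\<^sup>2 - d) / 4 :: complex)"
      by (metis nonzero_mult_div_cancel_left zero_neq_numeral)
    have "((of_int d + s) / 2)\<^sup>2 = ((of_int d)\<^sup>2 + 2 * of_int d * s + s\<^sup>2) / 4"
      by (simp add: power_divide power2_sum algebra_simps)
    also have "\<dots> = of_int d * ((of_int d + s) / 2) - of_int c"
      unfolding s2 c by (simp add: field_simps power2_eq_square)
    finally show ?thesis by (simp add: s_def c_def)
  qed
  fix u v :: rat
  show "u = 0 \<and> v = 0" if "of_rat u + of_rat v * ((of_int d + csqrt (of_int d)) / 2) = 0"
  proof -
    have "of_rat (u + v * of_int d / 2) + of_rat (v / 2) * s = 0"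
      using that by (simp add: s_def of_rat_add of_rat_mult of_rat_divide algebra_simps add_divide_distrib)
    from irr[OF this] have "v = 0" by simp
    then show ?thesis using that by simp
  qed
  assume T: "2 * u + v * of_int d \<in> \<int>"
    and N: "u\<^sup>2 + u * v * of_int d + v\<^sup>2 * of_int ((d\<^sup>2 - d) div 4) \<in> \<int>"
  obtain t where t: "2 * u + v * of_int d = of_int t" using T by (rule Ints_cases)
  obtain n where n: "u\<^sup>2 + u * v * of_int d + v\<^sup>2 * of_int c = of_int n"
    using N unfolding c_def by (rule Ints_cases)
  have "4 * (of_int c :: rat) = of_int (d\<^sup>2 - d)" unfolding c4[symmetric] by simp
  then have c: "4 * (of_int c :: rat) = (of_int d)\<^sup>2 - of_int d" by simp
  have n4: "4 * of_int n = 4 * u\<^sup>2 + 4 * u * v * of_int d + v\<^sup>2 * (4 * of_int c)"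
    unfolding n[symmetric] by (simp add: algebra_simps)
  \<comment> \<open>The square of the difference of the two conjugates, expressed by trace and
    norm.\<close>
  have "v\<^sup>2 * of_int d = (of_int t)\<^sup>2 - 4 * of_int n"
    unfolding n4 c t[symmetric] by (simp add: power2_eq_square algebra_simps)
  then have "v\<^sup>2 * of_int d = of_int (t\<^sup>2 - 4 * n)" by simp
  then have "v \<in> \<int>" by (rule fundamental_discriminant_square_factor[OF d])
  then obtain k where k: "v = of_int k" by (rule Ints_cases)
  \<comment> \<open>With v integral, the trace only makes x = 2u an integer; the norm equation then
    shows that x^2, hence x, is even.\<close>
  define x where "x = t - k * d"
  have x: "2 * u = of_int x" using t by (simp add: x_def k)
  have "of_int (4 * n) = (2 * u)\<^sup>2 + 2 * (2 * u) * v * of_int d + v\<^sup>2 * (4 * of_int c)"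
    using n4 by (simp add: power2_eq_square algebra_simps)
  also have "\<dots> = (of_int (x\<^sup>2 + 2 * x * k * d + k\<^sup>2 * (4 * c)) :: rat)"
    unfolding x k by simp
  finally have "4 * n = x\<^sup>2 + 2 * x * k * d + k\<^sup>2 * (4 * c)" by (simp only: of_int_eq_iff)
  then have "x\<^sup>2 = 2 * (2 * n - x * k * d - k\<^sup>2 * (2 * c))" by (simp add: algebra_simps)
  then have "even (x\<^sup>2)" by (metis dvd_triv_left)
  then have "even x" by simp
  then obtain y where "x = 2 * y" by blast
  then have "u = of_int y" using x by simp
  then show "u \<in> \<int> \<and> v \<in> \<int>" using k by simp
qed

theorem class_group_fundamental_discriminant:
  assumes "fundamental_discriminant d"
  shows "comm_group (class_group d)" "finite (carrier (class_group d))"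
proof -
  interpret quadratic_order d "(of_int d + csqrt (of_int d)) / 2" d "(d\<^sup>2 - d) div 4"
    by (rule quadratic_order_fundamental[OF assms])
  show "comm_group (class_group d)" "finite (carrier (class_group d))"
    by (rule class_group_finite_comm_group)+
qed

section \<open>q-series and inversion at one level\<close>

text \<open>
  The product of \<open>sur_factor q n\<^bsub>i+1\<^esub> n\<^sub>i r\<^sub>i\<close> over all \<open>i\<close> is, for \<open>q = p\<close>, the number of surjections from
  a finite abelian \<open>p\<close>-group with ranks \<open>r\<close> to one with ranks \<open>n\<close>. The coefficients \<open>inv_factor\<close>
  come from q-binomial inversion.
\<close>

definition sur_factor :: "real \<Rightarrow> nat \<Rightarrow> nat \<Rightarrow> nat \<Rightarrow> real" where
  "sur_factor q n N r = q ^ (r * n) * (\<Prod>j=n..<N. q ^ r - q ^ j)"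

definition inv_factor :: "real \<Rightarrow> nat \<Rightarrow> nat \<Rightarrow> nat \<Rightarrow> real" where
  "inv_factor q n N mu =
     (- 1) ^ (N - mu) * (1 / q) ^ ((N - mu choose 2) + (mu + 1) * (N - mu) + mu\<^sup>2) /
     (qpochhammer (1 / q) (1 / q) (mu - n) * qpochhammer (1 / q) (1 / q) (N - mu))"

lemma qpochhammer_0 [simp]: "qpochhammer a q 0 = 1"
  by (simp add: qpochhammer_def)

lemma qpochhammer_Suc: "qpochhammer a q (Suc k) = qpochhammer a q k * (1 - a * q ^ k)"
  by (simp add: qpochhammer_def)

lemma qpochhammer_add:
  "qpochhammer a q (m + n) = qpochhammer a q m * qpochhammer (a * q ^ m) q n"
  by (induction n) (simp_all add: qpochhammer_Suc power_add algebra_simps)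

lemma qpochhammer_pos:
  assumes "0 \<le> q" "q < 1" "0 \<le> a" "a < 1"
  shows "0 < qpochhammer a q k"
  unfolding qpochhammer_def
proof (intro prod_pos)
  fix i
  have "a * q ^ i \<le> a * 1"
    using assms by (intro mult_left_mono power_le_one) auto
  then show "0 < 1 - a * q ^ i" using assms by linarith
qed

lemma qpochhammer_qq_pos: "1 < q \<Longrightarrow> 0 < qpochhammer (1 / q) (1 / q) k" for q :: real
  by (rule qpochhammer_pos) auto

lemma sur_factor_Suc:
  "n \<le> N \<Longrightarrow> sur_factor q n (Suc N) r = sur_factor q n N r * (q ^ r - q ^ N)"
  by (simp add: sur_factor_def)

lemma sur_factor_eq_0: "n \<le> r \<Longrightarrow> r < N \<Longrightarrow> sur_factor q n N r = 0"
  by (auto simp: sur_factor_def)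

lemma sur_factor_nonneg:
  assumes "1 < q" "n \<le> r"
  shows "0 \<le> sur_factor q n N r"
proof (cases "N \<le> r")
  case True
  then show ?thesis
    using assms unfolding sur_factor_def
    by (intro mult_nonneg_nonneg prod_nonneg) (auto intro!: power_increasing)
next
  case False
  then show ?thesis using sur_factor_eq_0[of n r N q] assms by simp
qed

lemma choose_two_Suc: "Suc k choose 2 = (k choose 2) + k"
  by (simp add: numeral_2_eq_2)

text \<open>Passing from N to N + 1 raises the exponent of 1/q by N + 1 and adds one Pochhammer
  factor. Combined with \<open>sur_factor_Suc\<close>, this gives the ratio of consecutive terms in
  the inversion sum.\<close>

lemma inv_factor_Suc:
  assumes "1 < q" "mu \<le> N"
  shows "inv_factor q n (Suc N) mu * (q ^ mu * (q ^ Suc (N - mu) - 1)) = - inv_factor q n N mu"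
proof -
  obtain k where N: "N = mu + k" using assms le_Suc_ex by blast
  define P where "P = qpochhammer (1 / q) (1 / q)"
  have P: "P j > 0" for j using qpochhammer_qq_pos[OF assms(1)] by (simp add: P_def)
  have q: "q > 0" "q ^ Suc k > 1" using assms one_less_power[of q "Suc k"] by auto
  have PS: "P (Suc k) * q ^ Suc k = P k * (q ^ Suc k - 1)"
    using q by (simp add: P_def qpochhammer_Suc field_simps)
  define e where "e = (k choose 2) + (mu + 1) * k + mu\<^sup>2"
  have e: "(Suc k choose 2) + (mu + 1) * Suc k + mu\<^sup>2 = e + (mu + Suc k)"
    by (simp add: e_def choose_two_Suc)
  have **: "inv_factor q n (Suc N) mu * (q ^ mu * (q ^ Suc k - 1))
     = - ((-1) ^ k * (1 / q) ^ e * (1/q) ^ (mu + Suc k) * (q ^ mu * (q ^ Suc k - 1)) / (P (mu - n) * P (Suc k)))"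
    unfolding inv_factor_def N P_def[symmetric]
    by (simp only: add_diff_cancel_left' add_Suc_right[symmetric] e)
       (simp add: power_add)
  have *: "(1/q) ^ (mu + Suc k) * (q ^ mu * (q ^ Suc k - 1)) / P (Suc k) = 1 / P k"
  proof -
    have "(1/q) ^ (mu + Suc k) * q ^ mu = 1 / q ^ Suc k"
      using q by (simp add: power_add power_divide)
    then have "(1/q) ^ (mu + Suc k) * (q ^ mu * (q ^ Suc k - 1)) / P (Suc k)
        = (q ^ Suc k - 1) / (q ^ Suc k * P (Suc k))"
      by (simp only: mult.assoc[symmetric]) simp
    also have "\<dots> = 1 / P k"
      using PS P[of k] P[of "Suc k"] q by (simp add: frac_eq_eq mult.commute)
    finally show ?thesis .
  qed
  have "a * b * x * y / (c * d) = a * b / c * (x * y / d)" for a b c d x y :: real by simp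
  note this[of "(-1) ^ k" "(1/q) ^ e" "(1/q) ^ (mu + Suc k)" "q ^ mu * (q ^ Suc k - 1)" "P (mu - n)" "P (Suc k)"]
  also note *
  finally have "- ((-1) ^ k * (1 / q) ^ e * (1/q) ^ (mu + Suc k) * (q ^ mu * (q ^ Suc k - 1)) / (P (mu - n) * P (Suc k)))
    = - ((-1) ^ k * (1 / q) ^ e / P (mu - n) * (1 / P k))" by simp
  with ** have "inv_factor q n (Suc N) mu * (q ^ mu * (q ^ Suc k - 1))
      = - ((-1) ^ k * (1 / q) ^ e / P (mu - n) * (1 / P k))" by simp
  then show ?thesis
    unfolding inv_factor_def N P_def[symmetric] by (simp add: e_def)
qed

text \<open>Reversing the order of the factors turns the product of q^mu - q^j into a power of q
  times a Pochhammer symbol, which is what \<open>inv_factor\<close> divides by. This normalises the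
  leading term of the inversion sum to 1.\<close>

lemma inv_factor_times_sur_factor_diag:
  assumes "1 < q" "n \<le> mu"
  shows "inv_factor q n mu mu * sur_factor q n mu mu = 1"
proof -
  obtain k where mu: "mu = n + k" using assms le_Suc_ex by blast
  have "(\<Prod>j=n..<n+k. q ^ (n+k) - q ^ j) = q ^ ((n+k) * k) * qpochhammer (1 / q) (1 / q) k"
  proof -
    have "(\<Prod>j=n..<n+k. q ^ (n+k) - q ^ j) = (\<Prod>i<k. q ^ (n+k) - q ^ (n + k - Suc i))"
      by (rule prod.reindex_bij_witness[of _ "\<lambda>i. n + k - Suc i" "\<lambda>j. n + k - Suc j"]) auto
    also have "\<dots> = (\<Prod>i<k. q ^ (n+k) * (1 - (1/q) * (1/q) ^ i))"
    proof (rule prod.cong)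
      fix i assume "i \<in> {..<k}"
      then have "q ^ (n+k) = q ^ (n + k - Suc i) * q ^ Suc i"
        by (subst power_add[symmetric]) simp
      then show "q ^ (n+k) - q ^ (n + k - Suc i) = q ^ (n+k) * (1 - (1/q) * (1/q) ^ i)"
        using assms by (simp add: field_simps)
    qed simp
    also have "\<dots> = q ^ ((n+k) * k) * qpochhammer (1 / q) (1 / q) k"
      by (simp add: prod.distrib qpochhammer_def power_mult)
    finally show ?thesis .
  qed
  moreover have "mu * n + (n + k) * k = mu\<^sup>2" by (simp add: mu power2_eq_square algebra_simps)
  ultimately have "sur_factor q n mu mu = q ^ (mu\<^sup>2) * qpochhammer (1 / q) (1 / q) k"
    unfolding sur_factor_def by (simp add: mu power_add[symmetric])
  then show ?thesis using qpochhammer_qq_pos[OF assms(1), of k] assms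
    by (simp add: inv_factor_def mu numeral_2_eq_2 field_simps)
qed

text \<open>
  A Bonferroni inequality. With \<open>u\<^sub>k\<close> the \<open>k\<close>-th term of the alternating sum and \<open>R = r - mu > 0\<close>, the
  partial sums telescope: \<open>(q\<^sup>R - 1) (u\<^sub>0 + \<dots> + u\<^bsub>K-1\<^esub>) = - (q\<^sup>K - 1) u\<^sub>K\<close>.
\<close>

lemma one_level_inversion:
  assumes "1 < q" "n \<le> mu" "n \<le> r" "mu \<le> b"
  shows "\<bar>of_bool (r = mu) - (\<Sum>N=mu..<b. inv_factor q n N mu * sur_factor q n N r)\<bar>
           \<le> \<bar>inv_factor q n b mu\<bar> * sur_factor q n b r"
proof -
  define u where "u k = inv_factor q n (mu + k) mu * sur_factor q n (mu + k) r" for k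
  obtain K where b: "b = mu + K" using assms le_Suc_ex by blast
  have shift: "(\<Sum>N=mu..<b. inv_factor q n N mu * sur_factor q n N r) = (\<Sum>k<K. u k)"
    unfolding b u_def
    by (rule sum.reindex_bij_witness[of _ "\<lambda>k. mu + k" "\<lambda>N. N - mu"]) auto
  have uK: "\<bar>inv_factor q n b mu\<bar> * sur_factor q n b r = \<bar>u K\<bar>"
    using sur_factor_nonneg[OF assms(1,3)] by (simp add: u_def b abs_mult)
  have rec: "u (Suc k) * (q ^ mu * (q ^ Suc k - 1)) = - u k * (q ^ r - q ^ (mu + k))" for k
  proof -
    have "u (Suc k) * (q ^ mu * (q ^ Suc k - 1))
        = (inv_factor q n (Suc (mu + k)) mu * (q ^ mu * (q ^ Suc k - 1))) * sur_factor q n (Suc (mu + k)) r"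
      by (simp add: u_def)
    also have "\<dots> = - u k * (q ^ r - q ^ (mu + k))"
      using inv_factor_Suc[OF assms(1), of mu "mu + k" n] sur_factor_Suc[of n "mu + k" q r] assms
      by (simp add: u_def)
    finally show ?thesis .
  qed
  consider "r < mu" | "r = mu" | "mu < r" by linarith
  then have "\<bar>of_bool (r = mu) - (\<Sum>k<K. u k)\<bar> \<le> \<bar>u K\<bar>"
  proof cases
    case 1
    then have "u k = 0" for k using sur_factor_eq_0[of n r "mu + k" q] assms by (simp add: u_def)
    then show ?thesis using 1 by simp
  next
    case 2
    have u0: "u 0 = 1" using inv_factor_times_sur_factor_diag assms 2 by (simp add: u_def)
    have us: "u (Suc k) = 0" for k
      using sur_factor_eq_0[of n r "mu + Suc k" q] assms 2 by (simp add: u_def)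
    show ?thesis
    proof (cases K)
      case 0 then show ?thesis using 2 u0 by simp
    next
      case (Suc K')
      then have "(\<Sum>k<K. u k) = 1" by (simp only: sum.lessThan_Suc_shift u0 us) simp
      then show ?thesis using 2 by simp
    qed
  next
    case 3
    then obtain R where r: "r = mu + R" "R > 0" by (metis less_imp_add_positive)
    have qm: "q ^ mu > 0" and qR: "q ^ R > 1" using assms r one_less_power by auto
    have rec': "u (Suc k) * (q ^ Suc k - 1) = - u k * (q ^ R - q ^ k)" for k
    proof -
      have "q ^ mu * (u (Suc k) * (q ^ Suc k - 1)) = q ^ mu * (- u k * (q ^ R - q ^ k))"
        using rec[of k] by (simp add: r power_add algebra_simps)
      then show ?thesis by (rule mult_left_cancel[THEN iffD1, rotated]) (use assms in simp)
    qed
    have part: "(q ^ R - 1) * (\<Sum>k<K. u k) = - u K * (q ^ K - 1)" for K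
    proof (induction K)
      case (Suc K)
      have "(q ^ R - 1) * (\<Sum>k<Suc K. u k) = - u K * (q ^ K - 1) + (q ^ R - 1) * u K"
        using Suc by (simp add: algebra_simps)
      also have "\<dots> = - (- u K * (q ^ R - q ^ K))" by (simp add: algebra_simps)
      also have "\<dots> = - u (Suc K) * (q ^ Suc K - 1)" using rec'[of K] by simp
      finally show ?case .
    qed simp
    show ?thesis
    \<comment> \<open>For K <= R the telescoped identity gives the bound, because q^K - 1 <= q^R -
      1. For K > R the term \<open>u K\<close> vanishes, and the identity makes the whole sum
      vanish.\<close>
    proof (cases "K \<le> R")
      case True
      then have "1 \<le> q ^ K" "q ^ K \<le> q ^ R" using assms by (auto intro: power_increasing)
      then have "\<bar>u K\<bar> * (q ^ K - 1) \<le> \<bar>u K\<bar> * (q ^ R - 1)"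
        by (intro mult_left_mono) auto
      moreover have "\<bar>(q ^ R - 1) * (\<Sum>k<K. u k)\<bar> = \<bar>u K\<bar> * (q ^ K - 1)"
        unfolding part using \<open>1 \<le> q ^ K\<close> by (simp add: abs_mult)
      ultimately have "(q ^ R - 1) * \<bar>\<Sum>k<K. u k\<bar> \<le> (q ^ R - 1) * \<bar>u K\<bar>"
        using qR by (simp add: abs_mult mult.commute)
      then show ?thesis using qR 3 by simp
    next
      case False
      then have "u K = 0" using sur_factor_eq_0[of n r "mu + K" q] assms r by (simp add: u_def)
      then show ?thesis using part[of K] qR 3 by simp
    qed
  qed
  then show ?thesis using shift uK by simp
qed

section \<open>Gaussian binomials: the q-binomial theorem and Cauchy's identity\<close>

lemma qpochhammer_nz:
  assumes "\<And>j. 0 < j \<Longrightarrow> q ^ j \<noteq> 1"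
  shows "qpochhammer q q k \<noteq> 0"
  unfolding qpochhammer_def using assms[of "Suc _"] by (simp add: prod_zero_iff)

lemma qbinomial_0 [simp]: "(\<And>j. 0 < j \<Longrightarrow> q ^ j \<noteq> 1) \<Longrightarrow> qbinomial n 0 q = 1"
  using qpochhammer_nz[of q n] by (simp add: qbinomial_def)

text \<open>The q-Pascal rule. It comes from splitting 1 - q^(n+1) into (1 - q^(k+1)) + q^(k+1) (1 -
  q^(n-k)); each part cancels the last factor of one Pochhammer symbol in the denominator.\<close>

lemma qbinomial_Suc_Suc:
  assumes q: "\<And>j. 0 < j \<Longrightarrow> q ^ j \<noteq> (1::real)"
  shows "qbinomial (Suc n) (Suc k) q = qbinomial n k q + q ^ Suc k * qbinomial n (Suc k) q"
proof -
  define P where "P = qpochhammer q q"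
  have P: "P j \<noteq> 0" for j using qpochhammer_nz[of q j] q by (simp add: P_def)
  have PS: "P (Suc j) = P j * (1 - q ^ Suc j)" for j by (simp add: P_def qpochhammer_Suc)
  have nz: "1 - q ^ Suc j \<noteq> 0" for j using q[of "Suc j"] by (metis eq_iff_diff_eq_0 zero_less_Suc)
  consider "n < k" | "n = k" | "k < n" by linarith
  then show ?thesis
  proof cases
    case 1 then show ?thesis by (simp add: qbinomial_def)
  next
    case 2 then show ?thesis using P[of "Suc k"] P[of k] P[of 0]
      by (simp add: qbinomial_def P_def)
  next
    case 3
    then obtain m where n: "n = Suc (k + m)" using less_imp_Suc_add by blast
    have "qbinomial (Suc n) (Suc k) q = P n * (1 - q ^ Suc n) / (P (Suc k) * P (Suc m))"
      by (simp add: qbinomial_def n P_def[symmetric] PS)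
    also have "1 - q ^ Suc n = (1 - q ^ Suc k) + q ^ Suc k * (1 - q ^ Suc m)"
      by (simp add: n power_add algebra_simps)
    also have "P n * \<dots> / (P (Suc k) * P (Suc m))
        = P n * (1 - q ^ Suc k) / (P (Suc k) * P (Suc m)) + q ^ Suc k * (P n * (1 - q ^ Suc m) / (P (Suc k) * P (Suc m)))"
      by (simp only: distrib_left add_divide_distrib) (simp only: mult.left_commute times_divide_eq_right)
    also have "P n * (1 - q ^ Suc k) / (P (Suc k) * P (Suc m)) = P n / (P k * P (Suc m))"
      using nz[of k] by (simp add: PS[of k])
    also have "P n * (1 - q ^ Suc m) / (P (Suc k) * P (Suc m)) = P n / (P (Suc k) * P m)"
      using nz[of m] by (simp add: PS[of m])
    also have "P n / (P k * P (Suc m)) = qbinomial n k q"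
      by (simp add: qbinomial_def n P_def[symmetric] Suc_diff_le)
    also have "P n / (P (Suc k) * P m) = qbinomial n (Suc k) q"
      by (simp add: qbinomial_def n P_def[symmetric])
    finally show ?thesis .
  qed
qed

lemma qbinomial_eq_0: "n < k \<Longrightarrow> qbinomial n k q = 0"
  by (simp add: qbinomial_def)

text \<open>The q-Pascal rule splits the sum for n + 1 into two copies of the sum for n at z q, with
  factors 1 and -z; so the induction runs over all z and peels off the factor 1 - z.\<close>

theorem qbinomial_theorem:
  assumes q: "\<And>j. 0 < j \<Longrightarrow> q ^ j \<noteq> (1::real)"
  shows "(\<Sum>k\<le>n. (-1) ^ k * q ^ (k choose 2) * z ^ k * qbinomial n k q) = qpochhammer z q n"
proof (induction n arbitrary: z)
  case (Suc n)
  define c where "c k = (-1) ^ k * q ^ (k choose 2) * z ^ k" for k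
  have cS: "c (Suc k) = - z * (q ^ k * c k)" for k
    by (simp add: c_def choose_two_Suc power_add algebra_simps)
  have IH: "(\<Sum>k\<le>n. q ^ k * c k * qbinomial n k q) = qpochhammer (z * q) q n"
    unfolding Suc.IH[of "z * q", symmetric] c_def
    by (intro sum.cong) (simp_all add: power_mult_distrib algebra_simps)
  have "(\<Sum>k\<le>Suc n. c k * qbinomial (Suc n) k q)
      = 1 + (\<Sum>k\<le>n. c (Suc k) * (qbinomial n k q + q ^ Suc k * qbinomial n (Suc k) q))"
    using q by (subst sum.atMost_Suc_shift) (simp add: qbinomial_Suc_Suc c_def[of 0] numeral_2_eq_2)
  also have "\<dots> = (1 + (\<Sum>k\<le>n. q ^ Suc k * c (Suc k) * qbinomial n (Suc k) q))
                    - z * (\<Sum>k\<le>n. q ^ k * c k * qbinomial n k q)"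
  proof -
    have "c (Suc k) * (qbinomial n k q + q ^ Suc k * qbinomial n (Suc k) q)
        = q ^ Suc k * c (Suc k) * qbinomial n (Suc k) q - z * (q ^ k * c k * qbinomial n k q)" for k
      unfolding cS by (simp add: algebra_simps)
    then show ?thesis by (simp add: sum_subtractf sum_distrib_left)
  qed
  also have "1 + (\<Sum>k\<le>n. q ^ Suc k * c (Suc k) * qbinomial n (Suc k) q)
      = (\<Sum>k\<le>Suc n. q ^ k * c k * qbinomial n k q)"
    using q by (subst sum.atMost_Suc_shift) (simp add: c_def[of 0] numeral_2_eq_2)
  also have "\<dots> = (\<Sum>k\<le>n. q ^ k * c k * qbinomial n k q)"
    by (simp add: qbinomial_eq_0)
  also have "\<dots> - z * (\<Sum>k\<le>n. q ^ k * c k * qbinomial n k q) = (1 - z) * qpochhammer (z * q) q n"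
    unfolding IH by (simp add: algebra_simps)
  also have "\<dots> = qpochhammer z q (Suc n)"
    using qpochhammer_add[of z q 1 n] by (simp add: qpochhammer_Suc[of _ _ 0])
  finally show ?case by (simp add: c_def)
qed (simp add: qbinomial_def numeral_2_eq_2)

text \<open>For a prime power q and x = q^r this counts linear maps from an n-dimensional to an
  r-dimensional space by rank, the product being the number of injective maps from dimension k. The
  proof by the q-Pascal rule covers every real x.\<close>

theorem cauchy_binomial:
  assumes q: "\<And>j. 0 < j \<Longrightarrow> q ^ j \<noteq> (1::real)"
  shows "(\<Sum>k\<le>n. qbinomial n k q * (\<Prod>j<k. x - q ^ j)) = x ^ n"
proof (induction n)
  case (Suc n)
  define c where "c k = (\<Prod>j<k. x - q ^ j)" for k
  have cS: "c (Suc k) = c k * (x - q ^ k)" for k by (simp add: c_def)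
  have "(\<Sum>k\<le>Suc n. qbinomial (Suc n) k q * c k)
      = 1 + (\<Sum>k\<le>n. (qbinomial n k q + q ^ Suc k * qbinomial n (Suc k) q) * c (Suc k))"
    using q by (subst sum.atMost_Suc_shift) (simp add: qbinomial_Suc_Suc c_def[of 0])
  also have "\<dots> = (1 + (\<Sum>k\<le>n. q ^ Suc k * qbinomial n (Suc k) q * c (Suc k)))
                    + (\<Sum>k\<le>n. qbinomial n k q * c (Suc k))"
    by (simp add: distrib_right sum.distrib)
  also have "1 + (\<Sum>k\<le>n. q ^ Suc k * qbinomial n (Suc k) q * c (Suc k))
      = (\<Sum>k\<le>Suc n. q ^ k * qbinomial n k q * c k)"
    using q by (subst sum.atMost_Suc_shift) (simp add: c_def[of 0])
  also have "\<dots> = (\<Sum>k\<le>n. q ^ k * qbinomial n k q * c k)"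
    by (simp add: qbinomial_eq_0)
  also have "\<dots> + (\<Sum>k\<le>n. qbinomial n k q * c (Suc k)) = (\<Sum>k\<le>n. x * (qbinomial n k q * c k))"
    unfolding sum.distrib[symmetric] by (intro sum.cong) (simp_all add: cS algebra_simps)
  also have "\<dots> = x ^ Suc n"
    using Suc by (simp add: c_def sum_distrib_left[symmetric])
  finally show ?case by (simp add: c_def)
qed (simp add: qbinomial_def)

section \<open>Euler's series for (z;q)_inf, the limit of the q-binomial theorem as n grows\<close>

definition euler_coeff :: "real \<Rightarrow> nat \<Rightarrow> real" where
  "euler_coeff q k = (- 1) ^ k * q ^ (k choose 2) / qpochhammer q q k"

lemma euler_coeff_Suc:
  assumes "0 \<le> q" "q < 1"
  shows "euler_coeff q (Suc k) * (1 - q ^ Suc k) = - (q ^ k * euler_coeff q k)"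
proof -
  have "q * q ^ k < 1" using assms power_Suc_less_one[of q k] by (cases "q = 0") auto
  moreover have "qpochhammer q q k \<noteq> 0" using qpochhammer_pos[of q q k] assms by simp
  ultimately show ?thesis
    by (simp add: euler_coeff_def qpochhammer_Suc choose_two_Suc power_add field_simps)
qed

lemma summable_euler:
  assumes "0 \<le> q" "q < 1"
  shows "summable (\<lambda>k. euler_coeff q k * z ^ k)"
proof -
  have "(\<lambda>k. q ^ k * \<bar>z\<bar> / (1 - q ^ Suc k)) \<longlonglongrightarrow> 0 * \<bar>z\<bar> / (1 - 0)"
    using assms by (intro tendsto_intros LIMSEQ_realpow_zero LIMSEQ_Suc) auto
  then have "eventually (\<lambda>k. q ^ k * \<bar>z\<bar> / (1 - q ^ Suc k) < 1 / 2) sequentially"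
    by (intro order_tendstoD(2)[where y = 0]) auto
  then obtain N where N: "q ^ k * \<bar>z\<bar> / (1 - q ^ Suc k) < 1 / 2" if "k \<ge> N" for k
    by (auto simp: eventually_sequentially)
  show ?thesis
  proof (rule summable_ratio_test[of "1 / 2" N])
    fix k assume "N \<le> k"
    have pos: "1 - q ^ Suc k > 0"
      using assms power_Suc_less_one[of q k] by (cases "q = 0") auto
    have "euler_coeff q (Suc k) = - (q ^ k * euler_coeff q k) / (1 - q ^ Suc k)"
      using euler_coeff_Suc[OF assms, of k] pos by (metis less_irrefl nonzero_eq_divide_eq)
    then have "norm (euler_coeff q (Suc k) * z ^ Suc k)
        = q ^ k * \<bar>z\<bar> / (1 - q ^ Suc k) * norm (euler_coeff q k * z ^ k)"
      using pos assms by (simp add: abs_mult abs_divide power_abs)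
    also have "\<dots> \<le> 1 / 2 * norm (euler_coeff q k * z ^ k)"
      using N[OF \<open>N \<le> k\<close>] by (intro mult_right_mono) auto
    finally show "norm (euler_coeff q (Suc k) * z ^ Suc k) \<le> 1 / 2 * norm (euler_coeff q k * z ^ k)" .
  qed simp
qed

text \<open>
  Euler's series \<open>f\<close> satisfies \<open>f z = (1 - z) * f (q * z)\<close>; iterate and let \<open>q ^ n * z\<close>
  tend to 0.
\<close>

theorem
  assumes q: "0 \<le> q" "q < 1"
  shows euler_sums: "(\<lambda>k. euler_coeff q k * z ^ k) sums qpochhammer_inf z q"
    and qpochhammer_tendsto: "qpochhammer z q \<longlonglongrightarrow> qpochhammer_inf z q"
proof -
  define f where "f z = (\<Sum>k. euler_coeff q k * z ^ k)" for z
  have sm: "(\<lambda>k. euler_coeff q k * z ^ k) sums f z" for z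
    unfolding f_def using summable_euler[OF q] by (rule summable_sums)
  have fe: "f z = (1 - z) * f (z * q)" for z
  proof -
    have "(\<lambda>k. euler_coeff q (Suc k) * z ^ Suc k * (1 - q ^ Suc k)) sums (f z - f (z * q))"
    proof -
      define g where "g k = euler_coeff q k * z ^ k - euler_coeff q k * (z * q) ^ k" for k
      have "g sums (f z - f (z * q))" unfolding g_def by (intro sums_diff sm)
      then have "(\<lambda>k. g (Suc k)) sums (f z - f (z * q))"
        by (subst sums_Suc_iff) (simp add: g_def)
      moreover have "g (Suc k) = euler_coeff q (Suc k) * z ^ Suc k * (1 - q ^ Suc k)" for k
        unfolding g_def power_mult_distrib by (simp add: right_diff_distrib)
      ultimately show ?thesis by simp
    qed
    moreover have "(\<lambda>k. euler_coeff q (Suc k) * z ^ Suc k * (1 - q ^ Suc k)) sums (- z * f (z * q))"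
    proof -
      have "(\<lambda>k. - z * (euler_coeff q k * (z * q) ^ k)) sums (- z * f (z * q))"
        by (intro sums_mult sm)
      moreover have "- z * (euler_coeff q k * (z * q) ^ k) = euler_coeff q (Suc k) * z ^ Suc k * (1 - q ^ Suc k)" for k
      proof -
        have "euler_coeff q (Suc k) * z ^ Suc k * (1 - q ^ Suc k) = z ^ Suc k * (euler_coeff q (Suc k) * (1 - q ^ Suc k))"
          by (simp add: algebra_simps)
        then show ?thesis unfolding euler_coeff_Suc[OF q] by (simp add: power_mult_distrib algebra_simps)
      qed
      ultimately show ?thesis by simp
    qed
    ultimately have "f z - f (z * q) = - z * f (z * q)" by (rule sums_unique2)
    then show ?thesis by (simp add: algebra_simps)
  qed
  have iter: "f z = qpochhammer z q n * f (z * q ^ n)" for n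
  proof (induction n)
    case (Suc n)
    then show ?case using fe[of "z * q ^ n"] by (simp add: qpochhammer_Suc algebra_simps)
  qed simp
  have "isCont f 0"
    unfolding f_def using summable_euler[OF q, of 1] by (intro isCont_powser[of _ 1]) auto
  moreover have "(\<lambda>n. z * q ^ n) \<longlonglongrightarrow> z * 0"
    using q by (intro tendsto_intros LIMSEQ_realpow_zero) auto
  ultimately have lim: "(\<lambda>n. f (z * q ^ n)) \<longlonglongrightarrow> f 0"
    using isCont_tendsto_compose by fastforce
  have f0: "f 0 = 1"
    unfolding f_def using powser_zero[of "euler_coeff q"] by (simp add: euler_coeff_def numeral_2_eq_2)
  have "eventually (\<lambda>n. f (z * q ^ n) \<noteq> 0) sequentially"
    using lim f0 by (intro tendsto_imp_eventually_ne) auto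
  then have "eventually (\<lambda>n. f z / f (z * q ^ n) = qpochhammer z q n) sequentially"
  proof eventually_elim
    case (elim n)
    then show ?case using iter[of n] by simp
  qed
  moreover have "(\<lambda>n. f z / f (z * q ^ n)) \<longlonglongrightarrow> f z / f 0"
    using lim f0 by (intro tendsto_intros) auto
  ultimately have lim: "qpochhammer z q \<longlonglongrightarrow> f z"
    using f0 Lim_transform_eventually by fastforce
  then have "f z = qpochhammer_inf z q" unfolding qpochhammer_inf_def by (simp add: limI)
  with lim sm[of z] show "(\<lambda>k. euler_coeff q k * z ^ k) sums qpochhammer_inf z q"
    and "qpochhammer z q \<longlonglongrightarrow> qpochhammer_inf z q" by simp_all
qed

lemma qpochhammer_inf_split:
  assumes q: "0 \<le> q" "q < 1"
  shows "qpochhammer_inf z q = qpochhammer z q n * qpochhammer_inf (z * q ^ n) q"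
proof (rule LIMSEQ_unique)
  show "(\<lambda>m. qpochhammer z q (n + m)) \<longlonglongrightarrow> qpochhammer_inf z q"
    using qpochhammer_tendsto[OF q, of z, THEN LIMSEQ_ignore_initial_segment, of n]
    by (simp add: add.commute)
  show "(\<lambda>m. qpochhammer z q (n + m)) \<longlonglongrightarrow> qpochhammer z q n * qpochhammer_inf (z * q ^ n) q"
    unfolding qpochhammer_add by (intro tendsto_intros qpochhammer_tendsto q)
qed

section \<open>Inversion over all levels\<close>

definition sur_product :: "real \<Rightarrow> nat \<Rightarrow> (nat \<Rightarrow> nat) \<Rightarrow> (nat \<Rightarrow> nat) \<Rightarrow> real" where
  "sur_product q l n r = (\<Prod>i<l. sur_factor q (n (Suc i)) (n i) (r i))"

definition inv_product :: "real \<Rightarrow> nat \<Rightarrow> (nat \<Rightarrow> nat) \<Rightarrow> (nat \<Rightarrow> nat) \<Rightarrow> real" where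
  "inv_product q l n mu = (\<Prod>i<l. inv_factor q (n (Suc i)) (n i) (mu i))"

text \<open>
  The sequences with \<open>b > n\<^sub>0 \<ge> mu\<^sub>0 \<ge> n\<^sub>1 \<ge> mu\<^sub>1 \<ge> \<dots> \<ge> n\<^bsub>l-1\<^esub> \<ge> mu\<^bsub>l-1\<^esub>\<close>, continued by zeros.
\<close>

primrec interlacing :: "nat \<Rightarrow> (nat \<Rightarrow> nat) \<Rightarrow> nat \<Rightarrow> (nat \<Rightarrow> nat) set" where
  "interlacing 0 mu b = {\<lambda>_. 0}"
| "interlacing (Suc l) mu b =
     (\<lambda>(n, k). case_nat k n) ` (interlacing l (mu \<circ> Suc) (Suc (mu 0)) \<times> {mu 0..<b})"

lemma inj_case_nat: "inj_on (\<lambda>(n, k). case_nat k n) A"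
proof (rule inj_onI, clarsimp)
  fix n k n' k' assume *: "case_nat k n = case_nat k' (n' :: nat \<Rightarrow> 'a)"
  show "n = n' \<and> k = k'"
    using fun_cong[OF *, of 0] fun_cong[OF *, of "Suc _"] by auto
qed

lemma sum_interlacing_Suc:
  "sum f (interlacing (Suc l) mu b) =
     (\<Sum>n\<in>interlacing l (mu \<circ> Suc) (Suc (mu 0)). \<Sum>k=mu 0..<b. f (case_nat k n))"
  by (subst interlacing.simps, subst sum.reindex[OF inj_case_nat])
     (simp add: sum.cartesian_product case_prod_unfold)

lemma sur_product_Suc:
  "sur_product q (Suc l) (case_nat k n) r = sur_factor q (n 0) k (r 0) * sur_product q l n (r \<circ> Suc)"
  by (simp add: sur_product_def prod.lessThan_Suc_shift del: prod.lessThan_Suc)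

lemma inv_product_Suc:
  "inv_product q (Suc l) (case_nat k n) mu = inv_factor q (n 0) k (mu 0) * inv_product q l n (mu \<circ> Suc)"
  by (simp add: inv_product_def prod.lessThan_Suc_shift del: prod.lessThan_Suc)

lemma interlacing_less: "n \<in> interlacing l mu b \<Longrightarrow> 0 < b \<Longrightarrow> n 0 < b"
  by (cases l) auto

lemma interlacing_antimono:
  "n \<in> interlacing l mu b \<Longrightarrow> antimono n \<and> (\<forall>i\<ge>l. n i = 0)"
proof (induction l arbitrary: n mu b)
  case 0 then show ?case by (simp add: antimono_def)
next
  case (Suc l)
  then obtain n' k where n: "n = case_nat k n'" "n' \<in> interlacing l (mu \<circ> Suc) (Suc (mu 0))" "mu 0 \<le> k"
    by auto
  have "antimono n'" and n': "\<forall>i\<ge>l. n' i = 0" using Suc.IH[OF n(2)] by auto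
  moreover have "n' 0 \<le> k" using interlacing_less[OF n(2)] n(3) by simp
  ultimately have "antimono n"
    unfolding antimono_iff_le_Suc by (auto simp: n(1) split: nat.split)
  then show ?case using n' by (auto simp: n(1) split: nat.split)
qed

lemma antimono_Suc: "antimono f \<Longrightarrow> antimono (f \<circ> Suc)" for f :: "nat \<Rightarrow> nat"
  by (auto simp: antimono_def)

text \<open>Supplies the condition \<open>n \<le> r\<close> that the one-level statements need: at
  each level, either the product over the deeper levels vanishes or that condition holds.\<close>

lemma sur_product_nonzeroD:
  assumes "n \<in> interlacing l mu b" "antimono r" "sur_product q l n r \<noteq> 0"
  shows "n 0 \<le> r 0"
  using assms
proof (induction l arbitrary: n mu b r)
  case (Suc l)
  then obtain n' k where n: "n = case_nat k n'" "n' \<in> interlacing l (mu \<circ> Suc) (Suc (mu 0))" by auto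
  have nz: "sur_factor q (n' 0) k (r 0) \<noteq> 0" "sur_product q l n' (r \<circ> Suc) \<noteq> 0"
    using Suc.prems(3) by (simp_all add: n(1) sur_product_Suc)
  have "n' 0 \<le> (r \<circ> Suc) 0"
    using Suc.IH[OF n(2) antimono_Suc[OF Suc.prems(2)] nz(2)] .
  also have "\<dots> \<le> r 0" using Suc.prems(2) by (simp add: antimono_def)
  finally show ?case using nz(1) sur_factor_eq_0[of "n' 0" "r 0" k q] by (auto simp: n(1) not_less[symmetric])
qed auto

text \<open>A single factor can be negative when its first index exceeds the rank, but then the
  product of the deeper factors is zero.\<close>

lemma sur_product_nonneg:
  assumes "1 < q" "n \<in> interlacing l mu b" "antimono r"
  shows "0 \<le> sur_product q l n r"
  using assms(2,3)
proof (induction l arbitrary: n mu b r)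
  case (Suc l)
  then obtain n' k where n: "n = case_nat k n'" "n' \<in> interlacing l (mu \<circ> Suc) (Suc (mu 0))" by auto
  have anti: "antimono (r \<circ> Suc)" using Suc.prems(2) by (rule antimono_Suc)
  have IH: "0 \<le> sur_product q l n' (r \<circ> Suc)" using Suc.IH[OF n(2) anti] .
  show ?case
  proof (cases "sur_product q l n' (r \<circ> Suc) = 0")
    case False
    have "n' 0 \<le> (r \<circ> Suc) 0" using sur_product_nonzeroD[OF n(2) anti False] .
    also have "\<dots> \<le> r 0" using Suc.prems(2) by (simp add: antimono_def)
    finally show ?thesis using IH sur_factor_nonneg[OF assms(1)] by (simp add: n(1) sur_product_Suc)
  qed (simp add: n(1) sur_product_Suc)
qed (simp add: sur_product_def)

lemma of_bool_all_Suc: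
  "(of_bool (\<forall>i<Suc l. r i = mu i) :: real)
     = of_bool (r 0 = mu 0) * of_bool (\<forall>i<l. (r \<circ> Suc) i = (mu \<circ> Suc) i)"
  unfolding All_less_Suc2 by auto

text \<open>The Bonferroni bound at the top level, with the deeper entries \<open>n\<close> fixed,
  multiplied by the nonnegative quantity |I| S.\<close>

lemma inversion_step:
  assumes "1 < q" "antimono mu" "antimono r" "mu 0 \<le> b"
    and "n \<in> interlacing l (mu \<circ> Suc) (Suc (mu 0))"
  shows "\<bar>inv_product q l n (mu \<circ> Suc) * sur_product q l n (r \<circ> Suc) * of_bool (r 0 = mu 0)
        - (\<Sum>k=mu 0..<b. inv_product q (Suc l) (case_nat k n) mu * sur_product q (Suc l) (case_nat k n) r)\<bar>
      \<le> \<bar>inv_product q (Suc l) (case_nat b n) mu\<bar> * sur_product q (Suc l) (case_nat b n) r"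
proof -
  define I S where "I = inv_product q l n (mu \<circ> Suc)" and "S = sur_product q l n (r \<circ> Suc)"
  define J where "J k = inv_factor q (n 0) k (mu 0)" for k
  define T where "T k = sur_factor q (n 0) k (r 0)" for k
  have S: "0 \<le> S" unfolding S_def
    by (rule sur_product_nonneg[OF assms(1,5) antimono_Suc[OF assms(3)]])
  have "\<bar>I * S * of_bool (r 0 = mu 0) - (\<Sum>k=mu 0..<b. (J k * I) * (T k * S))\<bar>
      = (\<bar>I\<bar> * S) * \<bar>of_bool (r 0 = mu 0) - (\<Sum>k=mu 0..<b. J k * T k)\<bar>"
  proof -
    have "I * S * of_bool (r 0 = mu 0) - (\<Sum>k=mu 0..<b. (J k * I) * (T k * S))
      = I * S * (of_bool (r 0 = mu 0) - (\<Sum>k=mu 0..<b. J k * T k))"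
      by (simp add: right_diff_distrib sum_distrib_left mult_ac)
    then show ?thesis using S by (simp add: abs_mult)
  qed
  also have "\<dots> \<le> (\<bar>I\<bar> * S) * (\<bar>J b\<bar> * T b)"
  proof (cases "S = 0")
    case False
    have "n 0 \<le> r 1"
      using sur_product_nonzeroD[OF assms(5) antimono_Suc[OF assms(3)]] False by (simp add: S_def)
    also have "\<dots> \<le> r 0" using assms(3) by (simp add: antimono_def)
    finally show ?thesis
      using one_level_inversion[OF assms(1) _ _ assms(4), of "n 0" "r 0"] S
        interlacing_less[OF assms(5)]
      unfolding J_def T_def by (intro mult_left_mono) auto
  qed simp
  also have "\<dots> = \<bar>J b * I\<bar> * (T b * S)" by (simp add: abs_mult)
  finally show ?thesis
    by (simp only: inv_product_Suc sur_product_Suc I_def S_def J_def T_def)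
qed

text \<open>For b > r_0 the error term of \<open>inversion_step\<close> contains a vanishing factor,
  so the top level produces exactly the indicator of r_0 = mu_0. Where this is nonzero, r_1 <= r_0 =
  mu_0, so the bound \<open>Suc (mu 0)\<close> built into \<open>interlacing\<close> suffices for
  the induction.\<close>

lemma inversion_exact:
  assumes "1 < q" "antimono mu" "antimono r" "mu 0 \<le> b" "r 0 < b"
  shows "(\<Sum>n\<in>interlacing l mu b. inv_product q l n mu * sur_product q l n r)
           = of_bool (\<forall>i<l. r i = mu i)"
  using assms(2-)
proof (induction l arbitrary: mu r b)
  case 0 then show ?case by (simp add: inv_product_def sur_product_def)
next
  case (Suc l)
  let ?IS = "\<lambda>n. inv_product q l n (mu \<circ> Suc) * sur_product q l n (r \<circ> Suc)"
  let ?J = "interlacing l (mu \<circ> Suc) (Suc (mu 0))"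
  have step: "(\<Sum>k=mu 0..<b. inv_product q (Suc l) (case_nat k n) mu * sur_product q (Suc l) (case_nat k n) r)
      = ?IS n * of_bool (r 0 = mu 0)" if n: "n \<in> ?J" for n
  proof -
    have "sur_product q (Suc l) (case_nat b n) r = 0"
    proof (cases "sur_product q l n (r \<circ> Suc) = 0")
      case False
      have "n 0 \<le> r 1"
        using sur_product_nonzeroD[OF n antimono_Suc[OF Suc.prems(2)] False] by simp
      also have "\<dots> \<le> r 0" using Suc.prems(2) by (simp add: antimono_def)
      finally show ?thesis using sur_factor_eq_0[of "n 0" "r 0" b q] Suc.prems(4) by (simp add: sur_product_Suc)
    qed (simp add: sur_product_Suc)
    then show ?thesis
      using inversion_step[OF assms(1) Suc.prems(1-3) n] by simp
  qed
  have "(\<Sum>n\<in>interlacing (Suc l) mu b. inv_product q (Suc l) n mu * sur_product q (Suc l) n r)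
      = (\<Sum>n\<in>?J. ?IS n) * of_bool (r 0 = mu 0)"
    unfolding sum_interlacing_Suc sum_distrib_right by (intro sum.cong step) auto
  also have "\<dots> = of_bool (\<forall>i<Suc l. r i = mu i)"
  proof (cases "r 0 = mu 0")
    case True
    have "(mu \<circ> Suc) 0 \<le> Suc (mu 0)" "(r \<circ> Suc) 0 < Suc (mu 0)"
      using Suc.prems(1,2) True antimonoD[of mu 0 1] antimonoD[of r 0 1] by auto
    then have "(\<Sum>n\<in>?J. ?IS n) = of_bool (\<forall>i<l. (r \<circ> Suc) i = (mu \<circ> Suc) i)"
      by (intro Suc.IH antimono_Suc Suc.prems)
    then show ?thesis by (simp only: of_bool_all_Suc mult.commute)
  qed auto
  finally show ?case .
qed

text \<open>With no relation between b and r_0, only the top level leaves an error; the deeper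
  levels are still inverted exactly. The error is a nonnegative combination of surjection numbers,
  so its average can be computed.\<close>

lemma inversion_truncated:
  assumes "1 < q" "antimono mu" "antimono r" "mu 0 \<le> b"
  shows "\<bar>of_bool (\<forall>i<Suc l. r i = mu i)
          - (\<Sum>n\<in>interlacing (Suc l) mu b. inv_product q (Suc l) n mu * sur_product q (Suc l) n r)\<bar>
      \<le> (\<Sum>n\<in>interlacing l (mu \<circ> Suc) (Suc (mu 0)).
            \<bar>inv_product q (Suc l) (case_nat b n) mu\<bar> * sur_product q (Suc l) (case_nat b n) r)"
proof -
  let ?IS = "\<lambda>n. inv_product q l n (mu \<circ> Suc) * sur_product q l n (r \<circ> Suc)"
  let ?J = "interlacing l (mu \<circ> Suc) (Suc (mu 0))"
  have "of_bool (\<forall>i<Suc l. r i = mu i) = (\<Sum>n\<in>?J. ?IS n * of_bool (r 0 = mu 0))"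
  proof (cases "r 0 = mu 0")
    case True
    have "(mu \<circ> Suc) 0 \<le> Suc (mu 0)" "(r \<circ> Suc) 0 < Suc (mu 0)"
      using assms True antimonoD[of mu 0 1] antimonoD[of r 0 1] by auto
    then have "(\<Sum>n\<in>?J. ?IS n) = of_bool (\<forall>i<l. (r \<circ> Suc) i = (mu \<circ> Suc) i)"
      by (intro inversion_exact antimono_Suc assms)
    then show ?thesis by (simp only: of_bool_all_Suc mult.commute sum_distrib_left[symmetric])
  qed auto
  then have "of_bool (\<forall>i<Suc l. r i = mu i)
      - (\<Sum>n\<in>interlacing (Suc l) mu b. inv_product q (Suc l) n mu * sur_product q (Suc l) n r)
    = (\<Sum>n\<in>?J. ?IS n * of_bool (r 0 = mu 0)
       - (\<Sum>k=mu 0..<b. inv_product q (Suc l) (case_nat k n) mu * sur_product q (Suc l) (case_nat k n) r))"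
    by (simp only: sum_interlacing_Suc sum_subtractf)
  then show ?thesis
    using inversion_step[OF assms] by (auto intro!: order_trans[OF sum_abs] sum_mono)
qed

section \<open>Summing the inversion coefficients against the limiting moments\<close>

lemma inv_factor_weighted:
  "inv_factor q n (mu + j) mu * (1 / q) ^ (u * (mu + j)) =
     (1 / q) ^ (mu\<^sup>2 + u * mu) / qpochhammer (1 / q) (1 / q) (mu - n) *
     (euler_coeff (1 / q) j * ((1 / q) ^ (mu + 1 + u)) ^ j)"
proof -
  have "(1 / q) ^ ((j choose 2) + (mu + 1) * j + mu\<^sup>2) * (1 / q) ^ (u * (mu + j))
      = (1 / q) ^ (mu\<^sup>2 + u * mu) * ((1 / q) ^ (j choose 2) * ((1 / q) ^ (mu + 1 + u)) ^ j)"
    unfolding power_mult[symmetric] power_add[symmetric] by (simp add: algebra_simps)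
  moreover have "c * a / (x * y) * b = c * (a * b) / (x * y)" for a b c x y :: real by simp
  ultimately show ?thesis by (simp add: inv_factor_def euler_coeff_def mult_ac)
qed

text \<open>In the form of \<open>inv_factor_weighted\<close> the terms are those of Euler's series
  at z = q^(-(mu + 1 + u)).\<close>

lemma inv_factor_sums:
  assumes "1 < q"
  shows "(\<lambda>j. inv_factor q n (mu + j) mu * (1 / q) ^ (u * (mu + j))) sums
     ((1 / q) ^ (mu\<^sup>2 + u * mu) / qpochhammer (1 / q) (1 / q) (mu - n) *
      qpochhammer_inf ((1 / q) ^ (mu + 1 + u)) (1 / q))"
  unfolding inv_factor_weighted using assms by (intro sums_mult euler_sums) auto

text \<open>The finite counterpart for inner levels: the extra denominator, which stems from
  \<open>inv_factor\<close> one level up with M as its rank, completes the Euler coefficients to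
  Gaussian binomials of length M - mu.\<close>

lemma inv_factor_sum:
  assumes "1 < q" "mu \<le> M"
  shows "(\<Sum>k=mu..<Suc M. inv_factor q n k mu * (1 / q) ^ (u * k) / qpochhammer (1 / q) (1 / q) (M - k))
     = (1 / q) ^ (mu\<^sup>2 + u * mu) / qpochhammer (1 / q) (1 / q) (mu - n) *
       (qpochhammer ((1 / q) ^ (mu + 1 + u)) (1 / q) (M - mu) / qpochhammer (1 / q) (1 / q) (M - mu))"
proof -
  obtain L where M: "M = mu + L" using assms le_Suc_ex by blast
  define P where "P = qpochhammer (1 / q) (1 / q)"
  define z where "z = (1 / q) ^ (mu + 1 + u)"
  define C where "C = (1 / q) ^ (mu\<^sup>2 + u * mu) / P (mu - n)"
  have P: "P j > 0" for j using qpochhammer_qq_pos[OF assms(1)] by (simp add: P_def)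
  have "(\<Sum>k=mu..<Suc M. inv_factor q n k mu * (1 / q) ^ (u * k) / P (M - k))
      = (\<Sum>j\<le>L. inv_factor q n (mu + j) mu * (1 / q) ^ (u * (mu + j)) / P (L - j))"
    by (rule sum.reindex_bij_witness[of _ "\<lambda>j. mu + j" "\<lambda>k. k - mu"]) (auto simp: M add.commute)
  also have "\<dots> = (\<Sum>j\<le>L. C * ((-1) ^ j * (1 / q) ^ (j choose 2) * z ^ j * qbinomial L j (1 / q) / P L))"
  proof (rule sum.cong)
    fix j assume "j \<in> {..L}"
    then have qb: "qbinomial L j (1 / q) = P L / (P j * P (L - j))" by (simp add: qbinomial_def P_def)
    show "inv_factor q n (mu + j) mu * (1 / q) ^ (u * (mu + j)) / P (L - j)
        = C * ((-1) ^ j * (1 / q) ^ (j choose 2) * z ^ j * qbinomial L j (1 / q) / P L)"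
      unfolding inv_factor_weighted euler_coeff_def qb P_def[symmetric] z_def[symmetric] C_def[symmetric]
      using P[of L] by (simp add: field_simps)
  qed simp
  also have "\<dots> = C * (qpochhammer z (1 / q) L / P L)"
  proof -
    have "(1 / q) ^ j \<noteq> 1" if "0 < j" for j
      using power_Suc_less_one[of "1 / q" "j - 1"] assms that by (intro less_imp_neq) simp
    from qbinomial_theorem[OF this, where n = L and z = z] show ?thesis
      by (simp add: sum_distrib_left[symmetric] sum_divide_distrib[symmetric])
  qed
  finally show ?thesis unfolding P_def C_def z_def by (simp add: M)
qed

text \<open>
  The moments of negative discriminants correspond to \<open>u = 0\<close>, those of positive ones to \<open>u = 1\<close>.
\<close>

definition weight :: "real \<Rightarrow> nat \<Rightarrow> nat \<Rightarrow> (nat \<Rightarrow> nat) \<Rightarrow> real" where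
  "weight q u l n = (1 / q) ^ (u * (\<Sum>i<l. n i))"

lemma weight_Suc: "weight q u (Suc l) (case_nat k n) = (1 / q) ^ (u * k) * weight q u l n"
  by (simp add: weight_def sum.lessThan_Suc_shift power_add distrib_left del: sum.lessThan_Suc)

text \<open>M stands for the rank one level up. Summing over the first entry by
  \<open>inv_factor_sum\<close> leaves the denominator indexed by \<open>mu 0 - n 0\<close>, which
  is the same situation one level down with \<open>mu 0\<close> in the role of M.\<close>

lemma interlacing_weighted_sum:
  assumes "1 < q" "antimono mu" "mu 0 \<le> M"
  shows "(\<Sum>n\<in>interlacing l mu (Suc M).
            inv_product q l n mu * weight q u l n / qpochhammer (1 / q) (1 / q) (M - n 0))
    = (\<Prod>i<l. (1 / q) ^ ((mu i)\<^sup>2 + u * mu i) *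
          qpochhammer ((1 / q) ^ (mu i + 1 + u)) (1 / q) (case_nat M mu i - mu i) /
          qpochhammer (1 / q) (1 / q) (case_nat M mu i - mu i)) /
      qpochhammer (1 / q) (1 / q) (case_nat M mu l)"
  using assms(2,3)
proof (induction l arbitrary: mu M)
  case 0 then show ?case by (simp add: inv_product_def weight_def)
next
  case (Suc l)
  define P where "P = qpochhammer (1 / q) (1 / q)"
  define z where "z m = (1 / q) ^ (m + 1 + u)" for m
  define Z where "Z m = qpochhammer (z m) (1 / q)" for m
  define I where "I n = inv_product q l n (mu \<circ> Suc) * weight q u l n" for n
  define h where "h i = (1 / q) ^ ((mu i)\<^sup>2 + u * mu i) *
          Z (mu i) (case_nat M mu i - mu i) / P (case_nat M mu i - mu i)" for i
  let ?J = "interlacing l (mu \<circ> Suc) (Suc (mu 0))"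
  have "(\<Sum>n\<in>interlacing (Suc l) mu (Suc M). inv_product q (Suc l) n mu * weight q u (Suc l) n / P (M - n 0))
      = (\<Sum>n\<in>?J. I n * (\<Sum>k=mu 0..<Suc M. inv_factor q (n 0) k (mu 0) * (1 / q) ^ (u * k) / P (M - k)))"
    unfolding sum_interlacing_Suc inv_product_Suc weight_Suc I_def sum_distrib_left
    by (intro sum.cong) (simp_all add: mult_ac)
  also have "\<dots> = (\<Sum>n\<in>?J. I n * ((1 / q) ^ ((mu 0)\<^sup>2 + u * mu 0) / P (mu 0 - n 0) * (Z (mu 0) (M - mu 0) / P (M - mu 0))))"
    unfolding P_def Z_def z_def using assms(1) Suc.prems by (intro sum.cong arg_cong2[where f = "(*)"] inv_factor_sum) auto
  also have "\<dots> = h 0 * (\<Sum>n\<in>?J. I n / P (mu 0 - n 0))"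
    unfolding sum_distrib_left h_def by (intro sum.cong) (simp_all add: mult_ac)
  also have "(\<Sum>n\<in>?J. I n / P (mu 0 - n 0)) = (\<Prod>i<l. h (Suc i)) / P (case_nat M mu (Suc l))"
  proof -
    have "case_nat (mu 0) (mu \<circ> Suc) = mu" by (auto split: nat.split)
    moreover have "(mu \<circ> Suc) 0 \<le> mu 0" using Suc.prems(1) by (simp add: antimono_def)
    ultimately show ?thesis
      unfolding I_def P_def h_def Z_def z_def nat.case
      by (intro trans[OF Suc.IH[OF antimono_Suc[OF Suc.prems(1)]]]) simp_all
  qed
  also have "h 0 * ((\<Prod>i<l. h (Suc i)) / P (case_nat M mu (Suc l)))
      = (\<Prod>i<Suc l. h i) / P (case_nat M mu (Suc l))"
    by (simp add: prod.lessThan_Suc_shift del: prod.lessThan_Suc)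
  finally show ?case unfolding P_def h_def Z_def z_def .
qed

text \<open>Here \<open>l\<close> is the index of the last level, so there are l + 1 levels. The
  separate last Pochhammer factor is the one with mu_(l+1) = 0, without a condition on that value of
  \<open>mu\<close>.\<close>

definition rank_density :: "real \<Rightarrow> nat \<Rightarrow> nat \<Rightarrow> (nat \<Rightarrow> nat) \<Rightarrow> real" where
  "rank_density q u l mu =
     (1 / q) ^ (\<Sum>i\<le>l. (mu i)\<^sup>2 + u * mu i) *
     qpochhammer_inf ((1 / q) ^ (mu l + 1 + u)) (1 / q) /
     ((\<Prod>i<l. qpochhammer (1 / q) (1 / q) (mu i - mu (Suc i))) * qpochhammer (1 / q) (1 / q) (mu l))"

text \<open>The bound b affects the first entry only, whose sum converges by Euler's identity; the
  remaining finite sum is \<open>interlacing_weighted_sum\<close> with M = mu_0.\<close>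

lemma interlacing_sum_tendsto:
  assumes "1 < q" "antimono mu"
  shows "(\<lambda>b. \<Sum>n\<in>interlacing (Suc l) mu b. inv_product q (Suc l) n mu * weight q u (Suc l) n)
           \<longlonglongrightarrow> rank_density q u l mu"
proof -
  define P where "P = qpochhammer (1 / q) (1 / q)"
  define z where "z m = (1 / q) ^ (m + 1 + u)" for m
  define Zinf where "Zinf m = qpochhammer_inf (z m) (1 / q)" for m
  define g where "g i = (1 / q) ^ ((mu i)\<^sup>2 + u * mu i)" for i
  define I where "I n = inv_product q l n (mu \<circ> Suc) * weight q u l n" for n
  let ?J = "interlacing l (mu \<circ> Suc) (Suc (mu 0))"
  have "(\<lambda>b. \<Sum>k=mu 0..<b. inv_factor q m k (mu 0) * (1 / q) ^ (u * k))
      \<longlonglongrightarrow> g 0 / P (mu 0 - m) * Zinf (mu 0)" for m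
  proof (rule LIMSEQ_offset[where k = "mu 0"])
    have "(\<Sum>k=mu 0..<b + mu 0. inv_factor q m k (mu 0) * (1 / q) ^ (u * k))
        = (\<Sum>j<b. inv_factor q m (mu 0 + j) (mu 0) * (1 / q) ^ (u * (mu 0 + j)))" for b
      by (rule sum.reindex_bij_witness[of _ "\<lambda>j. mu 0 + j" "\<lambda>k. k - mu 0"]) auto
    then show "(\<lambda>b. \<Sum>k=mu 0..<b + mu 0. inv_factor q m k (mu 0) * (1 / q) ^ (u * k))
        \<longlonglongrightarrow> g 0 / P (mu 0 - m) * Zinf (mu 0)"
      using inv_factor_sums[OF assms(1), of m "mu 0" u]
      by (simp add: sums_def g_def P_def Zinf_def z_def)
  qed
  then have "(\<lambda>b. \<Sum>n\<in>?J. I n * (\<Sum>k=mu 0..<b. inv_factor q (n 0) k (mu 0) * (1 / q) ^ (u * k)))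
      \<longlonglongrightarrow> (\<Sum>n\<in>?J. I n * (g 0 / P (mu 0 - n 0) * Zinf (mu 0)))"
    by (intro tendsto_intros)
  moreover have "(\<Sum>n\<in>interlacing (Suc l) mu b. inv_product q (Suc l) n mu * weight q u (Suc l) n)
      = (\<Sum>n\<in>?J. I n * (\<Sum>k=mu 0..<b. inv_factor q (n 0) k (mu 0) * (1 / q) ^ (u * k)))" for b
    unfolding sum_interlacing_Suc inv_product_Suc weight_Suc I_def sum_distrib_left
    by (intro sum.cong) (simp_all add: mult_ac)
  moreover have "(\<Sum>n\<in>?J. I n * (g 0 / P (mu 0 - n 0) * Zinf (mu 0))) = rank_density q u l mu"
  proof -
    have le: "mu (Suc i) \<le> mu i" for i using assms(2) by (simp add: antimono_def)
    have "(\<Sum>n\<in>?J. I n * (g 0 / P (mu 0 - n 0) * Zinf (mu 0))) = g 0 * Zinf (mu 0) * (\<Sum>n\<in>?J. I n / P (mu 0 - n 0))"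
      unfolding sum_distrib_left by (intro sum.cong) simp_all
    also have "(\<Sum>n\<in>?J. I n / P (mu 0 - n 0)) =
       (\<Prod>i<l. g (Suc i) * qpochhammer (z (mu (Suc i))) (1 / q) (mu i - mu (Suc i)) / P (mu i - mu (Suc i))) / P (mu l)"
    proof -
      have "case_nat (mu 0) (mu \<circ> Suc) = mu" by (auto split: nat.split)
      then show ?thesis
        using interlacing_weighted_sum[OF assms(1) antimono_Suc[OF assms(2)], of "mu 0" l u] le[of 0]
        unfolding I_def P_def g_def z_def by simp
    qed
    also have "\<dots> = (\<Prod>i<l. g (Suc i)) * (\<Prod>i<l. qpochhammer (z (mu (Suc i))) (1 / q) (mu i - mu (Suc i)))
        / ((\<Prod>i<l. P (mu i - mu (Suc i))) * P (mu l))"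
      by (simp add: prod.distrib prod_dividef)
    also have "g 0 * Zinf (mu 0) * \<dots> = (g 0 * (\<Prod>i<l. g (Suc i))) *
        (Zinf (mu 0) * (\<Prod>i<l. qpochhammer (z (mu (Suc i))) (1 / q) (mu i - mu (Suc i))))
        / ((\<Prod>i<l. P (mu i - mu (Suc i))) * P (mu l))" by simp
    also have "g 0 * (\<Prod>i<l. g (Suc i)) = (\<Prod>i\<le>l. g i)"
      by (simp add: prod.atMost_shift)
    also have "\<dots> = (1 / q) ^ (\<Sum>i\<le>l. (mu i)\<^sup>2 + u * mu i)"
      by (simp add: g_def power_sum)
    \<comment> \<open>The finite symbols fill the gaps between consecutive arguments: z(mu_(i+1))
      times (1/q)^(mu_i - mu_(i+1)) equals z(mu_i), so all of them merge into one infinite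
      product.\<close>
    also have "Zinf (mu 0) * (\<Prod>i<l. qpochhammer (z (mu (Suc i))) (1 / q) (mu i - mu (Suc i))) = Zinf (mu l)"
    proof (induction l)
      case (Suc l)
      have "z (mu (Suc l)) * (1 / q) ^ (mu l - mu (Suc l)) = z (mu l)"
        unfolding z_def power_add[symmetric] using le[of l] by (simp add: add_ac)
      then have "Zinf (mu (Suc l)) = qpochhammer (z (mu (Suc l))) (1 / q) (mu l - mu (Suc l)) * Zinf (mu l)"
        using qpochhammer_inf_split[of "1 / q" "z (mu (Suc l))" "mu l - mu (Suc l)"] assms(1)
        by (simp add: Zinf_def)
      then show ?case using Suc by (simp add: mult_ac)
    qed simp
    finally show ?thesis unfolding rank_density_def Zinf_def z_def P_def .
  qed
  ultimately show ?thesis by simp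
qed

text \<open>For fixed deeper entries the dependence on b is through the terms of the convergent
  series in \<open>inv_factor_sums\<close>, which tend to 0; there are finitely many choices of the
  deeper entries.\<close>

lemma interlacing_error_tendsto:
  assumes "1 < q"
  shows "(\<lambda>b. \<Sum>n\<in>interlacing l (mu \<circ> Suc) (Suc (mu 0)).
            \<bar>inv_product q (Suc l) (case_nat b n) mu\<bar> * weight q u (Suc l) (case_nat b n)) \<longlonglongrightarrow> 0"
proof -
  have "(\<lambda>b. \<bar>inv_factor q m b (mu 0) * (1 / q) ^ (u * b)\<bar>) \<longlonglongrightarrow> 0" for m
  proof (rule LIMSEQ_offset[where k = "mu 0"])
    show "(\<lambda>b. \<bar>inv_factor q m (b + mu 0) (mu 0) * (1 / q) ^ (u * (b + mu 0))\<bar>) \<longlonglongrightarrow> 0"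
      using tendsto_rabs_zero[OF summable_LIMSEQ_zero[OF sums_summable[OF inv_factor_sums[OF assms, of m "mu 0" u]]]]
      by (simp add: add.commute)
  qed
  then have "(\<lambda>b. \<Sum>n\<in>interlacing l (mu \<circ> Suc) (Suc (mu 0)).
      \<bar>inv_factor q (n 0) b (mu 0) * (1 / q) ^ (u * b)\<bar> * (\<bar>inv_product q l n (mu \<circ> Suc)\<bar> * weight q u l n)) \<longlonglongrightarrow> 0"
    by (intro tendsto_null_sum tendsto_mult_left_zero)
  moreover have "\<bar>inv_factor q (n 0) b (mu 0) * (1 / q) ^ (u * b)\<bar> * (\<bar>inv_product q l n (mu \<circ> Suc)\<bar> * weight q u l n)
    = \<bar>inv_product q (Suc l) (case_nat b n) mu\<bar> * weight q u (Suc l) (case_nat b n)" for n b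
    using assms by (simp add: inv_product_Suc weight_Suc abs_mult mult_ac)
  ultimately show ?thesis by simp
qed

section \<open>Averages and the exchange of limits\<close>

definition mean :: "'a set \<Rightarrow> ('a \<Rightarrow> real) \<Rightarrow> real" where
  "mean A f = (\<Sum>a\<in>A. f a) / (\<Sum>a\<in>A. 1)"

text \<open>Over an empty or infinite set the mean is 0 by the conventions for sums and division, so
  this and the following rules carry no side condition.\<close>

lemma mean_cong: "(\<And>a. a \<in> A \<Longrightarrow> f a = g a) \<Longrightarrow> mean A f = mean A g"
  by (simp add: mean_def)

lemma mean_mono: "(\<And>a. a \<in> A \<Longrightarrow> f a \<le> g a) \<Longrightarrow> mean A f \<le> mean A g"
  by (auto simp: mean_def intro!: divide_right_mono sum_mono)

lemma mean_add: "mean A (\<lambda>a. f a + g a) = mean A f + mean A g"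
  by (simp add: mean_def sum.distrib add_divide_distrib)

lemma mean_diff: "mean A (\<lambda>a. f a - g a) = mean A f - mean A g"
  by (simp add: mean_def sum_subtractf diff_divide_distrib)

lemma mean_cmult: "mean A (\<lambda>a. c * f a) = c * mean A f"
  by (simp add: mean_def sum_distrib_left)

lemma mean_sum: "mean A (\<lambda>a. \<Sum>i\<in>I. f i a) = (\<Sum>i\<in>I. mean A (f i))"
  by (simp add: mean_def sum.swap[of _ A] sum_divide_distrib)

lemma abs_mean_le: "\<bar>mean A f\<bar> \<le> mean A (\<lambda>a. \<bar>f a\<bar>)"
  by (auto simp: mean_def abs_divide intro!: divide_right_mono)

text \<open>First b is fixed so that the truncated density and the limiting error are each within
  e/4 of their limits. Only then does X move: for this b the main sum and the error bound involve
  finitely many moments, and each comes within e/4 of its limit. The four quarters add up to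
  e.\<close>

theorem rank_density_from_surjection_moments:
  fixes D :: "'x \<Rightarrow> 'a set" and r :: "'a \<Rightarrow> nat \<Rightarrow> nat"
  assumes q: "1 < q" and mu: "antimono mu"
    and r: "\<And>X a. a \<in> D X \<Longrightarrow> antimono (r a)"
    and moments: "\<And>n. antimono n \<Longrightarrow> \<forall>i\<ge>Suc l. n i = 0 \<Longrightarrow>
        ((\<lambda>X. mean (D X) (\<lambda>a. sur_product q (Suc l) n (r a))) \<longlongrightarrow> weight q u (Suc l) n) F"
  shows "((\<lambda>X. mean (D X) (\<lambda>a. of_bool (\<forall>i<Suc l. r a i = mu i))) \<longlongrightarrow> rank_density q u l mu) F"
proof (rule tendstoI)
  fix e :: real assume "0 < e"
  define I where "I n = inv_product q (Suc l) n mu" for n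
  define S where "S X n = mean (D X) (\<lambda>a. sur_product q (Suc l) n (r a))" for X n
  define W where "W = weight q u (Suc l)"
  let ?J = "interlacing l (mu \<circ> Suc) (Suc (mu 0))"
  let ?ind = "\<lambda>a. of_bool (\<forall>i<Suc l. r a i = mu i) :: real"
  have "eventually (\<lambda>b. dist (\<Sum>n\<in>interlacing (Suc l) mu b. I n * W n) (rank_density q u l mu) < e / 4) sequentially"
    using interlacing_sum_tendsto[OF q mu, of l u] \<open>0 < e\<close> unfolding I_def W_def
    by (intro tendstoD) auto
  moreover have "eventually (\<lambda>b. dist (\<Sum>n\<in>?J. \<bar>I (case_nat b n)\<bar> * W (case_nat b n)) 0 < e / 4) sequentially"
    using interlacing_error_tendsto[OF q, of l mu u] \<open>0 < e\<close> unfolding I_def W_def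
    by (intro tendstoD) auto
  moreover have "eventually (\<lambda>b. mu 0 \<le> b) sequentially" by (rule eventually_ge_at_top)
  ultimately have "eventually (\<lambda>b. dist (\<Sum>n\<in>interlacing (Suc l) mu b. I n * W n) (rank_density q u l mu) < e / 4
      \<and> dist (\<Sum>n\<in>?J. \<bar>I (case_nat b n)\<bar> * W (case_nat b n)) 0 < e / 4 \<and> mu 0 \<le> b) sequentially"
    by eventually_elim auto
  then obtain b where b: "dist (\<Sum>n\<in>interlacing (Suc l) mu b. I n * W n) (rank_density q u l mu) < e / 4"
      "dist (\<Sum>n\<in>?J. \<bar>I (case_nat b n)\<bar> * W (case_nat b n)) 0 < e / 4" "mu 0 \<le> b"
    by (auto dest!: eventually_happens)
  have lim: "((\<lambda>X. S X n) \<longlongrightarrow> W n) F" if "n \<in> interlacing (Suc l) mu b'" for n b'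
    unfolding S_def W_def using interlacing_antimono[OF that] by (intro moments) auto
  \<comment> \<open>The error terms have first entry b, just outside the range of the main sum; they
    interlace for the bound \<open>Suc b\<close>, so the moment hypothesis covers them too.\<close>
  have in_int: "case_nat b n \<in> interlacing (Suc l) mu (Suc b)" if "n \<in> ?J" for n
    using that b(3) by (auto intro!: image_eqI[of _ _ "(n, b)"])
  have "eventually (\<lambda>X. dist (\<Sum>n\<in>interlacing (Suc l) mu b. I n * S X n) (\<Sum>n\<in>interlacing (Suc l) mu b. I n * W n) < e / 4) F"
    using \<open>0 < e\<close> by (intro tendstoD tendsto_sum tendsto_mult tendsto_const lim) auto
  moreover have "eventually (\<lambda>X. dist (\<Sum>n\<in>?J. \<bar>I (case_nat b n)\<bar> * S X (case_nat b n))
      (\<Sum>n\<in>?J. \<bar>I (case_nat b n)\<bar> * W (case_nat b n)) < e / 4) F"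
    using \<open>0 < e\<close> by (intro tendstoD tendsto_sum tendsto_mult tendsto_const lim[OF in_int]) auto
  ultimately show "eventually (\<lambda>X. dist (mean (D X) ?ind) (rank_density q u l mu) < e) F"
  proof eventually_elim
    case (elim X)
    have "\<bar>mean (D X) ?ind - (\<Sum>n\<in>interlacing (Suc l) mu b. I n * S X n)\<bar>
        = \<bar>mean (D X) (\<lambda>a. ?ind a - (\<Sum>n\<in>interlacing (Suc l) mu b. I n * sur_product q (Suc l) n (r a)))\<bar>"
      by (simp only: mean_diff mean_sum mean_cmult S_def)
    also have "\<dots> \<le> mean (D X) (\<lambda>a. \<bar>?ind a - (\<Sum>n\<in>interlacing (Suc l) mu b. I n * sur_product q (Suc l) n (r a))\<bar>)"
      by (rule abs_mean_le)
    also have "\<dots> \<le> mean (D X) (\<lambda>a. \<Sum>n\<in>?J. \<bar>I (case_nat b n)\<bar> * sur_product q (Suc l) (case_nat b n) (r a))"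
      unfolding I_def by (intro mean_mono inversion_truncated q mu r b(3))
    also have "\<dots> = (\<Sum>n\<in>?J. \<bar>I (case_nat b n)\<bar> * S X (case_nat b n))"
      by (simp only: mean_sum mean_cmult S_def)
    finally show ?case
      using elim b(1,2) unfolding dist_real_def by linarith
  qed
qed

section \<open>Torsion moments and surjection moments\<close>

text \<open>The coefficient C_{lambda,mu} in terms of the conjugates n and m of lambda and mu, that
  is, of ranks instead of parts, indexed from 0.\<close>

definition type_coeff :: "real \<Rightarrow> nat \<Rightarrow> (nat \<Rightarrow> nat) \<Rightarrow> (nat \<Rightarrow> nat) \<Rightarrow> real" where
  "type_coeff q l n m =
     (\<Prod>i<l. q ^ (m (Suc i) * (n i - m i)) * qbinomial (n i - m (Suc i)) (n i - m i) q)"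

lemma power_neq_1: "1 < q \<Longrightarrow> 0 < j \<Longrightarrow> q ^ j \<noteq> 1" for q :: real
  using one_less_power[of q j] by linarith

lemma qbinomial_symmetric: "k \<le> n \<Longrightarrow> qbinomial n (n - k) q = qbinomial n k q"
  by (simp add: qbinomial_def mult.commute)

text \<open>Cauchy's identity at q^r / q^m, after pulling q^m out of each factor. The quotient is
  kept as a real number because r may be smaller than m.\<close>

lemma one_level_hom_expansion:
  assumes q: "1 < q" and "m \<le> N"
  shows "(\<Sum>k=m..N. q ^ (m * (N - k)) * qbinomial (N - m) (N - k) q * sur_factor q m k r) = q ^ (r * N)"
proof -
  obtain L where N: "N = m + L" using assms le_Suc_ex by blast
  define x where "x = q ^ r"
  have "(\<Sum>k=m..N. q ^ (m * (N - k)) * qbinomial (N - m) (N - k) q * sur_factor q m k r)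
      = (\<Sum>i\<le>L. q ^ (m * (L - i)) * qbinomial L (L - i) q * sur_factor q m (m + i) r)"
    by (rule sum.reindex_bij_witness[of _ "\<lambda>i. m + i" "\<lambda>k. k - m"]) (auto simp: N add.commute)
  also have "\<dots> = (\<Sum>i\<le>L. x ^ m * q ^ (m * L) * (qbinomial L i q * (\<Prod>j<i. x / q ^ m - q ^ j)))"
  proof (rule sum.cong)
    fix i assume "i \<in> {..L}"
    then have i: "i \<le> L" by simp
    have "(\<Prod>j=m..<m+i. x - q ^ j) = (\<Prod>j<i. q ^ m * (x / q ^ m - q ^ j))"
      using q by (intro prod.reindex_bij_witness[of _ "\<lambda>j. m + j" "\<lambda>j. j - m"])
                 (auto simp: right_diff_distrib power_add[symmetric])
    also have "\<dots> = q ^ (m * i) * (\<Prod>j<i. x / q ^ m - q ^ j)"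
      by (simp add: prod.distrib power_mult)
    finally have *: "sur_factor q m (m + i) r = x ^ m * (q ^ (m * i) * (\<Prod>j<i. x / q ^ m - q ^ j))"
      by (simp add: sur_factor_def x_def power_mult)
    have "q ^ (m * (L - i)) * q ^ (m * i) = q ^ (m * L)"
      using i by (simp add: power_add[symmetric] distrib_left[symmetric])
    then show "q ^ (m * (L - i)) * qbinomial L (L - i) q * sur_factor q m (m + i) r
        = x ^ m * q ^ (m * L) * (qbinomial L i q * (\<Prod>j<i. x / q ^ m - q ^ j))"
      using qbinomial_symmetric[OF i, of q] unfolding * by (simp add: mult_ac)
  qed simp
  also have "\<dots> = x ^ m * q ^ (m * L) * (x / q ^ m) ^ L"
    using cauchy_binomial[of q L "x / q ^ m"] power_neq_1[OF q] by (simp add: sum_distrib_left[symmetric])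
  also have "\<dots> = x ^ N"
    using q by (simp add: N power_divide power_mult power_add)
  finally show ?thesis by (simp add: x_def power_mult)
qed

lemma is_partition_Suc: "is_partition n \<Longrightarrow> is_partition (n \<circ> Suc)"
proof -
  assume n: "is_partition n"
  have "finite (Suc -` {i. n i \<noteq> 0})"
    using n by (intro finite_vimageI) (auto simp: is_partition_def)
  then show ?thesis using n antimono_Suc by (auto simp: is_partition_def vimage_def)
qed

lemma is_partition_case_nat: "is_partition m \<Longrightarrow> m 0 \<le> k \<Longrightarrow> is_partition (case_nat k m)"
proof -
  assume m: "is_partition m" "m 0 \<le> k"
  have "{i. case_nat k m i \<noteq> 0} \<subseteq> insert 0 (Suc ` {i. m i \<noteq> 0})"
  proof
    fix x assume "x \<in> {i. case_nat k m i \<noteq> 0}"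
    then show "x \<in> insert 0 (Suc ` {i. m i \<noteq> 0})" by (cases x) auto
  qed
  then have "finite {i. case_nat k m i \<noteq> 0}"
    by (rule finite_subset) (use m in \<open>auto simp: is_partition_def\<close>)
  moreover have "antimono (case_nat k m)"
    using m unfolding is_partition_def antimono_iff_le_Suc by (auto split: nat.split)
  ultimately show ?thesis unfolding is_partition_def by blast
qed

lemma subpartitions_Suc:
  "subpartitions n = (\<lambda>(m, k). case_nat k m) ` (SIGMA m:subpartitions (n \<circ> Suc). {m 0..n 0})"
proof (intro equalityI subsetI)
  fix m assume m: "m \<in> subpartitions n"
  have "m = case_nat (m 0) (m \<circ> Suc)" by (auto split: nat.split)
  moreover have "m \<circ> Suc \<in> subpartitions (n \<circ> Suc)" "m (Suc 0) \<le> m 0" "m 0 \<le> n 0"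
    using m by (auto simp: subpartitions_def is_partition_Suc) (auto simp: is_partition_def antimono_def)
  ultimately show "m \<in> (\<lambda>(m, k). case_nat k m) ` (SIGMA m:subpartitions (n \<circ> Suc). {m 0..n 0})"
    by (auto intro!: image_eqI[of _ _ "(m \<circ> Suc, m 0)"])
next
  fix m' assume "m' \<in> (\<lambda>(m, k). case_nat k m) ` (SIGMA m:subpartitions (n \<circ> Suc). {m 0..n 0})"
  then show "m' \<in> subpartitions n"
    by (auto simp: subpartitions_def is_partition_case_nat split: nat.split)
qed

lemma sum_subpartitions_Suc:
  assumes "finite (subpartitions (n \<circ> Suc))"
  shows "sum f (subpartitions n) = (\<Sum>m\<in>subpartitions (n \<circ> Suc). \<Sum>k=m 0..n 0. f (case_nat k m))"
  by (subst subpartitions_Suc, subst sum.reindex[OF inj_case_nat])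
     (simp add: sum.Sigma assms case_prod_unfold)

lemma subpartitions_zero:
  assumes "\<forall>i. n i = 0"
  shows "subpartitions n = {\<lambda>_. 0}"
  using assms by (auto simp: subpartitions_def is_partition_def antimono_def)

lemma finite_subpartitions_supported:
  "\<forall>i\<ge>l. n i = 0 \<Longrightarrow> finite (subpartitions n)"
proof (induction l arbitrary: n)
  case (Suc l)
  then show ?case by (subst subpartitions_Suc) (auto intro!: finite_SigmaI)
qed (simp add: subpartitions_zero)

text \<open>The right-hand side is the number of homomorphisms from a group with ranks r to one with
  ranks n, sorted on the left by image. The proof is algebraic: each level contributes one instance
  of \<open>one_level_hom_expansion\<close>.\<close>

lemma hom_expansion:
  assumes "1 < q" "is_partition n" "\<forall>i\<ge>l. n i = 0"
  shows "(\<Sum>m\<in>subpartitions n. type_coeff q l n m * sur_product q l m r) = q ^ (\<Sum>i<l. r i * n i)"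
  using assms(2,3)
proof (induction l arbitrary: n r)
  case 0
  then show ?case by (simp add: subpartitions_zero type_coeff_def sur_product_def)
next
  case (Suc l)
  have fin: "finite (subpartitions (n \<circ> Suc))"
    using Suc.prems by (intro finite_subpartitions_supported[of l]) auto
  let ?CS = "\<lambda>m. type_coeff q l (n \<circ> Suc) m * sur_product q l m (r \<circ> Suc)"
  have "(\<Sum>m\<in>subpartitions n. type_coeff q (Suc l) n m * sur_product q (Suc l) m r)
      = (\<Sum>m\<in>subpartitions (n \<circ> Suc). ?CS m * (\<Sum>k=m 0..n 0.
            q ^ (m 0 * (n 0 - k)) * qbinomial (n 0 - m 0) (n 0 - k) q * sur_factor q (m 0) k (r 0)))"
    unfolding sum_subpartitions_Suc[OF fin] sur_product_Suc sum_distrib_left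
    by (intro sum.cong) (simp_all add: type_coeff_def prod.lessThan_Suc_shift mult_ac del: prod.lessThan_Suc)
  also have "\<dots> = (\<Sum>m\<in>subpartitions (n \<circ> Suc). ?CS m * q ^ (r 0 * n 0))"
  proof (intro sum.cong arg_cong2[where f = "(*)"] one_level_hom_expansion assms(1) refl)
    fix m assume "m \<in> subpartitions (n \<circ> Suc)"
    then have "m 0 \<le> n 1" by (auto simp: subpartitions_def)
    also have "\<dots> \<le> n 0" using Suc.prems(1) by (simp add: is_partition_def antimono_def)
    finally show "m 0 \<le> n 0" .
  qed
  also have "\<dots> = q ^ (\<Sum>i<l. (r \<circ> Suc) i * (n \<circ> Suc) i) * q ^ (r 0 * n 0)"
    unfolding sum_distrib_right[symmetric]
    using Suc.prems by (subst Suc.IH[OF is_partition_Suc]) auto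
  also have "\<dots> = q ^ (\<Sum>i<Suc l. r i * n i)"
    by (simp add: sum.lessThan_Suc_shift power_add mult.commute del: sum.lessThan_Suc)
  finally show ?case .
qed

lemma type_coeff_self [simp]: "1 < q \<Longrightarrow> type_coeff q l n n = 1"
  using qbinomial_0[of q] power_neq_1[of q] by (simp add: type_coeff_def)

text \<open>Both the actual moments and their claimed limits satisfy the same triangular system with
  diagonal entries \<open>type_coeff q l n n = 1\<close>. It is solved by induction on the sum of
  the entries of n, every other subpartition having a smaller sum.\<close>

theorem surjection_moments_from_hom_moments:
  fixes D :: "'x \<Rightarrow> 'a set" and r :: "'a \<Rightarrow> nat \<Rightarrow> nat"
  assumes q: "1 < q"
    and hom: "\<And>n. is_partition n \<Longrightarrow> \<forall>i\<ge>l. n i = 0 \<Longrightarrow>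
        ((\<lambda>X. mean (D X) (\<lambda>a. q ^ (\<Sum>i<l. r a i * n i))) \<longlongrightarrow>
          (\<Sum>m\<in>subpartitions n. type_coeff q l n m * weight q u l m)) F"
    and n: "is_partition n" "\<forall>i\<ge>l. n i = 0"
  shows "((\<lambda>X. mean (D X) (\<lambda>a. sur_product q l n (r a))) \<longlongrightarrow> weight q u l n) F"
  using n
proof (induction "\<Sum>i<l. n i" arbitrary: n rule: less_induct)
  case less
  define R where "R = subpartitions n - {n}"
  have fin: "finite (subpartitions n)"
    using less.prems(2) by (rule finite_subpartitions_supported)
  have n: "n \<in> subpartitions n" using less.prems by (simp add: subpartitions_def)
  have split: "(\<Sum>m\<in>subpartitions n. type_coeff q l n m * f m) = f n + (\<Sum>m\<in>R. type_coeff q l n m * f m)"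
    for f :: "(nat \<Rightarrow> nat) \<Rightarrow> real"
    unfolding R_def using sum.remove[OF fin n, of "\<lambda>m. type_coeff q l n m * f m"] q by simp
  have IH: "((\<lambda>X. mean (D X) (\<lambda>a. sur_product q l m (r a))) \<longlongrightarrow> weight q u l m) F" if "m \<in> R" for m
  proof (rule less.hyps)
    have m: "is_partition m" "\<forall>i. m i \<le> n i" "m \<noteq> n"
      using that by (auto simp: R_def subpartitions_def)
    then show "is_partition m" "\<forall>i\<ge>l. m i = 0" using less.prems(2) by (auto, metis le_zero_eq)
    then obtain i where "m i \<noteq> n i" using m(3) by blast
    moreover then have "i < l" using less.prems(2) \<open>\<forall>i\<ge>l. m i = 0\<close> by (metis not_less)
    ultimately have "i < l" "m i < n i" using m(2) le_neq_implies_less by metis+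
    then show "(\<Sum>i<l. m i) < (\<Sum>i<l. n i)"
      using m(2) by (intro sum_strict_mono_ex1 bexI[of _ i]) auto
  qed
  have "((\<lambda>X. mean (D X) (\<lambda>a. q ^ (\<Sum>i<l. r a i * n i)) -
          (\<Sum>m\<in>R. type_coeff q l n m * mean (D X) (\<lambda>a. sur_product q l m (r a))))
        \<longlongrightarrow> (\<Sum>m\<in>subpartitions n. type_coeff q l n m * weight q u l m)
            - (\<Sum>m\<in>R. type_coeff q l n m * weight q u l m)) F"
    by (intro tendsto_diff hom less.prems tendsto_sum tendsto_mult tendsto_const IH)
  moreover have "mean (D X) (\<lambda>a. q ^ (\<Sum>i<l. r a i * n i)) -
          (\<Sum>m\<in>R. type_coeff q l n m * mean (D X) (\<lambda>a. sur_product q l m (r a)))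
      = mean (D X) (\<lambda>a. sur_product q l n (r a))" for X
    unfolding hom_expansion[OF q less.prems, symmetric] split mean_add mean_sum mean_cmult by simp
  ultimately show ?case unfolding split by simp
qed

section \<open>Conjugate partitions: from part multiplicities to ranks\<close>

definition conjugate :: "(nat \<Rightarrow> nat) \<Rightarrow> nat \<Rightarrow> nat" where
  "conjugate lam i = card {j. i < lam j}"

text \<open>The set \<open>{j. i < lam j}\<close> is an initial segment of the naturals, hence
  determined by its cardinality. The resulting symmetry between i and j yields monotonicity and
  involutivity of \<open>conjugate\<close>, whose index is one below that of
  \<open>conj_part\<close>.\<close>

lemma less_conjugate_iff:
  assumes "is_partition lam"
  shows "j < conjugate lam i \<longleftrightarrow> i < lam j"
proof -
  define A where "A = {j. i < lam j}"
  have "A \<subseteq> {j. lam j \<noteq> 0}" by (auto simp: A_def)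
  then have fin: "finite A" using assms finite_subset unfolding is_partition_def by blast
  have down: "j \<in> A" if "k \<in> A" "j \<le> k" for j k
    using assms that unfolding A_def is_partition_def antimono_def by (auto intro: less_le_trans)
  have "A = {..<card A}"
  proof (rule ccontr)
    assume ne: "A \<noteq> {..<card A}"
    show False
    proof (cases "A \<subseteq> {..<card A}")
      case True
      then show False using ne by (simp add: card_subset_eq)
    next
      case False
      then obtain k where "k \<in> A" "\<not> k < card A" by blast
      then have "{..card A} \<subseteq> A" using down by auto
      then have "card {..card A} \<le> card A" using fin by (rule card_mono[rotated])
      then show False by simp
    qed
  qed
  then show ?thesis unfolding conjugate_def A_def by blast
qed

lemma is_partition_conjugate:
  assumes "is_partition lam"
  shows "is_partition (conjugate lam)"
proof -
  have "antimono (conjugate lam)"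
  proof (rule antimonoI)
    fix i j :: nat assume "i \<le> j"
    show "conjugate lam j \<le> conjugate lam i"
    proof (rule ccontr)
      assume "\<not> conjugate lam j \<le> conjugate lam i"
      then have "j < lam (conjugate lam i)" using less_conjugate_iff[OF assms] by (simp add: not_le)
      then have "conjugate lam i < conjugate lam i"
        using less_conjugate_iff[OF assms] \<open>i \<le> j\<close> by (meson le_less_trans)
      then show False by simp
    qed
  qed
  moreover have "{i. conjugate lam i \<noteq> 0} \<subseteq> {..<lam 0}"
    using less_conjugate_iff[OF assms] by auto
  then have "finite {i. conjugate lam i \<noteq> 0}" by (rule finite_subset) simp
  ultimately show ?thesis unfolding is_partition_def by blast
qed

lemma conjugate_conjugate:
  assumes "is_partition lam"
  shows "conjugate (conjugate lam) = lam"
proof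
  fix i
  have "{j. i < conjugate lam j} = {..<lam i}" using less_conjugate_iff[OF assms] by auto
  then show "conjugate (conjugate lam) i = lam i" by (simp add: conjugate_def[of "conjugate lam"])
qed

lemma conjugate_mono:
  assumes "is_partition lam" "is_partition mu" "\<forall>i. mu i \<le> lam i"
  shows "conjugate mu i \<le> conjugate lam i"
proof (rule ccontr)
  assume "\<not> conjugate mu i \<le> conjugate lam i"
  then have "i < mu (conjugate lam i)" using less_conjugate_iff[OF assms(2)] by (simp add: not_le)
  also have "\<dots> \<le> lam (conjugate lam i)" using assms(3) by simp
  finally show False using less_conjugate_iff[OF assms(1)] by blast
qed

lemma bij_betw_conjugate:
  assumes "is_partition lam"
  shows "bij_betw conjugate (subpartitions lam) (subpartitions (conjugate lam))"
proof (rule bij_betwI[where g = conjugate])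
  show "conjugate \<in> subpartitions lam \<rightarrow> subpartitions (conjugate lam)"
    using assms by (auto simp: subpartitions_def is_partition_conjugate conjugate_mono)
  show "conjugate \<in> subpartitions (conjugate lam) \<rightarrow> subpartitions lam"
  proof
    fix mu assume "mu \<in> subpartitions (conjugate lam)"
    then show "conjugate mu \<in> subpartitions lam"
      using conjugate_mono[OF is_partition_conjugate[OF assms], of mu] assms
      by (auto simp: subpartitions_def is_partition_conjugate conjugate_conjugate)
  qed
qed (auto simp: subpartitions_def conjugate_conjugate is_partition_conjugate assms)

lemma conj_part_Suc:
  assumes "is_partition lam"
  shows "conj_part lam (Suc i) = conjugate lam i"
proof -
  have fin: "finite {k. lam k = j}" if "j \<in> {Suc i..lam 0}" for j
  proof -
    have "{k. lam k = j} \<subseteq> {k. lam k \<noteq> 0}" using that by auto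
    then show ?thesis using assms finite_subset unfolding is_partition_def by blast
  qed
  have "conj_part lam (Suc i) = card (\<Union>j\<in>{Suc i..lam 0}. {k. lam k = j})"
    unfolding conj_part_def part_mult_def by (subst card_UN_disjoint) (use fin in auto)
  also have "(\<Union>j\<in>{Suc i..lam 0}. {k. lam k = j}) = {k. i < lam k}"
    using assms by (auto simp: is_partition_def antimono_def)
  finally show ?thesis by (simp add: conjugate_def)
qed

lemma conjugate_eq_0_iff:
  assumes "is_partition lam"
  shows "conjugate lam i = 0 \<longleftrightarrow> lam 0 \<le> i"
  using less_conjugate_iff[OF assms, of 0 i] by auto

text \<open>Besides the shift of index by one, the product is extended from \<open>lam 0\<close> to
  l levels; the added factors have n = m = 0 and equal 1.\<close>

lemma subgroup_coeff_eq:
  assumes "is_partition lam" "mu \<in> subpartitions lam" "lam 0 \<le> l"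
  shows "subgroup_coeff lam mu q = type_coeff q l (conjugate lam) (conjugate mu)"
proof -
  define n m where "n = conjugate lam" and "m = conjugate mu"
  have mu: "is_partition mu" "mu 0 \<le> lam 0" using assms(2) by (auto simp: subpartitions_def)
  have cp: "conj_part lam i = n (i - 1)" "conj_part mu i = m (i - 1)" "conj_part mu (i + 1) = m i"
    if "i \<in> {1..lam 0}" for i
    using that conj_part_Suc[OF assms(1), of "i - 1"] conj_part_Suc[OF mu(1), of "i - 1"]
      conj_part_Suc[OF mu(1), of i] by (auto simp: n_def m_def)
  have "subgroup_coeff lam mu q = (\<Prod>i=1..lam 0.
      q ^ (m i * (n (i - 1) - m (i - 1))) * qbinomial (n (i - 1) - m i) (n (i - 1) - m (i - 1)) q)"
    unfolding subgroup_coeff_def power_sum prod.distrib[symmetric]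
    by (intro prod.cong) (simp_all only: cp)
  also have "\<dots> = (\<Prod>i<lam 0. q ^ (m (Suc i) * (n i - m i)) * qbinomial (n i - m (Suc i)) (n i - m i) q)"
    by (rule prod.reindex_bij_witness[of _ Suc "\<lambda>i. i - 1"]) auto
  also have "\<dots> = type_coeff q l n m"
    unfolding type_coeff_def
  proof (rule prod.mono_neutral_left)
    show "\<forall>i\<in>{..<l} - {..<lam 0}. q ^ (m (Suc i) * (n i - m i)) * qbinomial (n i - m (Suc i)) (n i - m i) q = 1"
    proof
      fix i assume "i \<in> {..<l} - {..<lam 0}"
      then have "n i = 0" "m i = 0" "m (Suc i) = 0"
        using mu(2) by (auto simp: n_def m_def conjugate_eq_0_iff mu(1) assms(1))
      then show "q ^ (m (Suc i) * (n i - m i)) * qbinomial (n i - m (Suc i)) (n i - m i) q = 1"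
        by (simp add: qbinomial_def)
    qed
  qed (use assms in auto)
  finally show ?thesis by (simp add: n_def m_def)
qed

text \<open>The cells of the diagram are counted by columns instead of rows.\<close>

lemma partition_size_eq:
  assumes "is_partition mu" "mu 0 \<le> l"
  shows "partition_size mu = (\<Sum>i<l. conjugate mu i)"
proof -
  let ?S = "{j. mu j \<noteq> 0}"
  have fin: "finite ?S" using assms by (simp add: is_partition_def)
  have le: "mu j \<le> l" for j using assms antimonoD[of mu 0 j] by (simp add: is_partition_def)
  have "(\<Sum>i<l. conjugate mu i) = (\<Sum>i<l. \<Sum>j\<in>?S. of_bool (i < mu j))"
  proof (rule sum.cong)
    fix i
    have "{j. i < mu j} = ?S \<inter> {j. i < mu j}" by auto
    then show "conjugate mu i = (\<Sum>j\<in>?S. of_bool (i < mu j))"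
      using fin by (simp add: conjugate_def)
  qed simp
  also have "\<dots> = (\<Sum>j\<in>?S. \<Sum>i<l. of_bool (i < mu j))" by (rule sum.swap)
  also have "\<dots> = (\<Sum>j\<in>?S. mu j)"
  proof (rule sum.cong)
    fix j
    have "{..<l} \<inter> {i. i < mu j} = {..<mu j}" using le[of j] by auto
    then show "(\<Sum>i<l. of_bool (i < mu j)) = mu j" by simp
  qed simp
  finally show ?thesis by (simp add: partition_size_def)
qed

text \<open>In the exponent, the rank with index k occurs once for every part greater than k, and
  the number of such parts is \<open>conjugate lam k\<close>; exchanging the two sums shows
  this.\<close>

lemma torsion_moment_eq:
  fixes p l :: nat
  assumes "is_partition lam" "lam 0 \<le> l"
    and "\<And>i. i \<in> {1..l} \<Longrightarrow> card (torsion G (p ^ i)) = p ^ (\<Sum>k<i. r k)"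
  shows "torsion_moment p l lam G = real p ^ (\<Sum>i<l. r i * conjugate lam i)"
proof -
  have "torsion_moment p l lam G = (\<Prod>i=1..l. real p ^ ((\<Sum>k<i. r k) * part_mult lam i))"
    unfolding torsion_moment_def using assms(3) by (intro prod.cong) (simp_all add: power_mult)
  also have "\<dots> = real p ^ (\<Sum>i=1..l. \<Sum>k<i. r k * part_mult lam i)"
    by (simp add: power_sum sum_distrib_right)
  also have "(\<Sum>i=1..l. \<Sum>k<i. r k * part_mult lam i) = (\<Sum>i=1..l. \<Sum>k\<in>{k\<in>{..<l}. k < i}. r k * part_mult lam i)"
    by (intro sum.cong) auto
  also have "\<dots> = (\<Sum>k<l. \<Sum>i\<in>{i\<in>{1..l}. k < i}. r k * part_mult lam i)"
    by (rule sum.swap_restrict) auto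
  also have "\<dots> = (\<Sum>k<l. \<Sum>i=Suc k..l. r k * part_mult lam i)"
    by (intro sum.cong) auto
  also have "\<dots> = (\<Sum>k<l. r k * conjugate lam k)"
  proof (rule sum.cong)
    fix k
    have "(\<Sum>i=Suc k..l. part_mult lam i) = (\<Sum>i=Suc k..lam 0. part_mult lam i)"
    proof (rule sum.mono_neutral_right)
      show "\<forall>i\<in>{Suc k..l} - {Suc k..lam 0}. part_mult lam i = 0"
      proof
        fix i assume "i \<in> {Suc k..l} - {Suc k..lam 0}"
        moreover have "lam j \<le> lam 0" for j
          using assms(1) antimonoD[of lam 0 j] by (simp add: is_partition_def)
        ultimately have "{j. lam j = i} = {}"
          by (auto simp: not_le dest: leD)
        then show "part_mult lam i = 0" by (simp add: part_mult_def)
      qed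
    qed (use assms in auto)
    then show "(\<Sum>i=Suc k..l. r k * part_mult lam i) = r k * conjugate lam k"
      using conj_part_Suc[OF assms(1), of k] by (simp add: sum_distrib_left[symmetric] conj_part_def)
  qed simp
  finally show ?thesis .
qed

text \<open>Conjugation translates the hypotheses: sequences n supported on l + 1 levels are the
  conjugates of partitions with parts at most l + 1, and the same bijection matches the
  subpartitions on the limit side.\<close>

theorem rank_density_from_torsion_moments:
  fixes D :: "'x \<Rightarrow> 'a set" and G :: "'a \<Rightarrow> ('b, 'c) monoid_scheme" and p l u :: nat
  assumes p: "1 < p" and mu: "antimono mu"
    and r: "\<And>X a. a \<in> D X \<Longrightarrow> antimono (r a)"
    and torsion: "\<And>X a i. a \<in> D X \<Longrightarrow> i \<in> {1..Suc l} \<Longrightarrow> card (torsion (G a) (p ^ i)) = p ^ (\<Sum>k<i. r a k)"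
    and moments: "\<And>lam. is_partition lam \<Longrightarrow> lam 0 \<le> Suc l \<Longrightarrow>
      ((\<lambda>X. mean (D X) (\<lambda>a. torsion_moment p (Suc l) lam (G a))) \<longlongrightarrow>
        (\<Sum>mu\<in>subpartitions lam. subgroup_coeff lam mu (real p) * (1 / real p) ^ (u * partition_size mu))) F"
  shows "((\<lambda>X. mean (D X) (\<lambda>a. of_bool (\<forall>i<Suc l. r a i = mu i))) \<longlongrightarrow> rank_density (real p) u l mu) F"
proof -
  have hom: "((\<lambda>X. mean (D X) (\<lambda>a. real p ^ (\<Sum>i<Suc l. r a i * n i))) \<longlongrightarrow>
      (\<Sum>m\<in>subpartitions n. type_coeff (real p) (Suc l) n m * weight (real p) u (Suc l) m)) F"
    if n: "is_partition n" "\<forall>i\<ge>Suc l. n i = 0" for n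
  proof -
    define lam where "lam = conjugate n"
    have lam: "is_partition lam" "conjugate lam = n"
      using n by (simp_all add: lam_def is_partition_conjugate conjugate_conjugate)
    have le: "lam 0 \<le> Suc l"
      using conjugate_eq_0_iff[OF lam(1), of "Suc l"] n(2) by (simp add: lam(2))
    have "(\<Sum>mu\<in>subpartitions lam. subgroup_coeff lam mu (real p) * (1 / real p) ^ (u * partition_size mu))
        = (\<Sum>m\<in>subpartitions n. type_coeff (real p) (Suc l) n m * weight (real p) u (Suc l) m)"
    proof -
      have "(\<Sum>mu\<in>subpartitions lam. subgroup_coeff lam mu (real p) * (1 / real p) ^ (u * partition_size mu))
        = (\<Sum>mu\<in>subpartitions lam. type_coeff (real p) (Suc l) n (conjugate mu) * weight (real p) u (Suc l) (conjugate mu))"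
      proof (rule sum.cong)
        fix mu assume mu: "mu \<in> subpartitions lam"
        then have "is_partition mu" "mu 0 \<le> lam 0" by (auto simp: subpartitions_def)
        note size = partition_size_eq[OF this(1) order_trans[OF this(2) le]]
        show "subgroup_coeff lam mu (real p) * (1 / real p) ^ (u * partition_size mu)
            = type_coeff (real p) (Suc l) n (conjugate mu) * weight (real p) u (Suc l) (conjugate mu)"
          using subgroup_coeff_eq[OF lam(1) mu le] by (simp only: size weight_def lam(2))
      qed simp
      also have "\<dots> = (\<Sum>m\<in>subpartitions n. type_coeff (real p) (Suc l) n m * weight (real p) u (Suc l) m)"
        by (rule sum.reindex_bij_betw[OF bij_betw_conjugate[OF lam(1), unfolded lam(2)]])
      finally show ?thesis .
    qed
    moreover have "mean (D X) (\<lambda>a. torsion_moment p (Suc l) lam (G a))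
        = mean (D X) (\<lambda>a. real p ^ (\<Sum>i<Suc l. r a i * n i))" for X
    proof (rule mean_cong)
      fix a assume "a \<in> D X"
      then show "torsion_moment p (Suc l) lam (G a) = real p ^ (\<Sum>i<Suc l. r a i * n i)"
        using torsion_moment_eq[OF lam(1) le torsion[of a X]] lam(2) by simp
    qed
    ultimately show ?thesis using moments[OF lam(1) le] by simp
  qed
  have "1 < real p" using p by simp
  have sur: "((\<lambda>X. mean (D X) (\<lambda>a. sur_product (real p) (Suc l) n (r a))) \<longlongrightarrow> weight (real p) u (Suc l) n) F"
    if n: "antimono n" "\<forall>i\<ge>Suc l. n i = 0" for n
  proof -
    have "{i. n i \<noteq> 0} \<subseteq> {..<Suc l}"
    proof
      fix i assume "i \<in> {i. n i \<noteq> 0}"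
      with spec[OF n(2), of i] show "i \<in> {..<Suc l}" by auto
    qed
    then have "finite {i. n i \<noteq> 0}" by (rule finite_subset) simp
    then have "is_partition n" using n(1) by (simp add: is_partition_def)
    from surjection_moments_from_hom_moments[where D = D and r = r, OF \<open>1 < real p\<close> hom this n(2)]
    show ?thesis .
  qed
  from rank_density_from_surjection_moments[where D = D and r = r, OF \<open>1 < real p\<close> mu r sur]
  show ?thesis .
qed

section \<open>Distribution of the ranks\<close>

lemma class_group_average_mean:
  "class_group_average s f c \<longleftrightarrow>
     ((\<lambda>X. mean (discriminants_below s X) (\<lambda>d. f (class_group d))) \<longlongrightarrow> c) at_top"
  by (simp add: class_group_average_def mean_def)

text \<open>Treats both signs at once, the limiting moments being weighted by |mu|^-th powers of
  p^(-u); what remains is the shift from indices starting at 1 to indices starting at 0.\<close>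

theorem class_group_rank_probability:
  fixes p l u :: nat and mu :: "nat \<Rightarrow> nat"
  assumes p: "Factorial_Ring.prime p" and l: "1 \<le> l"
    and moments: "\<And>lam. is_partition lam \<Longrightarrow> lam 0 \<le> l \<Longrightarrow>
      class_group_average s (torsion_moment p l lam)
        (\<Sum>mu\<in>subpartitions lam. subgroup_coeff lam mu (real p) * (1 / real p) ^ (u * partition_size mu))"
    and mu: "\<forall>j\<in>{1..<l}. mu (j + 1) \<le> mu j" "mu (l + 1) = 0"
  shows "class_group_probability s (\<lambda>G. \<forall>j\<in>{1..l}. prime_power_rank p j G = mu j)
    (qpochhammer_inf (1 / real p ^ (mu l + 1 + u)) (1 / real p) /
      (real p ^ ((\<Sum>j=1..l. (mu j)\<^sup>2) + u * (\<Sum>j=1..l. mu j)) *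
       (\<Prod>j=1..l. qpochhammer (1 / real p) (1 / real p) (mu j - mu (j + 1)))))"
proof -
  obtain k where k: "l = Suc k" using l by (cases l) auto
  \<comment> \<open>The values of \<open>mu\<close> beyond l + 1 are unconstrained, so the shifted
    sequence is cut off by zeros to be decreasing everywhere.\<close>
  define nu where "nu i = (if i \<le> k then mu (Suc i) else 0)" for i
  define r where "r d i = prime_power_rank p (Suc i) (class_group d)" for d i
  have nu: "antimono nu"
    unfolding antimono_iff_le_Suc using mu(1) by (auto simp: nu_def k)
  have fund: "comm_group (class_group d)" "finite (carrier (class_group d))"
    if "d \<in> discriminants_below s X" for d X
    using that class_group_fundamental_discriminant unfolding discriminants_below_def by blast+
  have "((\<lambda>X. mean (discriminants_below s X) (\<lambda>d. of_bool (\<forall>i<Suc k. r d i = nu i)))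
      \<longlongrightarrow> rank_density (real p) u k nu) at_top"
  proof (rule rank_density_from_torsion_moments[where G = class_group])
    show "1 < p" using p by (rule prime_gt_1_nat)
    show "antimono nu" by (rule nu)
    show "antimono (r d)" if "d \<in> discriminants_below s X" for X d
      using comm_group.prime_power_rank_antimono[OF fund[OF that] p] unfolding r_def .
    show "card (torsion (class_group d) (p ^ i)) = p ^ (\<Sum>j<i. r d j)"
      if "d \<in> discriminants_below s X" for X d i
      using comm_group.card_torsion_prime_power[OF fund[OF that] p] unfolding r_def .
    show "((\<lambda>X. mean (discriminants_below s X) (\<lambda>d. torsion_moment p (Suc k) lam (class_group d)))
        \<longlongrightarrow> (\<Sum>mu\<in>subpartitions lam. subgroup_coeff lam mu (real p) * (1 / real p) ^ (u * partition_size mu))) at_top"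
      if "is_partition lam" "lam 0 \<le> Suc k" for lam
      using moments[unfolded class_group_average_mean, of lam] that by (simp only: k)
  qed
  moreover have "(\<forall>i<Suc k. r d i = nu i) \<longleftrightarrow> (\<forall>j\<in>{1..l}. prime_power_rank p j (class_group d) = mu j)" for d
  proof
    assume *: "\<forall>i<Suc k. r d i = nu i"
    show "\<forall>j\<in>{1..l}. prime_power_rank p j (class_group d) = mu j"
    proof
      fix j assume "j \<in> {1..l}"
      then show "prime_power_rank p j (class_group d) = mu j"
        using spec[OF *, of "j - 1"] by (auto simp: r_def nu_def k)
    qed
  qed (simp add: r_def nu_def k)
  moreover have "rank_density (real p) u k nu =
     qpochhammer_inf (1 / real p ^ (mu l + 1 + u)) (1 / real p) /
      (real p ^ ((\<Sum>j=1..l. (mu j)\<^sup>2) + u * (\<Sum>j=1..l. mu j)) *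
       (\<Prod>j=1..l. qpochhammer (1 / real p) (1 / real p) (mu j - mu (j + 1))))"
  proof -
    define Q where "Q = qpochhammer (1 / real p) (1 / real p)"
    have "(\<Sum>i\<le>k. (nu i)\<^sup>2 + u * nu i) = (\<Sum>j=1..l. (mu j)\<^sup>2 + u * mu j)"
      by (rule sum.reindex_bij_witness[of _ "\<lambda>j. j - 1" Suc]) (auto simp: nu_def k)
    then have exponent: "(\<Sum>i\<le>k. (nu i)\<^sup>2 + u * nu i) = (\<Sum>j=1..l. (mu j)\<^sup>2) + u * (\<Sum>j=1..l. mu j)"
      by (simp only: sum.distrib sum_distrib_left)
    have "(\<Prod>j=1..l. Q (mu j - mu (j + 1))) = (\<Prod>i<Suc k. Q (mu (Suc i) - mu (Suc (Suc i))))"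
      by (rule prod.reindex_bij_witness[of _ Suc "\<lambda>j. j - 1"]) (auto simp: k)
    \<comment> \<open>The factor j = l becomes the separate last factor because
      \<open>mu (l + 1) = 0\<close>.\<close>
    also have "\<dots> = (\<Prod>i<k. Q (nu i - nu (Suc i))) * Q (nu k)"
      using mu(2) by (simp add: nu_def k)
    finally show ?thesis
      unfolding rank_density_def exponent Q_def[symmetric]
      by (simp add: power_one_over nu_def k mult.commute[of "real p"] power_add)
  qed
  ultimately show ?thesis
    by (simp only: class_group_probability_def class_group_average_mean)
qed

theorem theorem1:
  fixes p l :: nat
  assumes "Factorial_Ring.prime p" and "p \<ge> 3" and "l \<ge> 1"
  shows
    "((\<forall>lam. is_partition lam \<and> lam 0 \<le> l \<longrightarrow>
         class_group_average (- 1) (torsion_moment p l lam)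
           (\<Sum>mu\<in>subpartitions lam. subgroup_coeff lam mu (real p)))
      \<longrightarrow>
      (\<forall>mu :: nat \<Rightarrow> nat. (\<forall>j\<in>{1..<l}. mu (j + 1) \<le> mu j) \<and> mu (l + 1) = 0 \<longrightarrow>
         class_group_probability (- 1) (\<lambda>G. \<forall>j\<in>{1..l}. prime_power_rank p j G = mu j)
           (qpochhammer_inf (1 / real p ^ (mu l + 1)) (1 / real p) /
            (real p ^ (\<Sum>j=1..l. (mu j)\<^sup>2) *
             (\<Prod>j=1..l. qpochhammer (1 / real p) (1 / real p) (mu j - mu (j + 1)))))))
     \<and>
     ((\<forall>L\<ge>1. \<forall>lam. is_partition lam \<and> lam 0 \<le> L \<longrightarrow>
         class_group_average 1 (torsion_moment p L lam)
           (\<Sum>mu\<in>subpartitions lam.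
              subgroup_coeff lam mu (real p) * (1 / real p ^ partition_size mu)))
      \<longrightarrow>
      (\<forall>mu :: nat \<Rightarrow> nat. (\<forall>j\<in>{1..<l}. mu (j + 1) \<le> mu j) \<and> mu (l + 1) = 0 \<longrightarrow>
         class_group_probability 1 (\<lambda>G. \<forall>j\<in>{1..l}. prime_power_rank p j G = mu j)
           (qpochhammer_inf (1 / real p ^ (mu l + 2)) (1 / real p) /
            (real p ^ ((\<Sum>j=1..l. (mu j)\<^sup>2) + (\<Sum>j=1..l. mu j)) *
             (\<Prod>j=1..l. qpochhammer (1 / real p) (1 / real p) (mu j - mu (j + 1)))))))"
proof -
  have i: "class_group_probability (- 1) (\<lambda>G. \<forall>j\<in>{1..l}. prime_power_rank p j G = mu j)
      (qpochhammer_inf (1 / real p ^ (mu l + 1)) (1 / real p) /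
        (real p ^ (\<Sum>j=1..l. (mu j)\<^sup>2) *
         (\<Prod>j=1..l. qpochhammer (1 / real p) (1 / real p) (mu j - mu (j + 1)))))"
    if "\<forall>lam. is_partition lam \<and> lam 0 \<le> l \<longrightarrow>
         class_group_average (- 1) (torsion_moment p l lam)
           (\<Sum>mu\<in>subpartitions lam. subgroup_coeff lam mu (real p))"
      and "(\<forall>j\<in>{1..<l}. mu (j + 1) \<le> mu j) \<and> mu (l + 1) = 0" for mu
    using class_group_rank_probability[where u = 0, OF assms(1,3), of "- 1" mu] that by simp
  have ii: "class_group_probability 1 (\<lambda>G. \<forall>j\<in>{1..l}. prime_power_rank p j G = mu j)
      (qpochhammer_inf (1 / real p ^ (mu l + 2)) (1 / real p) /
        (real p ^ ((\<Sum>j=1..l. (mu j)\<^sup>2) + (\<Sum>j=1..l. mu j)) *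
         (\<Prod>j=1..l. qpochhammer (1 / real p) (1 / real p) (mu j - mu (j + 1)))))"
    if *: "\<forall>L\<ge>1. \<forall>lam. is_partition lam \<and> lam 0 \<le> L \<longrightarrow>
         class_group_average 1 (torsion_moment p L lam)
           (\<Sum>mu\<in>subpartitions lam.
              subgroup_coeff lam mu (real p) * (1 / real p ^ partition_size mu))"
      and mu: "(\<forall>j\<in>{1..<l}. mu (j + 1) \<le> mu j) \<and> mu (l + 1) = 0" for mu
  proof -
    have "class_group_average 1 (torsion_moment p l lam)
        (\<Sum>mu\<in>subpartitions lam. subgroup_coeff lam mu (real p) * (1 / real p) ^ (1 * partition_size mu))"
      if "is_partition lam" "lam 0 \<le> l" for lam
      using * that assms(3) by (simp add: power_one_over)
    from class_group_rank_probability[OF assms(1,3) this, of mu] mu show ?thesis by simp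
  qed
  show ?thesis using i ii by (intro conjI impI allI) simp_all
qed

end
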